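(* Let $\mathcal Y$ be the graph defined in the context. There exist a family $\mathcal L$ of $102$ induced subgraphs of $\mathcal Y$, each isomorphic to the cuboctahedron $L(Q_3)$, and for each $y\in\mathcal L$ an admissible partition $\Omega(y)$ of $E(y)$ into $2$-paths, such that: (1) $\mathcal Y$ is connected and is the union of the members of $\mathcal L$; (2) each edge of $\mathcal Y$ lies in exactly four members of $\mathcal L$; (3) each triangle of a member $y\in\mathcal L$, and each $2$-path $\omega\in\Omega(y)$, is contained in exactly two members $y,y'$ of $\mathcal L$; (4) if two members of $\mathcal L$ share a triangle $\Delta$, then there is exactly one subgraph of $\mathcal Y$ isomorphic to $K_4$ that contains $\Delta$; (5) each $4$-hole (chordless $4$-cycle) of $\mathcal Y$ is contained in at most one member of $\mathcal L$; (6) $\mathcal Y$ is $\Omega$-preserving strongly zipped $\{L(Q_3)\}_{K_3}$-UH; (7) $\mathcal Y$ is $\{K_4,L(Q_3)\}_{K_3}$-UH; (8) the automorphism group of $\mathcal Y$ is isomorphic to $PSL(2,17)$.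
   Context: The Biggs-Smith graph $\mathcal S$ is the cubic graph on the $102$ vertices $A_i,B_i,C_i,D_i,E_i,F_i$ ($i\in\mathbb Z_{17}$) whose edges are, for every $i\in\mathbb Z_{17}$: $A_iA_{i+1}$, $D_iD_{i+2}$, $C_iC_{i+4}$, $F_iF_{i+8}$, $A_iB_i$, $B_iC_i$, $D_iE_i$, $E_iF_i$, $B_iE_i$ (indices mod $17$). The graph $\mathcal Y$ has vertex set $V(\mathcal S)$, two distinct vertices $u,v$ being adjacent iff there is a $9$-cycle $(v_0,\dots,v_8)$ of $\mathcal S$ and an index $i$ with $\{u,v\}=\{v_i,v_{i+3}\}$ (indices mod $9$). $L(Q_3)$ is the line graph of the $3$-cube (12 vertices, 24 edges, 8 triangles, 6 chordless $4$-cycles). A partition $\Omega$ of $E(L(Q_3))$ into $2$-paths is admissible if it arises from a $3$-coloring of the edges in which every triangle receives three distinct colors, opposite edges of every chordless $4$-cycle receive equal colors, and each color class is the union of four vertex-disjoint $2$-paths; $\Omega$ is the set of these twelve monochromatic $2$-paths. An isomorphism $y\to y'$ between members of $\mathcal L$ is $\Omega$-preserving if it maps every path of $\Omega(y)$ onto a path of $\Omega(y')$. Below, "copies of $L(Q_3)$" means members of $\mathcal L$. Property (6) means: (i) every isomorphism between two triangles of $\mathcal Y$ and every isomorphism between two edges of $\mathcal Y$ extends to an automorphism of $\mathcal Y$, and every $\Omega$-preserving isomorphism between two members of $\mathcal L$ extends to an automorphism of $\mathcal Y$; (ii) for every $y_0\in\mathcal L$ and triangle $\Delta$ of $y_0$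 there is exactly one $y_1\in\mathcal L\setminus\{y_0\}$ with $y_1\cap y_0\supseteq\Delta$, and $y_1\cap y_0=\Delta$ (vertex and edge sets); (iii) for every $y_0\in\mathcal L$ and edge $e$ of $y_0$ there are exactly three members $y_1,y_2,y_3\in\mathcal L\setminus\{y_0\}$ with $y_i\cap y_0\supseteq e$, and $y_1\cap y_0=e$. Property (7) means: (a) $\mathcal Y$ is $K_4$-UH (every isomorphism between induced $K_4$'s extends to an automorphism) and is an edge-disjoint union of induced copies of $K_4$; (b) property (6) holds; (c) every induced copy of $K_4$ in $\mathcal Y$ has each of its triangles in common with exactly two members of $\mathcal L$. *)

theory Defs
  imports "HOL-Analysis.Determinants" "HOL-Library.Disjoint_Sets"
    "HOL-Algebra.Coset" "HOL-Algebra.Bij"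
begin

text \<open>Edges are meant to be two-element sets of vertices. A subgraph carries its own vertex and edge
  set, so that inclusion and intersection of subgraphs compare both.\<close>

record 'a graph =
  verts :: "'a set"
  edges :: "'a set set"

definition subgraph :: "'a graph \<Rightarrow> 'a graph \<Rightarrow> bool" where
  "subgraph H G \<longleftrightarrow> verts H \<subseteq> verts G \<and> edges H \<subseteq> edges G \<and> (\<forall>e\<in>edges H. e \<subseteq> verts H)"

definition induced_subgraph :: "'a graph \<Rightarrow> 'a graph \<Rightarrow> bool" where
  "induced_subgraph H G \<longleftrightarrow> verts H \<subseteq> verts G \<and> edges H = {e \<in> edges G. e \<subseteq> verts H}"

definition graph_inter :: "'a graph \<Rightarrow> 'a graph \<Rightarrow> 'a graph" where
  "graph_inter G H = \<lparr>verts = verts G \<inter> verts H, edges = edges G \<inter> edges H\<rparr>"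

definition graph_Union :: "'a graph set \<Rightarrow> 'a graph" where
  "graph_Union \<G> = \<lparr>verts = (\<Union>G\<in>\<G>. verts G), edges = (\<Union>G\<in>\<G>. edges G)\<rparr>"

definition map_graph :: "('a \<Rightarrow> 'b) \<Rightarrow> 'a graph \<Rightarrow> 'b graph" where
  "map_graph f G = \<lparr>verts = f ` verts G, edges = (\<lambda>e. f ` e) ` edges G\<rparr>"

definition graph_connected :: "'a graph \<Rightarrow> bool" where
  "graph_connected G \<longleftrightarrow> verts G \<noteq> {} \<and>
     (\<forall>u\<in>verts G. \<forall>v\<in>verts G. (u, v) \<in> {(x, y). {x, y} \<in> edges G}\<^sup>*)"

definition graph_iso :: "('a \<Rightarrow> 'b) \<Rightarrow> 'a graph \<Rightarrow> 'b graph \<Rightarrow> bool" where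
  "graph_iso f G H \<longleftrightarrow> bij_betw f (verts G) (verts H) \<and>
     (\<forall>u\<in>verts G. \<forall>v\<in>verts G. {u, v} \<in> edges G \<longleftrightarrow> {f u, f v} \<in> edges H)"

definition graph_isomorphic :: "'a graph \<Rightarrow> 'b graph \<Rightarrow> bool" where
  "graph_isomorphic G H \<longleftrightarrow> (\<exists>f. graph_iso f G H)"

definition automorphisms :: "'a graph \<Rightarrow> ('a \<Rightarrow> 'a) set" where
  "automorphisms G = {f \<in> Bij (verts G). graph_iso f G G}"

definition aut_group :: "'a graph \<Rightarrow> ('a \<Rightarrow> 'a) monoid" where
  "aut_group G = BijGroup (verts G) \<lparr>carrier := automorphisms G\<rparr>"

definition copies :: "'a graph \<Rightarrow> 'b graph \<Rightarrow> 'a graph set" where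
  "copies G X = {H. subgraph H G \<and> graph_isomorphic H X}"

definition induced_copies :: "'a graph \<Rightarrow> 'b graph \<Rightarrow> 'a graph set" where
  "induced_copies G X = {H. induced_subgraph H G \<and> graph_isomorphic H X}"

definition complete_graph :: "nat \<Rightarrow> nat graph" where
  "complete_graph n = \<lparr>verts = {..<n}, edges = {{i, j} | i j. i < n \<and> j < n \<and> i \<noteq> j}\<rparr>"

abbreviation triangles :: "'a graph \<Rightarrow> 'a graph set" where
  "triangles G \<equiv> copies G (complete_graph 3)"

definition edge_graph :: "'a set \<Rightarrow> 'a graph" where
  "edge_graph e = \<lparr>verts = e, edges = {e}\<rparr>"

definition cycle_graph :: "'a list \<Rightarrow> 'a graph" where
  "cycle_graph vs = \<lparr>verts = set vs,
     edges = {{vs ! i, vs ! (Suc i mod length vs)} | i. i < length vs}\<rparr>"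

definition is_cycle :: "'a graph \<Rightarrow> 'a list \<Rightarrow> bool" where
  "is_cycle G vs \<longleftrightarrow> 3 \<le> length vs \<and> distinct vs \<and> subgraph (cycle_graph vs) G"

definition chordless_cycle :: "'a graph \<Rightarrow> 'a list \<Rightarrow> bool" where
  "chordless_cycle G vs \<longleftrightarrow> is_cycle G vs \<and> induced_subgraph (cycle_graph vs) G"

definition two_path :: "'a graph \<Rightarrow> bool" where
  "two_path p \<longleftrightarrow> (\<exists>u v w. distinct [u, v, w] \<and> p = \<lparr>verts = {u, v, w}, edges = {{u, v}, {v, w}}\<rparr>)"

definition line_graph :: "'a graph \<Rightarrow> 'a set graph" where
  "line_graph G = \<lparr>verts = edges G,
     edges = {{e, f} | e f. e \<in> edges G \<and> f \<in> edges G \<and> e \<noteq> f \<and> e \<inter> f \<noteq> {}}\<rparr>"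

definition hypercube :: "nat \<Rightarrow> bool list graph" where
  "hypercube n = \<lparr>verts = {xs. length xs = n},
     edges = {{xs, ys} | xs ys. length xs = n \<and> length ys = n \<and> card {i. i < n \<and> xs ! i \<noteq> ys ! i} = 1}\<rparr>"

text \<open>The numeral type \<^typ>\<open>17\<close> is the ring of integers modulo 17.\<close>

datatype bs_vertex = VA 17 | VB 17 | VC 17 | VD 17 | VE 17 | VF 17

definition biggs_smith :: "bs_vertex graph" where
  "biggs_smith = \<lparr>verts = UNIV, edges = (\<Union>i.
     {{VA i, VA (i + 1)}, {VD i, VD (i + 2)}, {VC i, VC (i + 4)}, {VF i, VF (i + 8)},
      {VA i, VB i}, {VB i, VC i}, {VD i, VE i}, {VE i, VF i}, {VB i, VE i}})\<rparr>"

definition Y_graph :: "bs_vertex graph" where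
  "Y_graph = \<lparr>verts = verts biggs_smith,
     edges = {{u, v} | u v. u \<noteq> v \<and>
       (\<exists>vs i. is_cycle biggs_smith vs \<and> length vs = 9 \<and> i < 9 \<and>
         {u, v} = {vs ! i, vs ! ((i + 3) mod 9)})}\<rparr>"

definition two_path_partition :: "'a graph \<Rightarrow> 'a graph set \<Rightarrow> bool" where
  "two_path_partition y W \<longleftrightarrow> (\<forall>p\<in>W. two_path p \<and> subgraph p y) \<and>
     (\<forall>e\<in>edges y. \<exists>!p. p \<in> W \<and> e \<in> edges p)"

definition admissible :: "'a graph \<Rightarrow> 'a graph set \<Rightarrow> bool" where
  "admissible y W \<longleftrightarrow> two_path_partition y W \<and>
     (\<exists>c :: 'a set \<Rightarrow> nat. c ` edges y \<subseteq> {..<3} \<and>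
       (\<forall>T\<in>triangles y. inj_on c (edges T)) \<and>
       (\<forall>s t u v. chordless_cycle y [s, t, u, v] \<longrightarrow> c {s, t} = c {u, v} \<and> c {t, u} = c {v, s}) \<and>
       (\<exists>P. (\<forall>k<3. card (P k) = 4 \<and> (\<forall>p\<in>P k. two_path p) \<and> disjoint_family_on verts (P k) \<and>
               (\<Union>p\<in>P k. edges p) = {e \<in> edges y. c e = k}) \<and>
            W = (\<Union>k<3. P k)))"

definition extends_to_automorphism :: "'a graph \<Rightarrow> 'a graph \<Rightarrow> ('a \<Rightarrow> 'a) \<Rightarrow> bool" where
  "extends_to_automorphism G H f \<longleftrightarrow> (\<exists>\<phi>\<in>automorphisms G. \<forall>v\<in>verts H. \<phi> v = f v)"

definition isos_extend :: "'a graph \<Rightarrow> 'a graph set \<Rightarrow> bool" where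
  "isos_extend G C \<longleftrightarrow>
     (\<forall>H\<in>C. \<forall>H'\<in>C. \<forall>f. graph_iso f H H' \<longrightarrow> extends_to_automorphism G H f)"

definition path_preserving :: "('a graph \<Rightarrow> 'a graph set) \<Rightarrow> ('a \<Rightarrow> 'a) \<Rightarrow> 'a graph \<Rightarrow> 'a graph \<Rightarrow> bool" where
  "path_preserving \<Omega> f y y' \<longleftrightarrow> (\<forall>p\<in>\<Omega> y. map_graph f p \<in> \<Omega> y')"

text \<open>\<open>\<Omega>\<close>-preserving strongly zipped \<open>{L(Q\<^sub>3)}\<close>-ultrahomogeneity relative to \<open>K\<^sub>3\<close>, for the
  family \<open>\<L>\<close> of copies of \<open>L(Q\<^sub>3)\<close>.\<close>

definition strongly_zipped_LQ3_UH ::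
    "'a graph \<Rightarrow> 'a graph set \<Rightarrow> ('a graph \<Rightarrow> 'a graph set) \<Rightarrow> bool" where
  "strongly_zipped_LQ3_UH G \<L> \<Omega> \<longleftrightarrow>
     isos_extend G (triangles G) \<and>
     isos_extend G (copies G (complete_graph 2)) \<and>
     (\<forall>y\<in>\<L>. \<forall>y'\<in>\<L>. \<forall>f. graph_iso f y y' \<and> path_preserving \<Omega> f y y'
        \<longrightarrow> extends_to_automorphism G y f) \<and>
     (\<forall>y0\<in>\<L>. \<forall>T\<in>triangles y0. \<exists>y1.
        {y \<in> \<L> - {y0}. subgraph T (graph_inter y y0)} = {y1} \<and> graph_inter y1 y0 = T) \<and>
     (\<forall>y0\<in>\<L>. \<forall>e\<in>edges y0. \<exists>y1 y2 y3. distinct [y1, y2, y3] \<and>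
        {y \<in> \<L> - {y0}. subgraph (edge_graph e) (graph_inter y y0)} = {y1, y2, y3} \<and>
        graph_inter y1 y0 = edge_graph e)"

definition K4_LQ3_UH ::
    "'a graph \<Rightarrow> 'a graph set \<Rightarrow> ('a graph \<Rightarrow> 'a graph set) \<Rightarrow> bool" where
  "K4_LQ3_UH G \<L> \<Omega> \<longleftrightarrow>
     isos_extend G (induced_copies G (complete_graph 4)) \<and>
     (\<exists>\<K> \<subseteq> induced_copies G (complete_graph 4).
        disjoint_family_on edges \<K> \<and> graph_Union \<K> = G) \<and>
     strongly_zipped_LQ3_UH G \<L> \<Omega> \<and>
     (\<forall>K\<in>induced_copies G (complete_graph 4). \<forall>T\<in>triangles K.
        card {y \<in> \<L>. subgraph T (graph_inter K y)} = 2)"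

definition SL :: "('a::comm_ring_1^'n^'n) monoid" where
  "SL = \<lparr>carrier = {M. det M = 1}, mult = (\<lambda>M N. M ** N), one = mat 1\<rparr>"

definition PSL :: "('a::comm_ring_1^'n^'n) set monoid" where
  "PSL = SL Mod {M \<in> carrier SL. \<exists>a. M = mat a}"

end

theory Submission
  imports Defs
begin

text \<open>The graph \<open>\<Y>\<close> joins vertices at distance 3 in the Biggs-Smith graph, and the members of the family
  are induced on the sets of neighbours \<open>N(K)\<close> of the copies \<open>K\<close> of \<open>K\<^sub>4\<close> in \<open>\<Y>\<close>. An edge \<open>u v\<close> of such a
  member determines two vertices of \<open>K\<close> and thus one of the three perfect matchings of \<open>K\<close>: this is its
  colour, and the 2-paths in \<open>\<Omega>\<close> are those whose end vertices have a common Biggs-Smith neighbour.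

  To each vertex corresponds a set of six points of the projective line over the field with 17 elements,
  and \<open>SL(2,17)\<close> permutes these sets, which gives a group of automorphisms generated by the images \<open>rho 1\<close> of
  \<open>x \<mapsto> x + 1\<close> and \<open>tau\<close> of \<open>x \<mapsto> -1/x\<close>. This group is transitive on ordered triangles of \<open>\<Y>\<close> and on pairs of a
  member and one of its edges, which reduces every local claim to the four members through one
  edge. An automorphism of \<open>\<Y>\<close> that fixes a triangle pointwise fixes all neighbours of its
  vertices, hence is the identity; so there are no other automorphisms.\<close>

subsection \<open>The Biggs-Smith graph\<close>

text \<open>The group has order 2448. This is 102 times 24, the order of a vertex stabilizer
  \<open>S\<^sub>4\<close>; it is also the number of ordered triangles of \<open>Y_graph\<close>
  (612 edges, two directions, two common neighbours) and the number of pairs of a member and one of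
  its edges. So the action is regular on both kinds of objects: the stabilizer of an edge permutes
  the four members through it regularly, and the stabilizer of a member is regular on its 24 edges.
  The cuboctahedron itself has 48 symmetries, and the 2-paths are what excludes the other half. The
  six points of a vertex arise because \<open>S\<^sub>4\<close> has three cyclic subgroups of order
  4. As 4 divides (17 - 1)/2, each of them has two fixed points on the projective line. Incidence of
  vectors with these points ties a matrix to a permutation of the vertices. Image and kernel of the
  action are found from this incidence, so the group never has to be enumerated.\<close>

lemma UNIV_17: "(UNIV :: 17 set) = {0, 1, 2, 3, 4, 5, 6, 7, 8, 9, 10, 11, 12, 13, 14, 15, 16}"
  by (rule sym, rule card_subset_eq) simp_all

lemma all_17: "(\<forall>i::17. P i) \<longleftrightarrow> P 0 \<and> P 1 \<and> P 2 \<and> P 3 \<and> P 4 \<and> P 5 \<and> P 6 \<and> P 7 \<and> P 8 \<and>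
    P 9 \<and> P 10 \<and> P 11 \<and> P 12 \<and> P 13 \<and> P 14 \<and> P 15 \<and> P 16"
proof -
  have "(\<forall>i::17. P i) \<longleftrightarrow> (\<forall>i\<in>UNIV. P i)" by simp
  then show ?thesis unfolding UNIV_17 by simp
qed

lemma all_bs_vertex: "(\<forall>v. P v) \<longleftrightarrow> (\<forall>i. P (VA i)) \<and> (\<forall>i. P (VB i)) \<and> (\<forall>i. P (VC i)) \<and>
    (\<forall>i. P (VD i)) \<and> (\<forall>i. P (VE i)) \<and> (\<forall>i. P (VF i))"
  by (metis bs_vertex.exhaust)

text \<open>The default simplifier decides equations between numerals of \<^typ>\<open>17\<close> slowly, so the larger finite checks
  below are done with explicit rules only.\<close>

lemma numeral_17:
  "(17::17) = 0" "(18::17) = 1" "(19::17) = 2" "(20::17) = 3" "(21::17) = 4" "(22::17) = 5"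
  "(23::17) = 6" "(24::17) = 7" "(25::17) = 8" "(26::17) = 9" "(27::17) = 10" "(28::17) = 11"
  "(29::17) = 12" "(30::17) = 13" "(31::17) = 14" "(32::17) = 15"
  by simp_all

text \<open>Backward shifts are written as positive residues, 16 for -1 and so on, so that closed
  indices normalise to numerals below 17.\<close>

primrec bs_nbrs :: "bs_vertex \<Rightarrow> bs_vertex set" where
  "bs_nbrs (VA i) = {VA (i + 1), VA (i + 16), VB i}" |
  "bs_nbrs (VB i) = {VA i, VC i, VE i}" |
  "bs_nbrs (VC i) = {VC (i + 4), VC (i + 13), VB i}" |
  "bs_nbrs (VD i) = {VD (i + 2), VD (i + 15), VE i}" |
  "bs_nbrs (VE i) = {VB i, VD i, VF i}" |
  "bs_nbrs (VF i) = {VF (i + 8), VF (i + 9), VE i}"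

text \<open>The Biggs-Smith graph has girth 9, so the 3 * 2 * 2 walks of length 3 without
  backtracking end in twelve different vertices, the vertices at distance 3.\<close>

primrec bs_sphere3 :: "bs_vertex \<Rightarrow> bs_vertex set" where
  "bs_sphere3 (VA i) = {VA (i + 3), VA (i + 14), VB (i + 2), VB (i + 15), VC (i + 1), VC (i + 4),
     VC (i + 13), VC (i + 16), VD i, VE (i + 1), VE (i + 16), VF i}" |
  "bs_sphere3 (VB i) = {VA (i + 2), VA (i + 15), VB (i + 1), VB (i + 4), VB (i + 13), VB (i + 16),
     VC (i + 8), VC (i + 9), VD (i + 2), VD (i + 15), VF (i + 8), VF (i + 9)}" |
  "bs_sphere3 (VC i) = {VA (i + 1), VA (i + 4), VA (i + 13), VA (i + 16), VB (i + 8), VB (i + 9),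
     VC (i + 5), VC (i + 12), VD i, VE (i + 4), VE (i + 13), VF i}" |
  "bs_sphere3 (VD i) = {VA i, VB (i + 2), VB (i + 15), VC i, VD (i + 6), VD (i + 11), VE (i + 4),
     VE (i + 13), VF (i + 2), VF (i + 8), VF (i + 9), VF (i + 15)}" |
  "bs_sphere3 (VE i) = {VA (i + 1), VA (i + 16), VC (i + 4), VC (i + 13), VD (i + 4), VD (i + 13),
     VE (i + 2), VE (i + 8), VE (i + 9), VE (i + 15), VF (i + 1), VF (i + 16)}" |
  "bs_sphere3 (VF i) = {VA i, VB (i + 8), VB (i + 9), VC i, VD (i + 2), VD (i + 8), VD (i + 9),
     VD (i + 15), VE (i + 1), VE (i + 16), VF (i + 7), VF (i + 10)}"

section \<open>The two generating permutations of the vertices\<close>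

primrec rho :: "17 \<Rightarrow> bs_vertex \<Rightarrow> bs_vertex" where
  "rho k (VA i) = VA (k + i)" |
  "rho k (VB i) = VB (k + i)" |
  "rho k (VC i) = VC (k + i)" |
  "rho k (VD i) = VD (k + i)" |
  "rho k (VE i) = VE (k + i)" |
  "rho k (VF i) = VF (k + i)"


text \<open>Both orders are listed so that the rules derived from them refute an equation between
  two residues whichever side comes first.\<close>

lemma distinct_17:
  "distinct [0::17, 1, 2, 3, 4, 5, 6, 7, 8, 9, 10, 11, 12, 13, 14, 15, 16]"
  "distinct [16::17, 15, 14, 13, 12, 11, 10, 9, 8, 7, 6, 5, 4, 3, 2, 1, 0]"
  by simp_all

lemmas neq_17 = distinct_17[simplified distinct.simps list.set insert_iff empty_iff de_Morgan_disj simp_thms]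

text \<open>The permutation that x -> -1/x induces on the six-point sets;
  \<open>neg_inverse_sextet\<close> checks that it does.\<close>

definition tau_table :: "(bs_vertex \<times> bs_vertex) list" where
  "tau_table = [
    (VA 0, VC 0), (VA 1, VC 4), (VA 2, VB 4), (VA 3, VA 4), (VA 4, VA 3), (VA 5, VB 3),
    (VA 6, VE 3), (VA 7, VD 3), (VA 8, VD 1), (VA 9, VD 16), (VA 10, VD 14), (VA 11, VE 14),
    (VA 12, VB 14), (VA 13, VA 14), (VA 14, VA 13), (VA 15, VB 13), (VA 16, VC 13), (VB 0, VB 0),
    (VB 1, VC 8), (VB 2, VE 4), (VB 3, VA 5), (VB 4, VA 2), (VB 5, VC 3), (VB 6, VF 3),
    (VB 7, VD 5), (VB 8, VE 1), (VB 9, VE 16), (VB 10, VD 12), (VB 11, VF 14), (VB 12, VC 14),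
    (VB 13, VA 15), (VB 14, VA 12), (VB 15, VE 13), (VB 16, VC 9), (VC 0, VA 0), (VC 1, VC 12),
    (VC 2, VF 4), (VC 3, VB 5), (VC 4, VA 1), (VC 5, VC 16), (VC 6, VF 12), (VC 7, VE 5),
    (VC 8, VB 1), (VC 9, VB 16), (VC 10, VE 12), (VC 11, VF 5), (VC 12, VC 1), (VC 13, VA 16),
    (VC 14, VB 12), (VC 15, VF 13), (VC 16, VC 5), (VD 0, VD 0), (VD 1, VA 8), (VD 2, VD 2),
    (VD 3, VA 7), (VD 4, VE 2), (VD 5, VB 7), (VD 6, VF 2), (VD 7, VE 7), (VD 8, VF 10),
    (VD 9, VF 7), (VD 10, VE 10), (VD 11, VF 15), (VD 12, VB 10), (VD 13, VE 15), (VD 14, VA 10),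
    (VD 15, VD 15), (VD 16, VA 9), (VE 0, VE 0), (VE 1, VB 8), (VE 2, VD 4), (VE 3, VA 6),
    (VE 4, VB 2), (VE 5, VC 7), (VE 6, VF 11), (VE 7, VD 7), (VE 8, VF 1), (VE 9, VF 16),
    (VE 10, VD 10), (VE 11, VF 6), (VE 12, VC 10), (VE 13, VB 15), (VE 14, VA 11), (VE 15, VD 13),
    (VE 16, VB 9), (VF 0, VF 0), (VF 1, VE 8), (VF 2, VD 6), (VF 3, VB 6), (VF 4, VC 2),
    (VF 5, VC 11), (VF 6, VE 11), (VF 7, VD 9), (VF 8, VF 9), (VF 9, VF 8), (VF 10, VD 8),
    (VF 11, VE 6), (VF 12, VC 6), (VF 13, VC 15), (VF 14, VB 11), (VF 15, VD 11), (VF 16, VE 9)]"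

definition tau :: "bs_vertex \<Rightarrow> bs_vertex" where
  "tau v = the (map_of tau_table v)"

lemmas eval_17 = neq_17 numeral_17 bs_vertex.inject bs_vertex.distinct arith_simps one_plus_numeral numeral_plus_one
  one_add_one add_0 add_0_right

lemma distinct_tau_table: "distinct (map fst tau_table)"
  unfolding tau_table_def
  by (simp only: eval_17 list.map fst_conv distinct.simps list.set insert_iff empty_iff simp_thms)

lemma tau_tableD: "\<forall>(x, y)\<in>set tau_table. tau x = y"
  using distinct_tau_table by (auto simp: tau_def)

lemmas tau_eval = tau_tableD[unfolded tau_table_def, simplified list.set ball_simps prod.case]

lemmas all_vertices = all_bs_vertex all_17 

text \<open>The rule \<open>spec[of _ v]\<close> generalises the claim to all vertices, and
  \<open>all_vertices\<close> unfolds it into 102 closed instances. Several later checks use the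
  same device.\<close>

lemma tau_tau: "tau (tau v) = v"
  by (rule spec[of _ v]) (simp only: all_vertices tau_eval simp_thms)

lemma tau_nbrs: "\<forall>w\<in>bs_nbrs v. tau w \<in> bs_nbrs (tau v)"
  by (rule spec[of _ v])
   (simp only: all_vertices tau_eval bs_nbrs.simps ball_simps eval_17 insert_iff empty_iff simp_thms)


lemma eq_add_17: "i = j + k \<longleftrightarrow> j = i + l" if "k + l = 0" for i j k l :: 17
proof -
  have "l = - k" using that by (simp add: eq_neg_iff_add_eq_0 add.commute)
  then show ?thesis by auto
qed

lemma bs_nbrs_iff: "{u, v} \<in> edges biggs_smith \<longleftrightarrow> v \<in> bs_nbrs u"
proof -
  have sh: "i = j + 16 \<longleftrightarrow> j = i + 1" "i = j + 15 \<longleftrightarrow> j = i + 2" "i = j + 13 \<longleftrightarrow> j = i + 4"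
     "i = j + 9 \<longleftrightarrow> j = i + 8" for i j :: 17
    by (rule eq_add_17, simp)+
  show ?thesis
    by (cases u; cases v) (auto simp: biggs_smith_def doubleton_eq_iff sh)
qed

lemma bs_nbrs_sym: "v \<in> bs_nbrs u \<longleftrightarrow> u \<in> bs_nbrs v"
  by (metis bs_nbrs_iff insert_commute)

lemma bs_sphere3_step:
  "\<forall>x\<in>bs_nbrs u. \<forall>y\<in>bs_nbrs x - {u}. \<forall>z\<in>bs_nbrs y - {x}. z \<in> bs_sphere3 u"
  by (cases u) (simp_all add: Ball_def[of "_ - _"] imp_conjL add.assoc numeral_17 all_conj_distrib)

lemma bs_sphere3_path:
  "\<forall>z\<in>bs_sphere3 u. \<exists>x\<in>bs_nbrs u. \<exists>y\<in>bs_nbrs x. y \<noteq> u \<and> z \<in> bs_nbrs y \<and> z \<noteq> x"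
  by (cases u) (simp_all add: add.assoc numeral_17)

lemma bs_sphere3_iff:
  "z \<in> bs_sphere3 u \<longleftrightarrow> (\<exists>x\<in>bs_nbrs u. \<exists>y\<in>bs_nbrs x. y \<noteq> u \<and> z \<in> bs_nbrs y \<and> z \<noteq> x)"
  using bs_sphere3_step[of u] bs_sphere3_path[of u] by blast

lemma bs_sphere3_sym: "v \<in> bs_sphere3 u \<longleftrightarrow> u \<in> bs_sphere3 v"
  unfolding bs_sphere3_iff by (metis bs_nbrs_sym)

lemma bs_sphere3_irrefl: "u \<notin> bs_sphere3 u"
  by (cases u) simp_all

section \<open>Automorphisms of the Biggs-Smith graph\<close>

definition bs_aut :: "(bs_vertex \<Rightarrow> bs_vertex) \<Rightarrow> bool" where
  "bs_aut g \<longleftrightarrow> bij g \<and> (\<forall>u v. g v \<in> bs_nbrs (g u) \<longleftrightarrow> v \<in> bs_nbrs u)"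

lemma bs_aut_id: "bs_aut id"
  by (simp add: bs_aut_def)

lemma bs_aut_comp: "bs_aut g \<Longrightarrow> bs_aut h \<Longrightarrow> bs_aut (g \<circ> h)"
  by (simp add: bs_aut_def bij_comp)

lemma bs_aut_inv:
  assumes "bs_aut g"
  shows "bs_aut (inv_into UNIV g)"
  using assms unfolding bs_aut_def by (metis bij_imp_bij_inv bij_inv_eq_iff)

lemma bs_aut_nbrs: "bs_aut g \<Longrightarrow> g v \<in> bs_nbrs (g u) \<longleftrightarrow> v \<in> bs_nbrs u"
  by (simp add: bs_aut_def)

lemma bs_aut_eq_iff: "bs_aut g \<Longrightarrow> g u = g v \<longleftrightarrow> u = v"
  unfolding bs_aut_def by (meson bij_is_inj inj_eq)

lemma bs_aut_sphere3:
  assumes g: "bs_aut g"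
  shows "g v \<in> bs_sphere3 (g u) \<longleftrightarrow> v \<in> bs_sphere3 u"
proof -
  have *: "h v \<in> bs_sphere3 (h u)" if "bs_aut h" "v \<in> bs_sphere3 u" for h u v
    using that unfolding bs_sphere3_iff by (metis bs_aut_nbrs bs_aut_eq_iff)
  have "inv_into UNIV g (g x) = x" for x
    using g by (simp add: bs_aut_def bij_is_inj)
  then show ?thesis
    using *[OF g] *[OF bs_aut_inv[OF g], of "g v" "g u"] by auto
qed

lemma bs_aut_rho: "bs_aut (rho k)"
proof -
  have "rho k (rho (- k) v) = v" "rho (- k) (rho k v) = v" for v
    by (cases v; simp)+
  then have "bij (rho k)"
    by (rule_tac o_bij[of "rho (- k)"]) (auto simp: fun_eq_iff)
  moreover have "rho k v \<in> bs_nbrs (rho k u) \<longleftrightarrow> v \<in> bs_nbrs u" for u v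
    by (cases u; cases v) (auto simp: add.assoc)
  ultimately show ?thesis by (simp add: bs_aut_def)
qed

text \<open>Since \<open>tau\<close> is an involution, it is enough that it maps neighbours to
  neighbours: the same fact at \<open>tau u\<close> gives the converse.\<close>

lemma bs_aut_tau: "bs_aut tau"
  unfolding bs_aut_def
proof (intro conjI allI)
  show "bij tau" by (rule o_bij[of tau]) (auto simp: tau_tau)
  show "tau v \<in> bs_nbrs (tau u) \<longleftrightarrow> v \<in> bs_nbrs u" for u v
    using tau_nbrs[of u] tau_nbrs[of "tau u"] by (metis tau_tau)
qed

subsection \<open>The action of SL(2,17)\<close>

text \<open>\<open>Some t\<close> is the point with homogeneous coordinates \<open>(t, 1)\<close>, and \<open>None\<close> is the point at infinity.\<close>

primrec on_point :: "17 option \<Rightarrow> 17^2 \<Rightarrow> bool" where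
  "on_point None w \<longleftrightarrow> w $ 2 = 0" |
  "on_point (Some t) w \<longleftrightarrow> w $ 1 = t * w $ 2"

text \<open>The fixed points of the elements of order 4 in the stabilizer of the vertex.\<close>

primrec sextet :: "bs_vertex \<Rightarrow> 17 option set" where
  "sextet (VA i) = {Some (i + 2), Some (i + 5), Some (i + 6), Some (i + 11), Some (i + 12), Some (i + 15)}" |
  "sextet (VB i) = {None, Some i, Some (i + 2), Some (i + 8), Some (i + 9), Some (i + 15)}" |
  "sextet (VC i) = {Some (i + 3), Some (i + 7), Some (i + 8), Some (i + 9), Some (i + 10), Some (i + 14)}" |
  "sextet (VD i) = {Some (i + 4), Some (i + 5), Some (i + 7), Some (i + 10), Some (i + 12), Some (i + 13)}" |
  "sextet (VE i) = {None, Some i, Some (i + 1), Some (i + 4), Some (i + 13), Some (i + 16)}" |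
  "sextet (VF i) = {Some (i + 1), Some (i + 3), Some (i + 6), Some (i + 11), Some (i + 14), Some (i + 16)}"

text \<open>The six points as a set of vectors. Matrices act on it linearly, and homogeneous
  equations replace the division in fractional linear maps.\<close>

definition sextet_cone :: "bs_vertex \<Rightarrow> (17^2) set" where
  "sextet_cone v = {w. \<exists>p\<in>sextet v. on_point p w}"

text \<open>A relation rather than a function of the matrix, because it is directly closed under
  products and inverses. That each \<open>M\<close> of determinant 1 has exactly one
  \<open>g\<close> follows in \<open>realizes_ex\<close> and \<open>realizes_unique\<close>.\<close>

definition realizes :: "17^2^2 \<Rightarrow> (bs_vertex \<Rightarrow> bs_vertex) \<Rightarrow> bool" where
  "realizes M g \<longleftrightarrow> det M = 1 \<and> bs_aut g \<and> (\<forall>v w. M *v w \<in> sextet_cone (g v) \<longleftrightarrow> w \<in> sextet_cone v)"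

section \<open>Two by two matrices\<close>

definition mat2 :: "'a \<Rightarrow> 'a \<Rightarrow> 'a \<Rightarrow> 'a \<Rightarrow> 'a::zero^2^2" where
  "mat2 a b c d = vector [vector [a, b], vector [c, d]]"

lemma mat2_nth [simp]:
  "mat2 a b c d $ 1 $ 1 = a" "mat2 a b c d $ 1 $ 2 = b" "mat2 a b c d $ 2 $ 1 = c" "mat2 a b c d $ 2 $ 2 = d"
  by (simp_all add: mat2_def vector_2)

lemma mat2_exhaust:
  obtains a b c d where "M = mat2 a b c d"
proof
  show "M = mat2 (M $ 1 $ 1) (M $ 1 $ 2) (M $ 2 $ 1) (M $ 2 $ 2)"
    by (simp add: vec_eq_iff forall_2)
qed

lemma mat2_eq_iff: "mat2 a b c d = mat2 a' b' c' d' \<longleftrightarrow> a = a' \<and> b = b' \<and> c = c' \<and> d = d'"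
  by (metis mat2_nth)

lemma mat2_mult:
  fixes a b c d :: "'a::comm_ring_1"
  shows "mat2 a b c d ** mat2 a' b' c' d' =
    mat2 (a * a' + b * c') (a * b' + b * d') (c * a' + d * c') (c * b' + d * d')"
  by (simp add: vec_eq_iff forall_2 matrix_matrix_mult_def sum_2)

lemma det_mat2: "det (mat2 a b c d) = a * d - b * c" for a b c d :: "'a::comm_ring_1"
  by (simp add: det_2)

lemma mat2_vec: "(mat2 a b c d *v w) $ 1 = a * w $ 1 + b * w $ 2" "(mat2 a b c d *v w) $ 2 = c * w $ 1 + d * w $ 2"
  for a b c d :: "'a::comm_ring_1"
  by (simp_all add: matrix_vector_mult_def sum_2)

lemma mat_mat2: "mat a = mat2 a 0 0 a"
  by (simp add: vec_eq_iff forall_2 mat_def)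

lemma realizes_id: "realizes (mat 1) id"
  by (simp add: realizes_def bs_aut_id)

lemma realizes_comp: "realizes M g \<Longrightarrow> realizes N h \<Longrightarrow> realizes (M ** N) (g \<circ> h)"
  by (simp add: realizes_def bs_aut_comp det_mul matrix_vector_mul_assoc[symmetric])

lemma realizes_inv:
  assumes "realizes M g" "M ** N = mat 1"
  shows "realizes N (inv_into UNIV g)"
proof -
  have 1: "det N = 1"
    using assms det_mul[of M N] by (simp add: realizes_def)
  have 2: "g (inv_into UNIV g v) = v" for v
    using assms by (simp add: realizes_def bs_aut_def bij_is_surj surj_f_inv_f)
  have 3: "M *v (N *v w) = w" for w
    using assms by (simp add: matrix_vector_mul_assoc)
  have "M *v (N *v w) \<in> sextet_cone (g (inv_into UNIV g v)) \<longleftrightarrow> N *v w \<in> sextet_cone (inv_into UNIV g v)" for v w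
    using assms by (simp add: realizes_def)
  with 1 2 3 assms bs_aut_inv show ?thesis by (simp add: realizes_def)
qed

text \<open>The matrix moves the point t to t + k and fixes infinity, and the finite points of a
  sextet are the index plus constants.\<close>

lemma realizes_rho: "realizes (mat2 1 k 0 1) (rho k)"
proof -
  have "mat2 1 k 0 1 *v w \<in> sextet_cone (rho k v) \<longleftrightarrow> w \<in> sextet_cone v" for v w
    by (cases v) (simp_all add: sextet_cone_def mat2_vec distrib_right add.assoc add.left_commute[of _ k])
  then show ?thesis by (simp add: realizes_def det_mat2 bs_aut_rho)
qed

text \<open>The map x -> -1/x of the projective line: by Fermat, t^15 is the inverse of a nonzero t
  modulo 17.\<close>

definition neg_inverse :: "17 option \<Rightarrow> 17 option" where
  "neg_inverse p = (case p of None \<Rightarrow> Some 0 | Some t \<Rightarrow> if t = 0 then None else Some (- (t ^ 15)))"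

lemma inverse_17: "t * t ^ 15 = 1" if "t \<noteq> 0" for t :: 17
proof -
  have "\<forall>t::17. t \<noteq> 0 \<longrightarrow> t * t ^ 15 = 1" by (simp add: all_17)
  with that show ?thesis by blast
qed


lemma neg_inverse_eval:
  "neg_inverse None = Some 0" "neg_inverse (Some 0) = None"
  "neg_inverse (Some 1) = Some 16"
  "neg_inverse (Some 2) = Some 8"
  "neg_inverse (Some 3) = Some 11"
  "neg_inverse (Some 4) = Some 4"
  "neg_inverse (Some 5) = Some 10"
  "neg_inverse (Some 6) = Some 14"
  "neg_inverse (Some 7) = Some 12"
  "neg_inverse (Some 8) = Some 2"
  "neg_inverse (Some 9) = Some 15"
  "neg_inverse (Some 10) = Some 5"
  "neg_inverse (Some 11) = Some 3"
  "neg_inverse (Some 12) = Some 7"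
  "neg_inverse (Some 13) = Some 13"
  "neg_inverse (Some 14) = Some 6"
  "neg_inverse (Some 15) = Some 9"
  "neg_inverse (Some 16) = Some 1"
  by (simp_all add: neg_inverse_def)

text \<open>The matrix takes (t, 1) to (-1, t), a vector on the point -1/t.\<close>

lemma on_point_neg_inverse: "on_point (neg_inverse p) (mat2 0 (- 1) 1 0 *v w) \<longleftrightarrow> on_point p w"
proof (cases "p = None \<or> p = Some 0")
  case True
  then show ?thesis by (auto simp: neg_inverse_def mat2_vec)
next
  case False
  then obtain t where t: "p = Some t" "t \<noteq> 0" by auto
  have 1: "t * (t ^ 15 * x) = x" "t ^ 15 * (t * x) = x" for x
    using inverse_17[OF t(2)] mult.assoc[of t "t ^ 15" x] by (simp_all add: mult.left_commute)
  have "w $ 2 = t ^ 15 * w $ 1 \<longleftrightarrow> w $ 1 = t * w $ 2"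
  proof
    show "w $ 1 = t * w $ 2" if "w $ 2 = t ^ 15 * w $ 1"
      by (subst that) (rule 1(1)[symmetric])
    show "w $ 2 = t ^ 15 * w $ 1" if "w $ 1 = t * w $ 2"
      by (subst that) (rule 1(2)[symmetric])
  qed
  with t show ?thesis by (simp add: neg_inverse_def mat2_vec)
qed

lemma neg_inverse_sextet: "\<forall>p\<in>sextet v. neg_inverse p \<in> sextet (tau v)"
  by (rule spec[of _ v])
   (simp only: all_vertices tau_eval sextet.simps ball_simps neg_inverse_eval eval_17
     option.inject option.distinct insert_iff empty_iff simp_thms)

lemma neg_inverse_neg_inverse: "neg_inverse (neg_inverse p) = p"
proof -
  have "\<forall>t. neg_inverse (neg_inverse (Some t)) = Some t"
    by (simp only: all_17 neg_inverse_eval simp_thms)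
  then show ?thesis by (cases p) (simp_all add: neg_inverse_eval)
qed

lemma realizes_tau: "realizes (mat2 0 (- 1) 1 0) tau"
proof -
  have "mat2 0 (- 1) 1 0 *v w \<in> sextet_cone (tau v) \<longleftrightarrow> w \<in> sextet_cone v" for v w
  proof
    assume "mat2 0 (- 1) 1 0 *v w \<in> sextet_cone (tau v)"
    then obtain p where p: "p \<in> sextet (tau v)" "on_point p (mat2 0 (- 1) 1 0 *v w)"
      by (auto simp: sextet_cone_def)
    then have "neg_inverse p \<in> sextet v"
      using neg_inverse_sextet[of "tau v"] by (simp add: tau_tau)
    moreover have "on_point (neg_inverse p) w"
      using p(2) on_point_neg_inverse[of "neg_inverse p" w] by (simp add: neg_inverse_neg_inverse)
    ultimately show "w \<in> sextet_cone v" by (auto simp: sextet_cone_def)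
  next
    assume "w \<in> sextet_cone v"
    then obtain p where p: "p \<in> sextet v" "on_point p w"
      by (auto simp: sextet_cone_def)
    then have "neg_inverse p \<in> sextet (tau v)"
      using neg_inverse_sextet[of v] by blast
    moreover have "on_point (neg_inverse p) (mat2 0 (- 1) 1 0 *v w)"
      using p(2) by (simp add: on_point_neg_inverse)
    ultimately show "mat2 0 (- 1) 1 0 *v w \<in> sextet_cone (tau v)"
      by (auto simp: sextet_cone_def)
  qed
  then show ?thesis by (simp add: realizes_def det_mat2 bs_aut_tau)
qed

lemma realizes_lower: "realizes (mat2 1 0 c 1) (tau \<circ> rho (- c) \<circ> tau)"
proof -
  let ?S = "mat2 0 (- 1) 1 0 :: 17^2^2"
  \<comment> \<open>The square of \<open>?S\<close> is -1, so its cube is its inverse and the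
    product is the conjugate of a translation by \<open>?S\<close>. On the vertices
    \<open>tau\<close> is its own inverse, which absorbs two of the factors.\<close>
  have "realizes (?S ** mat2 1 (- c) 0 1 ** ?S ** ?S ** ?S) (tau \<circ> rho (- c) \<circ> tau \<circ> tau \<circ> tau)"
    by (intro realizes_comp realizes_tau realizes_rho)
  moreover have "tau \<circ> rho (- c) \<circ> tau \<circ> tau \<circ> tau = tau \<circ> rho (- c) \<circ> tau"
    by (simp add: fun_eq_iff tau_tau)
  ultimately show ?thesis by (simp add: mat2_mult)
qed

text \<open>A matrix with nonzero lower left entry c is a product of an upper, a lower and an upper
  unipotent matrix. If c = 0, then a is nonzero and a factor \<open>?S\<close> moves it into the
  lower left corner.\<close>

lemma realizes_ex:
  assumes "det M = 1"
  shows "\<exists>g. realizes M g"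
proof -
  have *: "\<exists>g. realizes (mat2 a b c d) g" if d: "a * d - b * c = 1" and c: "c \<noteq> 0" for a b c d :: 17
  proof -
    \<comment> \<open>The shifts (a - 1)/c and (d - 1)/c give the triple product the right diagonal;
      the determinant then forces the upper right entry.\<close>
    define x y where "x = (a - 1) * c ^ 15" and "y = (d - 1) * c ^ 15"
    have xc: "x * c = a - 1" and yc: "y * c = d - 1"
      by (simp_all only: x_def y_def mult.assoc mult.commute[of "c ^ 15"] inverse_17[OF c] mult_1_right)
    have "(a * y + x) * c = a * (y * c) + x * c" by (simp only: distrib_right mult.assoc)
    also have "\<dots> = b * c" using d unfolding xc yc by (simp add: algebra_simps)
    finally have "(a * y + x) * (c * c ^ 15) = b * (c * c ^ 15)" by (simp add: mult.assoc[symmetric])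
    then have "a * y + x = b" by (simp add: inverse_17[OF c])
    then have "mat2 1 x 0 1 ** mat2 1 0 c 1 ** mat2 1 y 0 1 = mat2 a b c d"
      using xc yc by (simp add: mat2_mult mat2_eq_iff mult.commute)
    then show ?thesis
      by (metis realizes_comp realizes_rho realizes_lower)
  qed
  obtain a b c d where M: "M = mat2 a b c d" by (rule mat2_exhaust)
  have det: "a * d - b * c = 1" using assms by (simp add: M det_mat2)
  show ?thesis
  proof (cases "c = 0")
    case True
    with det have "a \<noteq> 0" by auto
    then obtain g where g: "realizes (mat2 (- c) (- d) a b) g"
      using *[of "- c" b "- d" a] det by (auto simp: algebra_simps)
    let ?S = "mat2 0 (- 1) 1 0 :: 17^2^2"
    \<comment> \<open>The cube of \<open>?S\<close> is its inverse, so the product is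
      \<open>M\<close> again.\<close>
    have "realizes (?S ** ?S ** ?S ** mat2 (- c) (- d) a b) (tau \<circ> tau \<circ> tau \<circ> g)"
      by (intro realizes_comp realizes_tau g)
    then show ?thesis by (auto simp: mat2_mult M)
  qed (use * det M in blast)
qed

subsection \<open>Transitivity\<close>

definition bs_group :: "(bs_vertex \<Rightarrow> bs_vertex) set" where
  "bs_group = {g. \<exists>M. realizes M g}"

lemma bs_group_aut: "g \<in> bs_group \<Longrightarrow> bs_aut g"
  by (auto simp: bs_group_def realizes_def)

lemma bs_group_id: "id \<in> bs_group"
  using realizes_id by (auto simp: bs_group_def)

lemma bs_group_comp: "g \<in> bs_group \<Longrightarrow> h \<in> bs_group \<Longrightarrow> g \<circ> h \<in> bs_group"
  using realizes_comp by (fastforce simp: bs_group_def)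

lemma SL2_inverse:
  assumes "det (M :: 'a::comm_ring_1^2^2) = 1"
  shows "\<exists>N. M ** N = mat 1 \<and> N ** M = mat 1"
proof -
  obtain a b c d where M: "M = mat2 a b c d" by (rule mat2_exhaust)
  then have "a * d - b * c = 1" using assms by (simp add: det_mat2)
  then have "M ** mat2 d (- b) (- c) a = mat 1 \<and> mat2 d (- b) (- c) a ** M = mat 1"
    by (simp add: M mat2_mult mat_mat2 mat2_eq_iff mult.commute add.commute)
  then show ?thesis by blast
qed

lemma bs_group_inv: "g \<in> bs_group \<Longrightarrow> inv_into UNIV g \<in> bs_group"
  using realizes_inv SL2_inverse by (fastforce simp: bs_group_def realizes_def)

lemma bs_group_rho: "rho k \<in> bs_group"
  using realizes_rho by (auto simp: bs_group_def)

lemma bs_group_tau: "tau \<in> bs_group"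
  using realizes_tau by (auto simp: bs_group_def)

lemmas bs_group_intros = bs_group_comp bs_group_rho bs_group_tau bs_group_id

lemma bs_group_bij: "g \<in> bs_group \<Longrightarrow> bij g"
  using bs_group_aut by (auto simp: bs_aut_def)

lemma bs_group_inv_apply:
  assumes "g \<in> bs_group"
  shows "inv_into UNIV g (g v) = v" "g (inv_into UNIV g v) = v"
  using bs_group_bij[OF assms] by (simp_all add: bij_is_inj bij_is_surj surj_f_inv_f)

text \<open>Words in the two generators. The arguments given to them below are certificates, checked
  by evaluating the word at the vertices in question.\<close>

definition word3 :: "17 \<Rightarrow> 17 \<Rightarrow> bs_vertex \<Rightarrow> bs_vertex" where
  "word3 a c = rho a \<circ> tau \<circ> rho c"

definition word5 :: "17 \<Rightarrow> 17 \<Rightarrow> 17 \<Rightarrow> bs_vertex \<Rightarrow> bs_vertex" where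
  "word5 a b c = rho a \<circ> tau \<circ> rho b \<circ> tau \<circ> rho c"

lemma bs_group_word: "word3 a c \<in> bs_group" "word5 a b c \<in> bs_group"
  unfolding word3_def word5_def by (intro bs_group_intros)+

lemmas word_eval = word3_def word5_def comp_apply rho.simps tau_eval eval_17

text \<open>The translations \<open>rho i\<close> have six orbits, one for each letter, so one
  element that takes \<open>VB 0\<close> into each orbit is enough.\<close>

lemma bs_group_vertex_transitive: "\<exists>g\<in>bs_group. g (VB 0) = v"
proof -
  have *: "\<exists>g\<in>bs_group. g (VB 0) = v" if "word3 a c (VB 0) = w" "rho i w = v" for a c i w
    using that by (intro bexI[of _ "rho i \<circ> word3 a c"]) (auto intro: bs_group_intros bs_group_word)
  show ?thesis
  proof (cases v)
    case (VA i)
    show ?thesis by (rule *[of 2 13 "VA 0" i]) (simp_all only: word_eval VA)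
  next
    case (VB i)
    show ?thesis by (intro bexI[of _ "rho i"] bs_group_rho) (simp only: word_eval VB)
  next
    case (VC i)
    show ?thesis by (rule *[of 3 12 "VC 0" i]) (simp_all only: word_eval VC)
  next
    case (VD i)
    show ?thesis by (rule *[of 5 10 "VD 0" i]) (simp_all only: word_eval VD)
  next
    case (VE i)
    show ?thesis by (rule *[of 1 9 "VE 0" i]) (simp_all only: word_eval VE)
  next
    case (VF i)
    show ?thesis by (rule *[of 3 11 "VF 0" i]) (simp_all only: word_eval VF)
  qed
qed

lemmas set_eval = insert_iff empty_iff ball_simps bex_simps simp_thms Int_iff Int_insert_left_if1 Int_insert_left_if0 Int_empty_left

lemma bs_group_arc_transitive:
  assumes "v \<in> bs_sphere3 u"
  shows "\<exists>g\<in>bs_group. g (VB 0) = u \<and> g (VA 2) = v"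
proof -
  have *: "\<exists>g\<in>bs_group. g (VB 0) = VB 0 \<and> g (VA 2) = v"
    if "word5 a b c (VB 0) = VB 0 \<and> word5 a b c (VA 2) = v" for a b c v
    using that bs_group_word by blast
  have base: "\<forall>v\<in>bs_sphere3 (VB 0). \<exists>g\<in>bs_group. g (VB 0) = VB 0 \<and> g (VA 2) = v"
    unfolding bs_sphere3.simps ball_simps
  proof (intro conjI TrueI)
  \<comment> \<open>Each of the twelve neighbours of \<open>VB 0\<close> is reached by one of these
    twelve words, all of which fix \<open>VB 0\<close>; for each goal the alternatives are tried in
    turn.\<close>
  qed ((rule *[of 4 10 3], simp only: word_eval simp_thms; fail) |
       (rule *[of 5 11 5], simp only: word_eval simp_thms; fail) |
       (rule *[of 3 10 4], simp only: word_eval simp_thms; fail) |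
       (rule *[of 5 5 16], simp only: word_eval simp_thms; fail) |
       (rule *[of 4 13 4], simp only: word_eval simp_thms; fail) |
       (rule *[of 2 9 2], simp only: word_eval simp_thms; fail) |
       (rule *[of 9 5 15], simp only: word_eval simp_thms; fail) |
       (rule *[of 4 3 14], simp only: word_eval simp_thms; fail) |
       (rule *[of 1 12 12], simp only: word_eval simp_thms; fail) |
       (rule *[of 3 7 3], simp only: word_eval simp_thms; fail) |
       (rule *[of 1 6 5], simp only: word_eval simp_thms; fail) |
       (rule *[of 2 12 8], simp only: word_eval simp_thms; fail))+
  obtain h where h: "h \<in> bs_group" "h (VB 0) = u"
    using bs_group_vertex_transitive by blast
  define v' where "v' = inv_into UNIV h v"
  have v': "h v' = v" using h by (simp add: v'_def bs_group_inv_apply)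
  then have "v' \<in> bs_sphere3 (VB 0)"
    using assms h bs_aut_sphere3[OF bs_group_aut, of h v' "VB 0"] by simp
  then obtain g where "g \<in> bs_group" "g (VB 0) = VB 0" "g (VA 2) = v'"
    using base by blast
  then show ?thesis
    using h v' by (intro bexI[of _ "h \<circ> g"]) (auto intro: bs_group_comp)
qed

lemma bs_sphere3_base_common: "bs_sphere3 (VB 0) \<inter> bs_sphere3 (VA 2) = {VB 4, VD 2}"
  by (simp only: bs_sphere3.simps eval_17 set_eval)

text \<open>The base arc from \<open>VB 0\<close> to \<open>VA 2\<close> lies in just two triangles,
  and \<open>word5 4 10 3\<close> fixes both of its ends and exchanges the two triangles.\<close>

lemma bs_group_triangle_transitive:
  assumes "b \<in> bs_sphere3 a" "c \<in> bs_sphere3 a" "c \<in> bs_sphere3 b"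
  shows "\<exists>g\<in>bs_group. g (VB 0) = a \<and> g (VA 2) = b \<and> g (VD 2) = c"
proof -
  obtain h where h: "h \<in> bs_group" "h (VB 0) = a" "h (VA 2) = b"
    using bs_group_arc_transitive[OF assms(1)] by blast
  define c' where "c' = inv_into UNIV h c"
  have c': "h c' = c" using h by (simp add: c'_def bs_group_inv_apply)
  then have "c' \<in> bs_sphere3 (VB 0) \<inter> bs_sphere3 (VA 2)"
    using assms h bs_aut_sphere3[OF bs_group_aut, of h c'] by (metis IntI)
  then consider "c' = VB 4" | "c' = VD 2" unfolding bs_sphere3_base_common by blast
  then show ?thesis
  proof cases
    case 1
    have "word5 4 10 3 (VB 0) = VB 0 \<and> word5 4 10 3 (VA 2) = VA 2 \<and> word5 4 10 3 (VD 2) = VB 4"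
      by (simp only: word_eval simp_thms)
    with 1 h c' show ?thesis
      by (intro bexI[of _ "h \<circ> word5 4 10 3"]) (auto intro: bs_group_comp bs_group_word)
  next
    case 2
    with h c' show ?thesis by auto
  qed
qed

section \<open>Adjacency in Y and the 9-cycles\<close>

lemma is_cycle_biggs_smith:
  "is_cycle biggs_smith vs \<longleftrightarrow> 3 \<le> length vs \<and> distinct vs \<and>
     (\<forall>i<length vs. vs ! (Suc i mod length vs) \<in> bs_nbrs (vs ! i))"
proof -
  have "verts biggs_smith = UNIV" by (simp add: biggs_smith_def)
  moreover have "vs ! (Suc i mod length vs) \<in> set vs" if "i < length vs" for i
    using that by (intro nth_mem mod_less_divisor) linarith
  ultimately show ?thesis
    unfolding is_cycle_def subgraph_def cycle_graph_def
    by (auto simp: bs_nbrs_iff[symmetric])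
qed

lemma is_cycle_bs_aut:
  assumes "bs_aut g" "is_cycle biggs_smith vs"
  shows "is_cycle biggs_smith (map g vs)"
proof -
  have len: "0 < length vs" using assms by (auto simp: is_cycle_def)
  have "inj_on g (set vs)"
    using assms(1) by (meson bs_aut_eq_iff inj_onI)
  with len assms show ?thesis
    by (auto simp: is_cycle_biggs_smith distinct_map bs_aut_nbrs)
qed


text \<open>Three consecutive edges of a 9-cycle form a walk without backtracking, which gives one
  direction. For the other, one explicit 9-cycle through the base arc is enough, since the group
  carries this arc to every other.\<close>

lemma Y_adj_iff: "{u, v} \<in> edges Y_graph \<longleftrightarrow> v \<in> bs_sphere3 u"
proof
  assume "{u, v} \<in> edges Y_graph"
  then obtain vs i where c: "is_cycle biggs_smith vs" "length vs = 9" "i < 9"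
    and uv: "{u, v} = {vs ! i, vs ! ((i + 3) mod 9)}"
    unfolding Y_graph_def graph.simps mem_Collect_eq by metis
  define f where "f k = vs ! ((i + k) mod 9)" for k
  have adj: "f (Suc k) \<in> bs_nbrs (f k)" for k
  proof -
    have "vs ! (Suc ((i + k) mod 9) mod 9) \<in> bs_nbrs (vs ! ((i + k) mod 9))"
      using c(1) c(2) unfolding is_cycle_biggs_smith by simp
    then show ?thesis by (simp add: f_def mod_Suc_eq)
  qed
  have "(i + 0) mod 9 \<noteq> (i + 2) mod 9" "(i + 1) mod 9 \<noteq> (i + 3) mod 9"
  proof -
    from c(3) have "i \<in> {0, 1, 2, 3, 4, 5, 6, 7, 8}" by auto
    then show "(i + 0) mod 9 \<noteq> (i + 2) mod 9" "(i + 1) mod 9 \<noteq> (i + 3) mod 9" by auto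
  qed
  then have "f 0 \<noteq> f 2" "f 1 \<noteq> f 3"
    using c unfolding f_def is_cycle_def by (simp_all add: nth_eq_iff_index_eq)
  moreover have "f 1 \<in> bs_nbrs (f 0)" "f 2 \<in> bs_nbrs (f 1)" "f 3 \<in> bs_nbrs (f 2)"
    using adj[of 0] adj[of 1] adj[of 2] by (simp_all add: eval_nat_numeral)
  ultimately have "f 3 \<in> bs_sphere3 (f 0)"
    using bs_sphere3_step[of "f 0"] by fastforce
  moreover have "{u, v} = {f 0, f 3}" using uv c(3) by (simp add: f_def)
  then have "u = f 0 \<and> v = f 3 \<or> u = f 3 \<and> v = f 0" by (simp only: doubleton_eq_iff)
  ultimately show "v \<in> bs_sphere3 u"
    using bs_sphere3_sym[of "f 3" "f 0"] by blast
next
  assume uv: "v \<in> bs_sphere3 u"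
  then obtain g where g: "g \<in> bs_group" "g (VB 0) = u" "g (VA 2) = v"
    using bs_group_arc_transitive by blast
  \<comment> \<open>The base arc joins the positions 0 and 3 of this cycle.\<close>
  let ?c = "[VB 0, VA 0, VA 1, VA 2, VA 3, VA 4, VB 4, VC 4, VC 0]"
  have "?c ! (Suc i mod 9) \<in> bs_nbrs (?c ! i)" if "i < 9" for i
  proof -
    from that have "i \<in> {0, 1, 2, 3, 4, 5, 6, 7, 8}" by auto
    then show ?thesis by auto
  qed
  then have "is_cycle biggs_smith ?c" unfolding is_cycle_biggs_smith by simp
  then have "is_cycle biggs_smith (map g ?c)"
    by (rule is_cycle_bs_aut[OF bs_group_aut[OF g(1)]])
  moreover have "u \<noteq> v" using uv bs_sphere3_irrefl by auto
  ultimately show "{u, v} \<in> edges Y_graph"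
    unfolding Y_graph_def graph.simps
    by (intro CollectI exI[of _ u] exI[of _ v] conjI exI[of _ "map g ?c"] exI[of _ 0])
      (simp_all add: g)
qed

subsection \<open>Simple graphs\<close>

definition simple_graph :: "'a graph \<Rightarrow> bool" where
  "simple_graph G \<longleftrightarrow> (\<forall>e\<in>edges G. e \<subseteq> verts G \<and> (\<exists>u v. u \<noteq> v \<and> e = {u, v}))"

lemma simple_graphE:
  assumes "simple_graph G" "e \<in> edges G"
  obtains u v where "u \<noteq> v" "e = {u, v}" "u \<in> verts G" "v \<in> verts G"
proof -
  have "\<exists>u v. u \<noteq> v \<and> e = {u, v}" "e \<subseteq> verts G"
    using assms by (simp_all add: simple_graph_def)
  then show thesis using that by auto
qed

definition clique :: "'a graph \<Rightarrow> 'a set \<Rightarrow> bool" where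
  "clique G X \<longleftrightarrow> X \<subseteq> verts G \<and> (\<forall>u\<in>X. \<forall>v\<in>X. u \<noteq> v \<longrightarrow> {u, v} \<in> edges G)"

definition clique_graph :: "'a set \<Rightarrow> 'a graph" where
  "clique_graph X = \<lparr>verts = X, edges = {{u, v} | u v. u \<in> X \<and> v \<in> X \<and> u \<noteq> v}\<rparr>"

lemma verts_clique_graph [simp]: "verts (clique_graph X) = X"
  by (simp add: clique_graph_def)

text \<open>Replaces the existential over isomorphisms in \<open>copies\<close> by a condition on
  vertex sets; edges, triangles and copies of \<open>K\<^sub>4\<close> are handled in this form
  below.\<close>

lemma copies_complete_graph:
  assumes G: "simple_graph G"
  shows "H \<in> copies G (complete_graph n) \<longleftrightarrow> (\<exists>X. clique G X \<and> finite X \<and> card X = n \<and> H = clique_graph X)"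
proof
  assume "H \<in> copies G (complete_graph n)"
  then obtain f where H: "subgraph H G" and iso: "graph_iso f H (complete_graph n)"
    unfolding copies_def graph_isomorphic_def by blast
  from iso have f: "bij_betw f (verts H) {..<n}"
    by (simp add: graph_iso_def complete_graph_def)
  have e: "{u, v} \<in> edges H \<longleftrightarrow> {f u, f v} \<in> edges (complete_graph n)"
    if "u \<in> verts H" "v \<in> verts H" for u v
    using iso that unfolding graph_iso_def by blast
  have fin: "finite (verts H)" "card (verts H) = n"
    using bij_betw_finite[OF f] bij_betw_same_card[OF f] by simp_all
  have e': "{u, v} \<in> edges H \<longleftrightarrow> u \<noteq> v" if "u \<in> verts H" "v \<in> verts H" for u v
  proof -
    have "f u < n" "f v < n" "f u = f v \<longleftrightarrow> u = v"
      using f that by (auto simp: bij_betw_def inj_on_eq_iff)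
    then show ?thesis
      unfolding e[OF that] by (auto simp: complete_graph_def doubleton_eq_iff)
  qed
  have "edges H = {{u, v} | u v. u \<in> verts H \<and> v \<in> verts H \<and> u \<noteq> v}"
  proof
    show "edges H \<subseteq> {{u, v} | u v. u \<in> verts H \<and> v \<in> verts H \<and> u \<noteq> v}"
    proof
      fix x assume x: "x \<in> edges H"
      then have "x \<in> edges G" "x \<subseteq> verts H" using H by (auto simp: subgraph_def)
      moreover from \<open>x \<in> edges G\<close> obtain u v where "u \<noteq> v" "x = {u, v}"
        by (rule simple_graphE[OF G])
      ultimately show "x \<in> {{u, v} | u v. u \<in> verts H \<and> v \<in> verts H \<and> u \<noteq> v}" by auto
    qed
  qed (use e' in auto)
  then have "H = clique_graph (verts H)" by (simp add: clique_graph_def)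
  moreover have "clique G (verts H)"
    using H e' unfolding clique_def subgraph_def by blast
  ultimately show "\<exists>X. clique G X \<and> finite X \<and> card X = n \<and> H = clique_graph X"
    using fin by blast
next
  assume "\<exists>X. clique G X \<and> finite X \<and> card X = n \<and> H = clique_graph X"
  then obtain X where X: "clique G X" "finite X" "card X = n" and H: "H = clique_graph X" by blast
  obtain f where f: "bij_betw f X {..<n}"
    using X by (metis atLeast0LessThan ex_bij_betw_finite_nat)
  have "graph_iso f H (complete_graph n)"
    unfolding graph_iso_def H
  proof (intro conjI ballI)
    show "bij_betw f (verts (clique_graph X)) (verts (complete_graph n))"
      using f by (simp add: clique_graph_def complete_graph_def)
    fix u v assume "u \<in> verts (clique_graph X)" "v \<in> verts (clique_graph X)"
    then have uv: "u \<in> X" "v \<in> X" by simp_all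
    then have "f u < n" "f v < n" "f u = f v \<longleftrightarrow> u = v"
      using f by (auto simp: bij_betw_def inj_on_eq_iff)
    then show "{u, v} \<in> edges (clique_graph X) \<longleftrightarrow> {f u, f v} \<in> edges (complete_graph n)"
      using uv by (auto simp: clique_graph_def complete_graph_def doubleton_eq_iff)
  qed
  moreover have "subgraph H G"
    using X(1) by (auto simp: H subgraph_def clique_graph_def clique_def)
  ultimately show "H \<in> copies G (complete_graph n)"
    by (auto simp: copies_def graph_isomorphic_def)
qed

lemma induced_copies_complete_graph:
  assumes G: "simple_graph G"
  shows "induced_copies G (complete_graph n) = copies G (complete_graph n)"
proof
  show "induced_copies G (complete_graph n) \<subseteq> copies G (complete_graph n)"
    unfolding induced_copies_def copies_def induced_subgraph_def subgraph_def by blast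
  show "copies G (complete_graph n) \<subseteq> induced_copies G (complete_graph n)"
  proof
    fix H assume H: "H \<in> copies G (complete_graph n)"
    then obtain X where X: "clique G X" "H = clique_graph X"
      using copies_complete_graph[OF G] by blast
    have "induced_subgraph H G"
      unfolding induced_subgraph_def
    proof
      show "verts H \<subseteq> verts G" using X by (auto simp: clique_def)
      show "edges H = {e \<in> edges G. e \<subseteq> verts H}"
      proof
        show "edges H \<subseteq> {e \<in> edges G. e \<subseteq> verts H}"
          using X by (auto simp: clique_def clique_graph_def)
        show "{e \<in> edges G. e \<subseteq> verts H} \<subseteq> edges H"
        proof
          fix e assume e: "e \<in> {e \<in> edges G. e \<subseteq> verts H}"
          then have "e \<in> edges G" by simp
          then obtain u v where "u \<noteq> v" "e = {u, v}" by (rule simple_graphE[OF G])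
          with e show "e \<in> edges H" using X by (auto simp: clique_graph_def)
        qed
      qed
    qed
    with H show "H \<in> induced_copies G (complete_graph n)"
      by (auto simp: induced_copies_def copies_def)
  qed
qed

definition path3 :: "'a \<Rightarrow> 'a \<Rightarrow> 'a \<Rightarrow> 'a graph" where
  "path3 u v w = \<lparr>verts = {u, v, w}, edges = {{u, v}, {v, w}}\<rparr>"

lemma two_path_iff: "two_path p \<longleftrightarrow> (\<exists>u v w. distinct [u, v, w] \<and> p = path3 u v w)"
  by (simp add: two_path_def path3_def)

lemma cycle_graph_4:
  "cycle_graph [s, t, u, v] = \<lparr>verts = {s, t, u, v}, edges = {{s, t}, {t, u}, {u, v}, {v, s}}\<rparr>"
proof -
  have len: "length [s, t, u, v] = 4" by simp
  have "{i. i < (4::nat)} = {0, 1, 2, 3}" by auto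
  then have "{{[s, t, u, v] ! i, [s, t, u, v] ! (Suc i mod 4)} |i. i < 4} =
    (\<lambda>i. {[s, t, u, v] ! i, [s, t, u, v] ! (Suc i mod 4)}) ` {0, 1, 2, 3}"
    by blast
  also have "\<dots> = {{s, t}, {t, u}, {u, v}, {v, s}}" by simp
  finally show ?thesis
    unfolding cycle_graph_def len by simp
qed

text \<open>In terms of adjacencies the notion is easily transported along injections and rotated,
  and both are needed for admissibility.\<close>

lemma chordless_4_cycle_iff:
  assumes G: "simple_graph G"
  shows "chordless_cycle G [s, t, u, v] \<longleftrightarrow> distinct [s, t, u, v] \<and> {s, t} \<in> edges G \<and> {t, u} \<in> edges G \<and>
    {u, v} \<in> edges G \<and> {v, s} \<in> edges G \<and> {s, u} \<notin> edges G \<and> {t, v} \<notin> edges G"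
    (is "?L \<longleftrightarrow> ?R")
proof -
  note c = cycle_graph_4[of s t u v]
  show ?thesis
  proof
    assume ?L
    then have d: "distinct [s, t, u, v]" and e: "{{s, t}, {t, u}, {u, v}, {v, s}} = {e \<in> edges G. e \<subseteq> {s, t, u, v}}"
      by (auto simp: chordless_cycle_def is_cycle_def induced_subgraph_def c)
    from d have "{s, u} \<notin> {{s, t}, {t, u}, {u, v}, {v, s}}" "{t, v} \<notin> {{s, t}, {t, u}, {u, v}, {v, s}}"
      by (auto simp: doubleton_eq_iff)
    moreover have "x \<notin> edges G" if "x \<notin> {{s, t}, {t, u}, {u, v}, {v, s}}" "x \<subseteq> {s, t, u, v}" for x
      using that unfolding e by simp
    moreover have "{{s, t}, {t, u}, {u, v}, {v, s}} \<subseteq> edges G"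
      unfolding e by blast
    ultimately show ?R using d by simp
  next
    assume R: ?R
    then have "{s, t} \<subseteq> verts G" "{u, v} \<subseteq> verts G" using G by (simp_all only: simple_graph_def)
    then have "{s, t, u, v} \<subseteq> verts G" by simp
    moreover have "{{s, t}, {t, u}, {u, v}, {v, s}} = {e \<in> edges G. e \<subseteq> {s, t, u, v}}"
    proof
      show "{{s, t}, {t, u}, {u, v}, {v, s}} \<subseteq> {e \<in> edges G. e \<subseteq> {s, t, u, v}}" using R by blast
      show "{e \<in> edges G. e \<subseteq> {s, t, u, v}} \<subseteq> {{s, t}, {t, u}, {u, v}, {v, s}}"
      proof
        fix e assume "e \<in> {e \<in> edges G. e \<subseteq> {s, t, u, v}}"
        then have e: "e \<in> edges G" "e \<subseteq> {s, t, u, v}" by simp_all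
        from e(1) obtain x y where xy: "x \<noteq> y" "e = {x, y}"
          by (rule simple_graphE[OF G])
        then have "x \<in> {s, t, u, v}" "y \<in> {s, t, u, v}" "{x, y} \<in> edges G" using e by simp_all
        note xy this
        moreover have "{u, s} \<notin> edges G" "{v, t} \<notin> edges G"
          using R by (simp_all add: insert_commute)
        ultimately show "e \<in> {{s, t}, {t, u}, {u, v}, {v, s}}"
          using R by (auto simp: doubleton_eq_iff)
      qed
    qed
    ultimately show ?L
      using R by (auto simp: chordless_cycle_def is_cycle_def induced_subgraph_def subgraph_def c)
  qed
qed

subsection \<open>Transport along injections\<close>

lemma map_graph_sel [simp]:
  "verts (map_graph g y) = g ` verts y" "edges (map_graph g y) = (`) g ` edges y"
  by (simp_all add: map_graph_def)

lemma map_graph_comp: "map_graph g (map_graph h y) = map_graph (g \<circ> h) y"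
  by (simp add: map_graph_def image_comp comp_def image_image)

lemma map_graph_id: "map_graph id y = y"
  by (simp add: map_graph_def)

lemma map_graph_path3: "map_graph g (path3 u v w) = path3 (g u) (g v) (g w)"
  by (simp add: map_graph_def path3_def)

lemma inj_image_mem: "inj g \<Longrightarrow> g ` e \<in> (`) g ` E \<longleftrightarrow> e \<in> E"
  by (simp add: inj_image_mem_iff inj_on_image_eq_iff image_iff inj_image_eq_iff)

lemma doubleton_mem_map_graph: "inj g \<Longrightarrow> {g u, g v} \<in> edges (map_graph g y) \<longleftrightarrow> {u, v} \<in> edges y"
  using inj_image_mem[of g "{u, v}"] by simp

lemma inj_image_image_subset: "inj g \<Longrightarrow> (`) g ` E \<subseteq> (`) g ` F \<longleftrightarrow> E \<subseteq> F"
  by (rule inj_image_subset_iff) (simp add: inj_image_eq_iff inj_on_def)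

lemma subgraph_map_graph: "inj g \<Longrightarrow> subgraph (map_graph g x) (map_graph g y) \<longleftrightarrow> subgraph x y"
  by (simp add: subgraph_def inj_image_subset_iff inj_on_image_eq_iff inj_image_image_subset)

lemma graph_inter_map_graph:
  "inj g \<Longrightarrow> graph_inter (map_graph g x) (map_graph g y) = map_graph g (graph_inter x y)"
  by (simp add: graph_inter_def map_graph_def image_Int inj_on_image)
  
lemma inj_map_graph: "inj g \<Longrightarrow> inj (map_graph g)"
  by (rule injI) (auto simp: map_graph_def inj_image_eq_iff inj_on_image inj_on_image_eq_iff intro: graph.equality)

lemma simple_map_graph:
  assumes "inj g" "simple_graph y"
  shows "simple_graph (map_graph g y)"
  unfolding simple_graph_def
proof
  fix e assume "e \<in> edges (map_graph g y)"
  then obtain e' where e': "e' \<in> edges y" "e = g ` e'" by auto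
  from assms(2) e'(1) obtain u v where "u \<noteq> v" "e' = {u, v}" "u \<in> verts y" "v \<in> verts y"
    by (rule simple_graphE)
  then have "e = {g u, g v}" "g u \<noteq> g v" "e \<subseteq> verts (map_graph g y)"
    using e' assms(1) by (auto simp: inj_eq)
  then show "e \<subseteq> verts (map_graph g y) \<and> (\<exists>u v. u \<noteq> v \<and> e = {u, v})" by blast
qed

lemma map_graph_clique_graph:
  assumes g: "inj g"
  shows "map_graph g (clique_graph X) = clique_graph (g ` X)"
proof -
  have "(`) g ` {{u, v} | u v. u \<in> X \<and> v \<in> X \<and> u \<noteq> v} = {{g u, g v} | u v. u \<in> X \<and> v \<in> X \<and> u \<noteq> v}"
  proof -
    have "(`) g ` {{u, v} | u v. u \<in> X \<and> v \<in> X \<and> u \<noteq> v} = {g ` {u, v} | u v. u \<in> X \<and> v \<in> X \<and> u \<noteq> v}"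
      by blast
    then show ?thesis by simp
  qed
  also have "\<dots> = {{u, v} | u v. u \<in> g ` X \<and> v \<in> g ` X \<and> u \<noteq> v}"
  proof -
    have "{{u, v} | u v. u \<in> g ` X \<and> v \<in> g ` X \<and> u \<noteq> v} = {{g u, g v} | u v. u \<in> X \<and> v \<in> X \<and> g u \<noteq> g v}"
      by blast
    then show ?thesis using g by (simp add: inj_eq)
  qed
  finally show ?thesis by (simp add: map_graph_def clique_graph_def)
qed

lemma triangles_map_graph:
  assumes g: "inj g" and y: "simple_graph y" and T: "T \<in> triangles (map_graph g y)"
  shows "\<exists>T'\<in>triangles y. T = map_graph g T'"
proof -
  obtain X where X: "clique (map_graph g y) X" "finite X" "card X = 3" "T = clique_graph X"
    using T copies_complete_graph[OF simple_map_graph[OF g y]] by blast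
  then obtain Z where Z: "Z \<subseteq> verts y" "X = g ` Z"
    unfolding clique_def by (auto simp: subset_image_iff)
  have "clique y Z"
    using X(1) Z g unfolding clique_def by (auto simp: inj_eq doubleton_mem_map_graph simp del: map_graph_sel)
  moreover have "finite Z" "card Z = 3"
    using X Z g by (auto simp: card_image inj_on_subset finite_image_iff)
  moreover have "T = map_graph g (clique_graph Z)"
    using X(4) Z g by (simp add: map_graph_clique_graph)
  ultimately show ?thesis using copies_complete_graph[OF y] by blast
qed

text \<open>Reduces admissibility to a single member: an edge gets the colour of its preimage, and
  the paths are pushed forward.\<close>

lemma admissible_map_graph:
  assumes g: "inj g" and y: "simple_graph y" and W: "admissible y W"
  shows "admissible (map_graph g y) (map_graph g ` W)"
proof -
  obtain c P where part: "two_path_partition y W" and c: "c ` edges y \<subseteq> {..<3::nat}"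
    and tri: "\<forall>T\<in>triangles y. inj_on c (edges T)"
    and hole: "\<forall>s t u v. chordless_cycle y [s, t, u, v] \<longrightarrow> c {s, t} = c {u, v} \<and> c {t, u} = c {v, s}"
    and P: "\<forall>k<3. card (P k) = 4 \<and> (\<forall>p\<in>P k. two_path p) \<and> disjoint_family_on verts (P k) \<and>
               (\<Union>p\<in>P k. edges p) = {e \<in> edges y. c e = k}"
    and WP: "W = (\<Union>k<3. P k)"
    using W unfolding admissible_def by (elim conjE exE) (rule that)
  have tp: "two_path (map_graph g p)" if "two_path p" for p
  proof -
    from that obtain u v w where "distinct [u, v, w]" "p = path3 u v w"
      unfolding two_path_iff by blast
    then show ?thesis
      unfolding two_path_iff using g
      by (intro exI[of _ "g u"] exI[of _ "g v"] exI[of _ "g w"]) (simp add: map_graph_path3 inj_eq)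
  qed
  define c' where "c' e = c (g -` e)" for e
  have c'g: "c' (g ` e) = c e" for e
    using g by (simp add: c'_def inj_vimage_image_eq)
  have c'2: "c' {g u, g v} = c {u, v}" for u v
    using c'g[of "{u, v}"] by simp
  have ig: "map_graph g p = map_graph g q \<longleftrightarrow> p = q" for p q
    using inj_map_graph[OF g] by (simp add: inj_eq)
  show ?thesis
    unfolding admissible_def
  proof (intro conjI exI[of _ c'] exI[of _ "\<lambda>k. map_graph g ` P k"] allI impI ballI)
    show "two_path_partition (map_graph g y) (map_graph g ` W)"
      unfolding two_path_partition_def
    proof (intro conjI ballI)
      fix p assume "p \<in> map_graph g ` W"
      then show "two_path p" "subgraph p (map_graph g y)"
        using part tp subgraph_map_graph[OF g] unfolding two_path_partition_def by auto
    next
      fix e assume "e \<in> edges (map_graph g y)"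
      then obtain e' where e': "e' \<in> edges y" "e = g ` e'" by auto
      then obtain p where p: "p \<in> W" "e' \<in> edges p" "\<And>q. q \<in> W \<Longrightarrow> e' \<in> edges q \<Longrightarrow> q = p"
        using part unfolding two_path_partition_def by metis
      show "\<exists>!p. p \<in> map_graph g ` W \<and> e \<in> edges p"
      proof (rule ex1I[of _ "map_graph g p"])
        show "map_graph g p \<in> map_graph g ` W \<and> e \<in> edges (map_graph g p)"
          using p(1,2) e'(2) by simp
        show "q = map_graph g p" if "q \<in> map_graph g ` W \<and> e \<in> edges q" for q
          using that p(3) e' inj_image_mem[OF g] by (auto simp: ig)
      qed
    qed
    show "c' ` edges (map_graph g y) \<subseteq> {..<3}"
      using c c'g by auto
    show "inj_on c' (edges T)" if T: "T \<in> triangles (map_graph g y)" for T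
    proof -
      obtain T' where T': "T' \<in> triangles y" "T = map_graph g T'"
        using triangles_map_graph[OF g y T] by blast
      then show ?thesis
        using bspec[OF tri T'(1)] by (auto simp: inj_on_def c'g)
    qed
    show "map_graph g ` W = (\<Union>k<3. map_graph g ` P k)"
      by (auto simp: WP)
    fix s t u v assume h: "chordless_cycle (map_graph g y) [s, t, u, v]"
    then have "{s, t, u, v} \<subseteq> g ` verts y"
      by (auto simp: chordless_cycle_def induced_subgraph_def cycle_graph_def)
    then obtain s' t' u' v' where *: "s = g s'" "t = g t'" "u = g u'" "v = g v'" by auto
    then have "chordless_cycle y [s', t', u', v']"
      using h g unfolding chordless_4_cycle_iff[OF y] chordless_4_cycle_iff[OF simple_map_graph[OF g y]]
      by (auto simp: doubleton_mem_map_graph simp del: map_graph_sel)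
    with hole show "c' {s, t} = c' {u, v}" "c' {t, u} = c' {v, s}"
      by (simp_all add: * c'2)
  next
    fix k :: nat assume "k < 3"
    with P have Pk: "card (P k) = 4" "\<forall>p\<in>P k. two_path p" "disjoint_family_on verts (P k)"
      "(\<Union>p\<in>P k. edges p) = {e \<in> edges y. c e = k}" by simp_all
    show "card (map_graph g ` P k) = 4"
      using Pk inj_map_graph[OF g] by (auto simp: card_image inj_on_subset)
    show "two_path p" if "p \<in> map_graph g ` P k" for p
      using that Pk tp by auto
    show "disjoint_family_on verts (map_graph g ` P k)"
      using Pk g unfolding disjoint_family_on_def
      by (auto simp: image_Int[symmetric] ig)
    show "(\<Union>p\<in>map_graph g ` P k. edges p) = {e \<in> edges (map_graph g y). c' e = k}"
    proof -
      have "(\<Union>p\<in>map_graph g ` P k. edges p) = (`) g ` (\<Union>p\<in>P k. edges p)" by auto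
      also have "\<dots> = (`) g ` {e \<in> edges y. c e = k}" using Pk by simp
      also have "\<dots> = {e \<in> edges (map_graph g y). c' e = k}" by (auto simp: c'g)
      finally show ?thesis .
    qed
  qed
qed

subsection \<open>The family of members\<close>

lemma verts_Y [simp]: "verts Y_graph = UNIV"
  by (simp add: Y_graph_def biggs_smith_def)

lemma simple_Y: "simple_graph Y_graph"
  unfolding simple_graph_def by (auto simp: Y_graph_def biggs_smith_def)

definition Y_induced :: "bs_vertex set \<Rightarrow> bs_vertex graph" where
  "Y_induced X = \<lparr>verts = X, edges = {e \<in> edges Y_graph. e \<subseteq> X}\<rparr>"

lemma verts_Y_induced [simp]: "verts (Y_induced X) = X"
  by (simp add: Y_induced_def)

lemma edges_Y_induced: "e \<in> edges (Y_induced X) \<longleftrightarrow> e \<in> edges Y_graph \<and> e \<subseteq> X"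
  by (simp add: Y_induced_def)

lemma Y_induced_adj: "{u, v} \<in> edges (Y_induced X) \<longleftrightarrow> v \<in> bs_sphere3 u \<and> u \<in> X \<and> v \<in> X"
  by (simp add: edges_Y_induced Y_adj_iff)

lemma Y_edgeE:
  assumes "e \<in> edges Y_graph"
  obtains u v where "e = {u, v}" "v \<in> bs_sphere3 u"
  using simple_graphE[OF simple_Y assms] assms by (metis Y_adj_iff)

lemma simple_Y_induced: "simple_graph (Y_induced X)"
  using simple_Y by (auto simp: simple_graph_def edges_Y_induced)

lemma Y_induced_eq_iff: "Y_induced X = Y_induced X' \<longleftrightarrow> X = X'"
  by (metis verts_Y_induced)

definition bs_nbhd :: "bs_vertex set \<Rightarrow> bs_vertex set" where
  "bs_nbhd K = (\<Union>k\<in>K. bs_nbrs k)"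

definition K4_set :: "bs_vertex set \<Rightarrow> bool" where
  "K4_set K \<longleftrightarrow> card K = 4 \<and> clique Y_graph K"

text \<open>The 612 edges of Y split into copies of \<open>K\<^sub>4\<close> with six edges each,
  which is where the number 102 comes from.\<close>

definition cubocts :: "bs_vertex graph set" where
  "cubocts = (\<lambda>K. Y_induced (bs_nbhd K)) ` {K. K4_set K}"

text \<open>Given for every graph and by adjacencies only, so that it commutes with Biggs-Smith
  automorphisms and can be studied in one member.\<close>

definition Omega :: "bs_vertex graph \<Rightarrow> bs_vertex graph set" where
  "Omega y = {path3 u v w | u v w.
     {u, v} \<in> edges y \<and> {v, w} \<in> edges y \<and> u \<noteq> w \<and> (\<exists>x\<in>bs_nbrs u. x \<in> bs_nbrs w)}"

lemma bs_aut_inj: "bs_aut g \<Longrightarrow> inj g"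
  by (simp add: bs_aut_def bij_is_inj)

lemma bs_aut_image_nbrs:
  assumes "bs_aut g"
  shows "g ` bs_nbrs v = bs_nbrs (g v)"
proof
  show "g ` bs_nbrs v \<subseteq> bs_nbrs (g v)" using bs_aut_nbrs[OF assms] by auto
  show "bs_nbrs (g v) \<subseteq> g ` bs_nbrs v"
  proof
    fix x assume x: "x \<in> bs_nbrs (g v)"
    have "surj g" using assms by (simp add: bs_aut_def bij_is_surj)
    then obtain z where "x = g z" by (rule surjE)
    with x show "x \<in> g ` bs_nbrs v" using bs_aut_nbrs[OF assms] by auto
  qed
qed

lemma bs_nbhd_image:
  assumes "bs_aut g"
  shows "bs_nbhd (g ` K) = g ` bs_nbhd K"
  unfolding bs_nbhd_def image_UN by (simp add: bs_aut_image_nbrs[OF assms])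

lemma bs_aut_Y_edge:
  assumes "bs_aut g"
  shows "g ` e \<in> edges Y_graph \<longleftrightarrow> e \<in> edges Y_graph"
proof
  have *: "h ` e \<in> edges Y_graph" if h: "bs_aut h" and e: "e \<in> edges Y_graph" for h e
  proof -
    from e obtain u v where "e = {u, v}" "v \<in> bs_sphere3 u" by (rule Y_edgeE)
    then show ?thesis using bs_aut_sphere3[OF h] by (simp add: Y_adj_iff)
  qed
  show "g ` e \<in> edges Y_graph" if "e \<in> edges Y_graph"
    using *[OF assms that] .
  show "e \<in> edges Y_graph" if "g ` e \<in> edges Y_graph"
  proof -
    have "inv_into UNIV g ` g ` e = e"
      using bs_aut_inj[OF assms] by (simp add: image_image)
    then show ?thesis using *[OF bs_aut_inv[OF assms] that] by simp
  qed
qed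

lemma map_graph_Y_induced:
  assumes g: "bs_aut g"
  shows "map_graph g (Y_induced X) = Y_induced (g ` X)"
proof -
  have "(`) g ` {e \<in> edges Y_graph. e \<subseteq> X} = {e \<in> edges Y_graph. e \<subseteq> g ` X}"
  proof
    show "(`) g ` {e \<in> edges Y_graph. e \<subseteq> X} \<subseteq> {e \<in> edges Y_graph. e \<subseteq> g ` X}"
      using bs_aut_Y_edge[OF g] by auto
    show "{e \<in> edges Y_graph. e \<subseteq> g ` X} \<subseteq> (`) g ` {e \<in> edges Y_graph. e \<subseteq> X}"
    proof
      fix e assume e: "e \<in> {e \<in> edges Y_graph. e \<subseteq> g ` X}"
      then obtain e' where "e' \<subseteq> X" "e = g ` e'" by (auto simp: subset_image_iff)
      with e show "e \<in> (`) g ` {e \<in> edges Y_graph. e \<subseteq> X}" using bs_aut_Y_edge[OF g] by auto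
    qed
  qed
  then show ?thesis by (simp add: map_graph_def Y_induced_def)
qed

lemma clique_Y_iff: "clique Y_graph X \<longleftrightarrow> (\<forall>u\<in>X. \<forall>v\<in>X. u \<noteq> v \<longrightarrow> v \<in> bs_sphere3 u)"
  by (simp add: clique_def Y_adj_iff)

lemma K4_set_image:
  assumes g: "bs_aut g"
  shows "K4_set (g ` K) \<longleftrightarrow> K4_set K"
  using bs_aut_inj[OF g]
  by (simp add: K4_set_def clique_Y_iff bs_aut_sphere3[OF g] bs_aut_eq_iff[OF g] card_image inj_on_subset)

lemma cubocts_map_graph:
  assumes g: "bs_aut g"
  shows "map_graph g y \<in> cubocts \<longleftrightarrow> y \<in> cubocts"
proof
  have *: "map_graph h y \<in> cubocts" if h: "bs_aut h" and y: "y \<in> cubocts" for h y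
  proof -
    from y obtain K where "K4_set K" "y = Y_induced (bs_nbhd K)" by (auto simp: cubocts_def)
    then show ?thesis
      using K4_set_image[OF h]
      by (auto simp: cubocts_def map_graph_Y_induced[OF h] bs_nbhd_image[OF h, symmetric])
  qed
  show "map_graph g y \<in> cubocts" if "y \<in> cubocts"
    using *[OF g that] .
  have "inv_into UNIV g \<circ> g = id"
    using bs_aut_inj[OF g] by (simp add: fun_eq_iff)
  then show "y \<in> cubocts" if "map_graph g y \<in> cubocts"
    using *[OF bs_aut_inv[OF g] that] by (simp add: map_graph_comp map_graph_id)
qed

text \<open>The means of transporting counts: a set of members given by a property is the image of
  the corresponding set at the base configuration.\<close>

lemma cubocts_Collect_image:
  assumes g: "bs_aut g"
  shows "{y \<in> cubocts. Q y} = map_graph g ` {y \<in> cubocts. Q (map_graph g y)}"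
proof
  show "map_graph g ` {y \<in> cubocts. Q (map_graph g y)} \<subseteq> {y \<in> cubocts. Q y}"
    using cubocts_map_graph[OF g] by auto
  show "{y \<in> cubocts. Q y} \<subseteq> map_graph g ` {y \<in> cubocts. Q (map_graph g y)}"
  proof
    fix y assume y: "y \<in> {y \<in> cubocts. Q y}"
    have "surj g" using g by (simp add: bs_aut_def bij_is_surj)
    then have "g \<circ> inv_into UNIV g = id" by (simp add: fun_eq_iff surj_f_inv_f)
    then have "map_graph g (map_graph (inv_into UNIV g) y) = y"
      by (simp add: map_graph_comp map_graph_id)
    then show "y \<in> map_graph g ` {y \<in> cubocts. Q (map_graph g y)}"
      using y cubocts_map_graph[OF g, of "map_graph (inv_into UNIV g) y"]
      by (intro image_eqI[of _ _ "map_graph (inv_into UNIV g) y"]) auto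
  qed
qed

lemma Omega_map_graph:
  assumes g: "bs_aut g"
  shows "Omega (map_graph g y) = map_graph g ` Omega y"
proof -
  have nb: "(\<exists>x\<in>bs_nbrs (g u). x \<in> bs_nbrs (g w)) \<longleftrightarrow> (\<exists>x\<in>bs_nbrs u. x \<in> bs_nbrs w)" for u w
    by (simp add: bs_aut_image_nbrs[OF g, symmetric] inj_image_mem_iff[OF bs_aut_inj[OF g]])
  note adj = doubleton_mem_map_graph[OF bs_aut_inj[OF g]]
  show ?thesis
  proof
    show "map_graph g ` Omega y \<subseteq> Omega (map_graph g y)"
    proof
      fix p assume "p \<in> map_graph g ` Omega y"
      then obtain q where "q \<in> Omega y" and p: "p = map_graph g q" by blast
      then obtain u v w where q: "q = path3 u v w" "{u, v} \<in> edges y" "{v, w} \<in> edges y" "u \<noteq> w"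
        "\<exists>x\<in>bs_nbrs u. x \<in> bs_nbrs w"
        unfolding Omega_def by blast
      then have "p = path3 (g u) (g v) (g w)" by (simp add: p map_graph_path3)
      note q(2-) this
      then show "p \<in> Omega (map_graph g y)"
        unfolding Omega_def mem_Collect_eq
        by (intro exI[of _ "g u"] exI[of _ "g v"] exI[of _ "g w"])
          (simp only: adj nb bs_aut_eq_iff[OF g] simp_thms)
    qed
    show "Omega (map_graph g y) \<subseteq> map_graph g ` Omega y"
    proof
      fix p assume "p \<in> Omega (map_graph g y)"
      then obtain u v w where p: "p = path3 u v w" "{u, v} \<in> edges (map_graph g y)"
        "{v, w} \<in> edges (map_graph g y)" "u \<noteq> w" "\<exists>x\<in>bs_nbrs u. x \<in> bs_nbrs w"
        unfolding Omega_def by blast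
      have "surj g" using g by (simp add: bs_aut_def bij_is_surj)
      then obtain u' v' w' where "u = g u'" "v = g v'" "w = g w'" by (metis surjD)
      with p have "p = map_graph g (path3 u' v' w')" "path3 u' v' w' \<in> Omega y"
        unfolding Omega_def mem_Collect_eq map_graph_path3
        by (simp_all only: adj nb bs_aut_eq_iff[OF g] simp_thms) blast
      then show "p \<in> map_graph g ` Omega y" by blast
    qed
  qed
qed

lemma bs_aut_automorphism:
  assumes g: "bs_aut g"
  shows "g \<in> automorphisms Y_graph"
  using g bs_aut_sphere3[OF g]
  by (simp add: automorphisms_def Bij_def graph_iso_def Y_adj_iff bs_aut_def)

subsection \<open>The members through the base edge\<close>

text \<open>The edge between \<open>VB 0\<close> and \<open>VA 2\<close> lies in exactly these four members. The member on \<open>cuboct0\<close> shares a 2-path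
  with the next one, only this edge with the third one and a triangle with the last one.\<close>

definition cuboct0 :: "bs_vertex set" where
  "cuboct0 = {VA 1, VA 16, VB 0, VA 2, VC 2, VE 2, VA 15, VC 15, VE 15, VD 2, VD 15, VE 0}"

definition cuboct1 :: "bs_vertex set" where
  "cuboct1 = {VA 1, VA 16, VB 0, VA 4, VA 2, VB 3, VC 8, VC 0, VB 4, VC 3, VC 12, VB 16}"

definition cuboct2 :: "bs_vertex set" where
  "cuboct2 = {VA 2, VA 0, VB 1, VA 5, VA 3, VB 4, VC 4, VC 13, VB 0, VC 9, VC 1, VB 5}"

definition cuboct3 :: "bs_vertex set" where
  "cuboct3 = {VA 2, VA 0, VB 1, VB 0, VD 0, VF 0, VB 2, VD 2, VF 2, VF 9, VF 10, VE 1}"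

lemmas cuboct_defs = cuboct0_def cuboct1_def cuboct2_def cuboct3_def

lemmas nbhd_eval = bs_nbhd_def UN_insert UN_empty Un_insert_left Un_empty_left Un_empty_right bs_nbrs.simps eval_17

lemma bs_nbhd_eval:
  "bs_nbhd {VA 0, VB 2, VB 15, VD 0} = cuboct0"
  "bs_nbhd {VA 0, VA 3, VC 4, VC 16} = cuboct1"
  "bs_nbhd {VA 1, VA 4, VC 0, VC 5} = cuboct2"
  "bs_nbhd {VA 1, VE 0, VE 2, VF 1} = cuboct3"
  by (simp_all only: nbhd_eval cuboct_defs)

lemma K4_set_eval:
  "K4_set {VA 0, VB 2, VB 15, VD 0}"
  "K4_set {VA 0, VA 3, VC 4, VC 16}"
  "K4_set {VA 1, VA 4, VC 0, VC 5}"
  "K4_set {VA 1, VE 0, VE 2, VF 1}"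
  by (simp_all add: K4_set_def clique_Y_iff)

text \<open>The other two vertices of \<open>K\<close> are common neighbours of \<open>u\<close> and
  \<open>v\<close>, and there are at most two of these.\<close>

lemma K4_set_through:
  assumes K: "K4_set K" and uv: "u \<in> K" "v \<in> K" "u \<noteq> v"
    and c: "bs_sphere3 u \<inter> bs_sphere3 v = {p, q}"
  shows "K = {u, v, p, q}"
proof -
  have fin: "finite K" and card: "card K = 4"
    using K by (auto simp: K4_set_def intro: card_ge_0_finite)
  have sub: "K - {u, v} \<subseteq> {p, q}"
    using K uv c[symmetric] unfolding K4_set_def clique_Y_iff by auto
  have "card (K - {u, v}) = 2"
    using uv card fin by (simp add: card_Diff_subset)
  moreover have "card {p, q} \<le> 2" by (simp add: card_insert_if)
  ultimately have "K - {u, v} = {p, q}"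
    using sub by (intro card_seteq) simp_all
  then show ?thesis using uv by blast
qed

lemma common_eval:
  "bs_sphere3 (VA 0) \<inter> bs_sphere3 (VB 2) = {VB 15, VD 0}"
  "bs_sphere3 (VA 0) \<inter> bs_sphere3 (VA 3) = {VC 4, VC 16}"
  "bs_sphere3 (VC 0) \<inter> bs_sphere3 (VA 1) = {VA 4, VC 5}"
  "bs_sphere3 (VE 0) \<inter> bs_sphere3 (VA 1) = {VE 2, VF 1}"
  by (simp_all only: bs_sphere3.simps eval_17 set_eval)

text \<open>The vertices \<open>VB 0\<close> and \<open>VA 2\<close> have no common Biggs-Smith
  neighbour, so their neighbours j and k in \<open>K\<close> are distinct and hence adjacent in Y.
  This leaves four of the nine pairs, and each pair determines \<open>K\<close>.\<close>

lemma K4_set_base: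
  assumes K: "K4_set K" and "VB 0 \<in> bs_nbhd K" "VA 2 \<in> bs_nbhd K"
  shows "K \<in> {{VA 0, VB 2, VB 15, VD 0}, {VA 0, VA 3, VC 4, VC 16}, {VA 1, VA 4, VC 0, VC 5}, {VA 1, VE 0, VE 2, VF 1}}"
proof -
  obtain j k where jk: "j \<in> K" "k \<in> K" "j \<in> bs_nbrs (VB 0)" "k \<in> bs_nbrs (VA 2)"
    using assms(2,3) unfolding bs_nbhd_def by (auto simp: bs_nbrs_sym[of "VB 0"] bs_nbrs_sym[of "VA 2"] simp del: bs_nbrs.simps)
  have "\<forall>j\<in>bs_nbrs (VB 0). \<forall>k\<in>bs_nbrs (VA 2). j \<noteq> k"
    by (simp only: bs_nbrs.simps eval_17 set_eval)
  with jk have ne: "j \<noteq> k" by blast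
  then have adj: "k \<in> bs_sphere3 j"
    using K jk unfolding K4_set_def clique_Y_iff by blast
  have "\<forall>j\<in>bs_nbrs (VB 0). \<forall>k\<in>bs_nbrs (VA 2). k \<in> bs_sphere3 j \<longrightarrow>
     j = VA 0 \<and> k = VB 2 \<or> j = VA 0 \<and> k = VA 3 \<or> j = VC 0 \<and> k = VA 1 \<or> j = VE 0 \<and> k = VA 1"
    by (simp only: bs_nbrs.simps bs_sphere3.simps eval_17 set_eval)
  with jk adj consider "j = VA 0 \<and> k = VB 2" | "j = VA 0 \<and> k = VA 3" | "j = VC 0 \<and> k = VA 1" | "j = VE 0 \<and> k = VA 1"
    by blast
  then show ?thesis
    using K4_set_through[OF K jk(1,2) ne] common_eval by cases (auto simp del: bs_sphere3.simps)
qed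

lemma cubocts_base:
  "{y \<in> cubocts. {VB 0, VA 2} \<in> edges y} =
     {Y_induced cuboct0, Y_induced cuboct1, Y_induced cuboct2, Y_induced cuboct3}"
proof
  show "{y \<in> cubocts. {VB 0, VA 2} \<in> edges y} \<subseteq>
     {Y_induced cuboct0, Y_induced cuboct1, Y_induced cuboct2, Y_induced cuboct3}"
  proof
    fix y assume "y \<in> {y \<in> cubocts. {VB 0, VA 2} \<in> edges y}"
    then obtain K where K: "K4_set K" "y = Y_induced (bs_nbhd K)" "VB 0 \<in> bs_nbhd K" "VA 2 \<in> bs_nbhd K"
      by (auto simp: cubocts_def Y_induced_adj simp del: bs_sphere3.simps)
    from K4_set_base[OF K(1,3,4)] K(2)
    show "y \<in> {Y_induced cuboct0, Y_induced cuboct1, Y_induced cuboct2, Y_induced cuboct3}"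
      by (elim insertE emptyE) (simp_all add: bs_nbhd_eval)
  qed
  have "Y_induced cuboct0 \<in> cubocts" "Y_induced cuboct1 \<in> cubocts" "Y_induced cuboct2 \<in> cubocts"
    "Y_induced cuboct3 \<in> cubocts"
    unfolding cubocts_def bs_nbhd_eval[symmetric] using K4_set_eval by blast+
  then show "{Y_induced cuboct0, Y_induced cuboct1, Y_induced cuboct2, Y_induced cuboct3} \<subseteq>
      {y \<in> cubocts. {VB 0, VA 2} \<in> edges y}"
    by (simp add: Y_induced_adj cuboct_defs)
qed

lemma cubocts_distinct: "distinct [cuboct0, cuboct1, cuboct2, cuboct3]"
proof -
  have *: "A \<noteq> B" if "x \<in> A" "x \<notin> B" for A B :: "bs_vertex set" and x
    using that by blast
  have "cuboct0 \<noteq> cuboct1" "cuboct0 \<noteq> cuboct2" "cuboct0 \<noteq> cuboct3" "cuboct1 \<noteq> cuboct2"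
    "cuboct1 \<noteq> cuboct3" "cuboct2 \<noteq> cuboct3"
    by (rule *[of "VC 2"] *[of "VA 4"] *[of "VA 5"], simp add: cuboct_defs, simp add: cuboct_defs)+
  then show ?thesis by simp
qed

text \<open>Makes the stabilizer of the base edge transitive on the four members through it. The
  first word fixes both ends of the edge, the other two exchange them.\<close>

lemma flag_words:
  "word5 4 10 3 ` cuboct0 = cuboct1" "word5 4 10 3 ` {VB 0, VA 2} = {VB 0, VA 2}"
  "word3 14 3 ` cuboct0 = cuboct2" "word3 14 3 ` {VB 0, VA 2} = {VB 0, VA 2}"
  "word3 4 13 ` cuboct0 = cuboct3" "word3 4 13 ` {VB 0, VA 2} = {VB 0, VA 2}"
  by (simp_all only: set_eq_subset subset_iff[symmetric] subset_eq cuboct_defs image_insert image_empty word_eval set_eval)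

text \<open>Arc transitivity brings the edge to the base edge. The member is then one of four, and
  \<open>flag_words\<close> corrects it without moving the edge.\<close>

lemma flag_transitive:
  assumes y: "y \<in> cubocts" and e: "e \<in> edges y"
  obtains g where "g \<in> bs_group" "y = map_graph g (Y_induced cuboct0)" "e = g ` {VB 0, VA 2}"
proof -
  have "e \<in> edges Y_graph"
    using y e by (auto simp: cubocts_def edges_Y_induced)
  then obtain u v where uv: "e = {u, v}" "v \<in> bs_sphere3 u" by (rule Y_edgeE)
  then obtain h where h: "h \<in> bs_group" "h (VB 0) = u" "h (VA 2) = v"
    using bs_group_arc_transitive by blast
  note ha = bs_group_aut[OF h(1)]
  have "y \<in> map_graph h ` {y \<in> cubocts. h ` {VB 0, VA 2} \<in> edges (map_graph h y)}"
    using y e uv h by (subst cubocts_Collect_image[OF ha, symmetric]) simp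
  then obtain y' where y': "y' \<in> cubocts" "{VB 0, VA 2} \<in> edges y'" "y = map_graph h y'"
    unfolding map_graph_sel inj_image_mem[OF bs_aut_inj[OF ha]] by blast
  then have "y' \<in> {Y_induced cuboct0, Y_induced cuboct1, Y_induced cuboct2, Y_induced cuboct3}"
    using cubocts_base by blast
  then obtain k where k: "k \<in> bs_group" "y' = Y_induced (k ` cuboct0)" "k ` {VB 0, VA 2} = {VB 0, VA 2}"
    using flag_words bs_group_word bs_group_id by (elim insertE emptyE) (metis image_id id_apply)+
  show thesis
  proof (rule that[of "h \<circ> k"])
    show "h \<circ> k \<in> bs_group" using h k by (intro bs_group_comp)
    show "y = map_graph (h \<circ> k) (Y_induced cuboct0)"
      using y' k by (simp add: map_graph_comp[symmetric] map_graph_Y_induced[OF bs_group_aut])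
    show "e = (h \<circ> k) ` {VB 0, VA 2}"
      using uv h k(3) by (metis image_comp image_insert image_empty)
  qed
qed

subsection \<open>The isomorphism with the line graph of the cube\<close>

definition cuboct_nbrs :: "bs_vertex \<Rightarrow> bs_vertex set" where
  "cuboct_nbrs u = cuboct0 \<inter> bs_sphere3 u"

lemma cuboct_nbrs_eval:
  "cuboct_nbrs (VA 1) = {VC 2, VE 2, VA 15, VE 0}"
  "cuboct_nbrs (VA 16) = {VA 2, VC 15, VE 15, VE 0}"
  "cuboct_nbrs (VB 0) = {VA 2, VA 15, VD 2, VD 15}"
  "cuboct_nbrs (VA 2) = {VA 16, VB 0, VC 15, VD 2}"
  "cuboct_nbrs (VC 2) = {VA 1, VA 15, VE 15, VD 2}"
  "cuboct_nbrs (VE 2) = {VA 1, VC 15, VD 15, VE 0}"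
  "cuboct_nbrs (VA 15) = {VA 1, VB 0, VC 2, VD 15}"
  "cuboct_nbrs (VC 15) = {VA 16, VA 2, VE 2, VD 15}"
  "cuboct_nbrs (VE 15) = {VA 16, VC 2, VD 2, VE 0}"
  "cuboct_nbrs (VD 2) = {VB 0, VA 2, VC 2, VE 15}"
  "cuboct_nbrs (VD 15) = {VB 0, VE 2, VA 15, VC 15}"
  "cuboct_nbrs (VE 0) = {VA 1, VA 16, VE 2, VE 15}"
  by (simp_all only: cuboct_nbrs_def cuboct0_def bs_sphere3.simps eval_17 set_eval)

lemma cuboct0_adj:
  "{u, v} \<in> edges (Y_induced cuboct0) \<longleftrightarrow> u \<in> cuboct0 \<and> v \<in> cuboct_nbrs u"
  by (auto simp: Y_induced_adj cuboct_nbrs_def simp del: bs_sphere3.simps)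

lemmas cuboct_eval = cuboct0_def cuboct_nbrs_eval eval_17 set_eval

lemma less_3_cases: "k < 3 \<longleftrightarrow> k = 0 \<or> k = 1 \<or> k = (2::nat)"
  by auto

lemma hypercube_3_adj:
  "{[a, b, c], [a', b', c']} \<in> edges (hypercube 3) \<longleftrightarrow>
     a \<noteq> a' \<and> b = b' \<and> c = c' \<or> a = a' \<and> b \<noteq> b' \<and> c = c' \<or> a = a' \<and> b = b' \<and> c \<noteq> c'"
proof -
  have *: "{i. i < 3 \<and> Q i} = (if Q 0 then {0} else {}) \<union> (if Q 1 then {1} else {}) \<union> (if Q 2 then {2} else {})"
    for Q :: "nat \<Rightarrow> bool"
  proof (rule Set.set_eqI)
    fix i show "i \<in> {i. i < 3 \<and> Q i} \<longleftrightarrow> i \<in> (if Q 0 then {0} else {}) \<union> (if Q 1 then {1} else {}) \<union> (if Q 2 then {2} else {})"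
      by (cases "i = 0 \<or> i = 1 \<or> i = 2") auto
  qed
  have card: "card {i. i < 3 \<and> xs ! i \<noteq> ys ! i} = 1 \<longleftrightarrow>
     a \<noteq> a' \<and> b = b' \<and> c = c' \<or> a = a' \<and> b \<noteq> b' \<and> c = c' \<or> a = a' \<and> b = b' \<and> c \<noteq> c'"
    if "xs = [a, b, c]" "ys = [a', b', c']" for xs ys a b c a' b' c'
    unfolding * that by simp
  \<comment> \<open>The two sides of an edge of the cube can match the given pair in either
    order.\<close>
  have ex: "(\<exists>xs ys. {p, q} = {xs, ys} \<and> length xs = 3 \<and> length ys = 3 \<and> R xs ys) \<longleftrightarrow> R p q \<or> R q p"
    if "length p = 3" "length q = 3" for p q :: "bool list" and R
    using that unfolding doubleton_eq_iff by blast
  have "{[a, b, c], [a', b', c']} \<in> edges (hypercube 3) \<longleftrightarrow>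
    (\<exists>xs ys. {[a, b, c], [a', b', c']} = {xs, ys} \<and> length xs = 3 \<and> length ys = 3 \<and>
      card {i. i < 3 \<and> xs ! i \<noteq> ys ! i} = 1)"
    by (simp add: hypercube_def)
  also have "\<dots> \<longleftrightarrow> card {i. i < 3 \<and> [a, b, c] ! i \<noteq> [a', b', c'] ! i} = 1 \<or>
      card {i. i < 3 \<and> [a', b', c'] ! i \<noteq> [a, b, c] ! i} = 1"
    by (rule ex) simp_all
  also have "\<dots> \<longleftrightarrow> a \<noteq> a' \<and> b = b' \<and> c = c' \<or> a = a' \<and> b \<noteq> b' \<and> c = c' \<or> a = a' \<and> b = b' \<and> c \<noteq> c'"
    unfolding card[OF refl refl] by blast
  finally show ?thesis .
qed

text \<open>The triangles of the member become the triples of edges at the vertices of the cube. The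
  three Biggs-Smith neighbours of a vertex of the underlying \<open>K\<^sub>4\<close> become
  pairwise disjoint edges in the three directions.\<close>

definition cube_edge :: "bs_vertex \<Rightarrow> bool list set" where
  "cube_edge v = the (map_of [
     (VA 1, {[False, False, False], [True, False, False]}),
     (VA 16, {[True, False, True], [True, True, True]}),
     (VB 0, {[False, True, False], [False, True, True]}),
     (VA 2, {[False, True, True], [True, True, True]}),
     (VC 2, {[False, False, False], [False, False, True]}),
     (VE 2, {[True, False, False], [True, True, False]}),
     (VA 15, {[False, False, False], [False, True, False]}),
     (VC 15, {[True, True, False], [True, True, True]}),
     (VE 15, {[False, False, True], [True, False, True]}),
     (VD 2, {[False, False, True], [False, True, True]}),
     (VD 15, {[False, True, False], [True, True, False]}),
     (VE 0, {[True, False, False], [True, False, True]})] v)"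

lemma cube_edge_eval:
  "cube_edge (VA 1) = {[False, False, False], [True, False, False]}"
  "cube_edge (VA 16) = {[True, False, True], [True, True, True]}"
  "cube_edge (VB 0) = {[False, True, False], [False, True, True]}"
  "cube_edge (VA 2) = {[False, True, True], [True, True, True]}"
  "cube_edge (VC 2) = {[False, False, False], [False, False, True]}"
  "cube_edge (VE 2) = {[True, False, False], [True, True, False]}"
  "cube_edge (VA 15) = {[False, False, False], [False, True, False]}"
  "cube_edge (VC 15) = {[True, True, False], [True, True, True]}"
  "cube_edge (VE 15) = {[False, False, True], [True, False, True]}"
  "cube_edge (VD 2) = {[False, False, True], [False, True, True]}"
  "cube_edge (VD 15) = {[False, True, False], [True, True, False]}"
  "cube_edge (VE 0) = {[True, False, False], [True, False, True]}"
  unfolding cube_edge_def by simp_all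

lemma edges_hypercube_3: "edges (hypercube 3) = cube_edge ` cuboct0"
proof
  show "cube_edge ` cuboct0 \<subseteq> edges (hypercube 3)"
    unfolding image_subset_iff by (simp add: cuboct0_def cube_edge_eval hypercube_3_adj)
  show "edges (hypercube 3) \<subseteq> cube_edge ` cuboct0"
  proof
    fix e assume e: "e \<in> edges (hypercube 3)"
    then obtain xs ys where xy: "e = {xs, ys}" "length xs = 3" "length ys = 3"
      unfolding hypercube_def by auto
    have "\<exists>a b c. zs = [a, b, c]" if "length zs = 3" for zs :: "bool list"
      using that by (auto simp: numeral_3_eq_3 length_Suc_conv)
    with xy obtain a b c a' b' c' where "e = {[a, b, c], [a', b', c']}" by metis
    moreover from this e have "a \<noteq> a' \<and> b = b' \<and> c = c' \<or> a = a' \<and> b \<noteq> b' \<and> c = c' \<or> a = a' \<and> b = b' \<and> c \<noteq> c'"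
      by (simp only: hypercube_3_adj)
    ultimately show "e \<in> cube_edge ` cuboct0"
      unfolding cuboct0_def image_insert image_empty cube_edge_eval
      by (cases a; cases b; cases c; cases a'; cases b'; cases c')
        (simp_all add: doubleton_eq_iff)
  qed
qed

lemma line_graph_adj:
  "{e, f} \<in> edges (line_graph G) \<longleftrightarrow> e \<in> edges G \<and> f \<in> edges G \<and> e \<noteq> f \<and> e \<inter> f \<noteq> {}"
  by (auto simp: line_graph_def doubleton_eq_iff)

lemma cuboct0_isomorphic: "graph_isomorphic (Y_induced cuboct0) (line_graph (hypercube 3))"
proof -
  have disj: "{a, b} \<inter> {c, d} = {} \<longleftrightarrow> a \<noteq> c \<and> a \<noteq> d \<and> b \<noteq> c \<and> b \<noteq> d" for a b c d :: "bool list"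
    by auto
  have inj: "\<forall>u\<in>cuboct0. \<forall>v\<in>cuboct0. cube_edge u = cube_edge v \<longrightarrow> u = v"
    by (simp only: cuboct_eval cube_edge_eval doubleton_eq_iff list.inject)
  have adj: "\<forall>u\<in>cuboct0. \<forall>v\<in>cuboct0. v \<in> cuboct_nbrs u \<longleftrightarrow>
      cube_edge u \<noteq> cube_edge v \<and> cube_edge u \<inter> cube_edge v \<noteq> {}"
    by (simp only: cuboct_eval cube_edge_eval doubleton_eq_iff list.inject disj insert_not_empty)
  have "graph_iso cube_edge (Y_induced cuboct0) (line_graph (hypercube 3))"
    unfolding graph_iso_def
  proof (intro conjI ballI)
    show "bij_betw cube_edge (verts (Y_induced cuboct0)) (verts (line_graph (hypercube 3)))"
      using inj by (auto simp: bij_betw_def inj_on_def line_graph_def edges_hypercube_3)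
    fix u v assume "u \<in> verts (Y_induced cuboct0)" "v \<in> verts (Y_induced cuboct0)"
    then show "{u, v} \<in> edges (Y_induced cuboct0) \<longleftrightarrow> {cube_edge u, cube_edge v} \<in> edges (line_graph (hypercube 3))"
      using adj by (simp add: cuboct0_adj line_graph_adj edges_hypercube_3)
  qed
  then show ?thesis by (auto simp: graph_isomorphic_def)
qed

subsection \<open>The partition into 2-paths\<close>

text \<open>The second component is the middle of the path, and every vertex of the member is the
  middle of exactly one of the twelve paths.\<close>

definition cuboct_paths :: "nat \<Rightarrow> (bs_vertex \<times> bs_vertex \<times> bs_vertex) set" where
  "cuboct_paths k = (if k = 0 then
       {(VC 2, VA 1, VE 2), (VA 16, VA 2, VB 0), (VD 2, VE 15, VE 0), (VA 15, VD 15, VC 15)}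
     else if k = 1 then
       {(VC 15, VA 16, VE 15), (VD 15, VE 2, VE 0), (VA 1, VA 15, VB 0), (VA 2, VD 2, VC 2)}
     else {(VD 2, VB 0, VD 15), (VA 15, VC 2, VE 15), (VA 2, VC 15, VE 2), (VA 1, VE 0, VA 16)})"

text \<open>The member on \<open>cuboct0\<close> comes from the \<open>K\<^sub>4\<close> on \<open>VA 0, VB 2, VB 15, VD 0\<close>. Each of the sets of six vertices consists of the
  neighbours of two of these, so the colour says to which of the three perfect matchings the edge
  belongs.\<close>

definition cuboct_colour :: "bs_vertex set \<Rightarrow> nat" where
  "cuboct_colour e =
    (if e \<subseteq> {VA 1, VA 16, VB 0, VA 2, VC 2, VE 2} \<or> e \<subseteq> {VA 15, VC 15, VE 15, VD 2, VD 15, VE 0} then 0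
     else if e \<subseteq> {VA 1, VA 16, VB 0, VA 15, VC 15, VE 15} \<or> e \<subseteq> {VA 2, VC 2, VE 2, VD 2, VD 15, VE 0} then 1
     else 2)"

lemma path3_rev: "path3 u v w = path3 w v u"
  by (auto simp: path3_def)

lemma path3_sel [simp]: "verts (path3 u v w) = {u, v, w}" "edges (path3 u v w) = {{u, v}, {v, w}}"
  by (simp_all add: path3_def)

lemmas nat_eval = zero_neq_one one_neq_zero zero_neq_numeral numeral_neq_zero
  one_eq_numeral_iff numeral_eq_one_iff num.distinct num.inject refl if_True if_False

lemma colour_triangle:
  "\<forall>a\<in>cuboct0. \<forall>b\<in>cuboct_nbrs a. \<forall>c\<in>cuboct_nbrs a. c \<in> cuboct_nbrs b \<longrightarrow>
     cuboct_colour {a, b} \<noteq> cuboct_colour {a, c}"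
  by (simp only: cuboct_eval cuboct_colour_def insert_subset empty_subsetI nat_eval)

text \<open>One pair of opposite edges is enough here; the other pair is the same claim for the
  rotated cycle.\<close>

lemma colour_hole:
  "\<forall>s\<in>cuboct0. \<forall>t\<in>cuboct_nbrs s. \<forall>u\<in>cuboct_nbrs t. s \<noteq> u \<longrightarrow> u \<notin> cuboct_nbrs s \<longrightarrow>
     (\<forall>v\<in>cuboct_nbrs u. v \<in> cuboct_nbrs s \<longrightarrow> t \<noteq> v \<longrightarrow> v \<notin> cuboct_nbrs t \<longrightarrow>
        cuboct_colour {s, t} = cuboct_colour {u, v})"
  by (simp only: cuboct_eval cuboct_colour_def insert_subset empty_subsetI nat_eval)

lemma paths_edges:
  assumes "k < 3"
  shows "\<forall>(u, v, w)\<in>cuboct_paths k. u \<in> cuboct0 \<and> v \<in> cuboct_nbrs u \<and> v \<in> cuboct0 \<and> w \<in> cuboct_nbrs v \<and>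
     cuboct_colour {u, v} = k \<and> cuboct_colour {v, w} = k \<and> u \<noteq> w \<and> (\<exists>x\<in>bs_nbrs u. x \<in> bs_nbrs w)"
  using assms unfolding less_3_cases
  by (elim disjE; hypsubst)
    (simp_all only: cuboct_paths_def cuboct_eval cuboct_colour_def insert_subset empty_subsetI nat_eval prod.case
      bs_nbrs.simps)

lemma edges_paths:
  assumes "k < 3"
  shows "\<forall>u\<in>cuboct0. \<forall>v\<in>cuboct_nbrs u. cuboct_colour {u, v} = k \<longrightarrow>
     (\<exists>(a, b, c)\<in>cuboct_paths k. {u, v} = {a, b} \<or> {u, v} = {b, c})"
  using assms unfolding less_3_cases
  by (elim disjE; hypsubst)
    (simp_all only: cuboct_paths_def cuboct_eval cuboct_colour_def insert_subset empty_subsetI nat_eval prod.case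
      doubleton_eq_iff)

lemma paths_disjoint:
  assumes "k < 3"
  shows "\<forall>(a, b, c)\<in>cuboct_paths k. \<forall>(a', b', c')\<in>cuboct_paths k. (a, b, c) \<noteq> (a', b', c') \<longrightarrow>
    (\<forall>x\<in>{a, b, c}. \<forall>y\<in>{a', b', c'}. x \<noteq> y)"
  using assms unfolding less_3_cases
  by (elim disjE; hypsubst)
    (simp_all only: cuboct_paths_def cuboct_eval nat_eval prod.case prod.inject)

lemma card_paths: "k < 3 \<Longrightarrow> card (cuboct_paths k) = 4"
  unfolding less_3_cases by (elim disjE) (simp_all add: cuboct_paths_def)

text \<open>Inspects, for each middle vertex, all pairs of its neighbours. Only the ends of the
  listed path have a common Biggs-Smith neighbour.\<close>

lemma Omega_cuboct0_paths:
  "\<forall>v\<in>cuboct0. \<forall>u\<in>cuboct_nbrs v. \<forall>w\<in>cuboct_nbrs v. u \<noteq> w \<longrightarrow> (\<exists>x\<in>bs_nbrs u. x \<in> bs_nbrs w) \<longrightarrow>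
     (\<exists>(a, b, c)\<in>cuboct_paths 0 \<union> cuboct_paths 1 \<union> cuboct_paths 2. b = v \<and> (a = u \<and> c = w \<or> a = w \<and> c = u))"
  by (simp only: cuboct_paths_def cuboct_eval bs_nbrs.simps nat_eval prod.case Un_insert_left Un_empty_left)

lemma pathsD:
  assumes "(u, v, w) \<in> cuboct_paths k" "k < 3"
  shows "{u, v} \<in> edges (Y_induced cuboct0)" "{v, w} \<in> edges (Y_induced cuboct0)"
    "cuboct_colour {u, v} = k" "cuboct_colour {v, w} = k" "distinct [u, v, w]" "\<exists>x\<in>bs_nbrs u. x \<in> bs_nbrs w"
proof -
  have "u \<in> cuboct0 \<and> v \<in> cuboct_nbrs u \<and> v \<in> cuboct0 \<and> w \<in> cuboct_nbrs v \<and>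
     cuboct_colour {u, v} = k \<and> cuboct_colour {v, w} = k \<and> u \<noteq> w \<and> (\<exists>x\<in>bs_nbrs u. x \<in> bs_nbrs w)"
    using bspec[OF paths_edges[OF assms(2)] assms(1)] unfolding prod.case .
  moreover have "x \<notin> cuboct_nbrs x" for x
    using bs_sphere3_irrefl by (simp add: cuboct_nbrs_def)
  ultimately show "{u, v} \<in> edges (Y_induced cuboct0)" "{v, w} \<in> edges (Y_induced cuboct0)"
    "cuboct_colour {u, v} = k" "cuboct_colour {v, w} = k" "distinct [u, v, w]" "\<exists>x\<in>bs_nbrs u. x \<in> bs_nbrs w"
    by (auto simp: cuboct0_adj)
qed

definition path_class :: "nat \<Rightarrow> bs_vertex graph set" where
  "path_class k = (\<lambda>(u, v, w). path3 u v w) ` cuboct_paths k"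

lemma path_classE:
  assumes "p \<in> path_class k"
  obtains u v w where "(u, v, w) \<in> cuboct_paths k" "p = path3 u v w"
  using assms unfolding path_class_def by (auto split: prod.splits)

lemma paths_disjointD:
  assumes "k < 3" "(u, v, w) \<in> cuboct_paths k" "(u', v', w') \<in> cuboct_paths k"
    and "x \<in> {u, v, w}" "x \<in> {u', v', w'}"
  shows "(u, v, w) = (u', v', w')"
  using bspec[OF paths_disjoint[OF assms(1)] assms(2), unfolded prod.case, THEN bspec, OF assms(3)]
    assms(4,5) unfolding prod.case by metis

lemma path_class_disjoint:
  assumes "k < 3" "p \<in> path_class k" "q \<in> path_class k" "x \<in> verts p" "x \<in> verts q"
  shows "p = q"
proof -
  obtain u v w where p: "(u, v, w) \<in> cuboct_paths k" "p = path3 u v w" using assms(2) by (rule path_classE)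
  obtain u' v' w' where q: "(u', v', w') \<in> cuboct_paths k" "q = path3 u' v' w'" using assms(3) by (rule path_classE)
  have "(u, v, w) = (u', v', w')"
    using paths_disjointD[OF assms(1) p(1) q(1), of x] p(2) q(2) assms(4,5) by simp
  with p q show ?thesis by simp
qed

lemma card_path_class:
  assumes "k < 3"
  shows "card (path_class k) = 4"
proof -
  have "inj_on (\<lambda>(u, v, w). path3 u v w) (cuboct_paths k)"
  proof (rule inj_onI)
    fix s t assume st: "s \<in> cuboct_paths k" "t \<in> cuboct_paths k"
      and eq: "(case s of (u, v, w) \<Rightarrow> path3 u v w) = (case t of (u, v, w) \<Rightarrow> path3 u v w)"
    obtain u v w u' v' w' where [simp]: "s = (u, v, w)" "t = (u', v', w')" by (metis prod_cases3)
    have "{u, v, w} = {u', v', w'}" using eq unfolding \<open>s = _\<close> \<open>t = _\<close> prod.case by (metis path3_sel(1))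
    then have "u \<in> {u', v', w'}" by blast
    then show "s = t" using paths_disjointD[OF assms, of u v w u' v' w' u] st by simp
  qed
  then show ?thesis
    unfolding path_class_def by (simp add: card_image card_paths[OF assms])
qed

lemma Omega_cuboct0: "Omega (Y_induced cuboct0) = (\<Union>k<3. path_class k)"
proof
  have U: "(\<Union>k<3. path_class k) = (\<lambda>(u, v, w). path3 u v w) ` (cuboct_paths 0 \<union> cuboct_paths 1 \<union> cuboct_paths 2)"
  proof -
    have "{..<3::nat} = {0, 1, 2}" by (auto simp: less_3_cases)
    then show ?thesis by (simp add: path_class_def image_Un Un_assoc)
  qed
  show "Omega (Y_induced cuboct0) \<subseteq> (\<Union>k<3. path_class k)"
  proof
    fix p assume "p \<in> Omega (Y_induced cuboct0)"
    then obtain u v w where p: "p = path3 u v w" "{v, u} \<in> edges (Y_induced cuboct0)"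
      "{v, w} \<in> edges (Y_induced cuboct0)" "u \<noteq> w" "\<exists>x\<in>bs_nbrs u. x \<in> bs_nbrs w"
      unfolding Omega_def by (auto simp: insert_commute)
    then have v: "v \<in> cuboct0" "u \<in> cuboct_nbrs v" "w \<in> cuboct_nbrs v"
      by (simp_all add: cuboct0_adj)
    have "\<exists>(a, b, c)\<in>cuboct_paths 0 \<union> cuboct_paths 1 \<union> cuboct_paths 2. b = v \<and> (a = u \<and> c = w \<or> a = w \<and> c = u)"
      using Omega_cuboct0_paths[rule_format, OF v p(4,5)] .
    then obtain a c where "(a, v, c) \<in> cuboct_paths 0 \<union> cuboct_paths 1 \<union> cuboct_paths 2"
      "a = u \<and> c = w \<or> a = w \<and> c = u" by blast
    then have "(a, v, c) \<in> cuboct_paths 0 \<union> cuboct_paths 1 \<union> cuboct_paths 2" "p = path3 a v c"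
      using p(1) path3_rev by auto
    then show "p \<in> (\<Union>k<3. path_class k)"
      unfolding U by (intro image_eqI[of _ _ "(a, v, c)"]) simp_all
  qed
  show "(\<Union>k<3. path_class k) \<subseteq> Omega (Y_induced cuboct0)"
  proof
    fix p assume "p \<in> (\<Union>k<3. path_class k)"
    then obtain k where k: "k < 3" "p \<in> path_class k" by blast
    from k(2) obtain u v w where uvw: "(u, v, w) \<in> cuboct_paths k" "p = path3 u v w" by (rule path_classE)
    note d = pathsD[OF uvw(1) k(1)]
    have "u \<noteq> w" using d(5) by simp
    with d uvw(2) show "p \<in> Omega (Y_induced cuboct0)"
      unfolding Omega_def by blast
  qed
qed

lemma colour_less_3: "cuboct_colour e < 3"
  by (simp add: cuboct_colour_def)

lemma path_class_edges: "k < 3 \<Longrightarrow> (\<Union>p\<in>path_class k. edges p) = {e \<in> edges (Y_induced cuboct0). cuboct_colour e = k}"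
proof
  assume k: "k < 3"
  show "(\<Union>p\<in>path_class k. edges p) \<subseteq> {e \<in> edges (Y_induced cuboct0). cuboct_colour e = k}"
  proof
    fix e assume "e \<in> (\<Union>p\<in>path_class k. edges p)"
    then obtain p where "p \<in> path_class k" "e \<in> edges p" by blast
    then obtain u v w where "(u, v, w) \<in> cuboct_paths k" "e \<in> edges (path3 u v w)" by (metis path_classE)
    then show "e \<in> {e \<in> edges (Y_induced cuboct0). cuboct_colour e = k}"
      using pathsD[OF _ k] by auto
  qed
  show "{e \<in> edges (Y_induced cuboct0). cuboct_colour e = k} \<subseteq> (\<Union>p\<in>path_class k. edges p)"
  proof
    fix e assume "e \<in> {e \<in> edges (Y_induced cuboct0). cuboct_colour e = k}"
    then have e: "e \<in> edges (Y_induced cuboct0)" "cuboct_colour e = k" by simp_all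
    obtain u v where uv: "e = {u, v}" by (rule simple_graphE[OF simple_Y_induced e(1)])
    then have "u \<in> cuboct0" "v \<in> cuboct_nbrs u" using e by (simp_all add: cuboct0_adj)
    then have "\<exists>(a, b, c)\<in>cuboct_paths k. {u, v} = {a, b} \<or> {u, v} = {b, c}"
      using edges_paths[OF k] e(2) uv by blast
    then obtain a b c where "(a, b, c) \<in> cuboct_paths k" "e \<in> edges (path3 a b c)"
      using uv by auto
    then show "e \<in> (\<Union>p\<in>path_class k. edges p)" by (force simp: path_class_def)
  qed
qed

text \<open>For uniqueness: two paths with a common edge belong to the same colour, and paths of one
  colour have no vertex in common.\<close>

lemma two_path_partition_cuboct0: "two_path_partition (Y_induced cuboct0) (Omega (Y_induced cuboct0))"
  unfolding two_path_partition_def Omega_cuboct0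
proof (intro conjI ballI)
  fix p assume "p \<in> (\<Union>k<3. path_class k)"
  then obtain k where k: "k < 3" "p \<in> path_class k" by blast
  from k(2) obtain u v w where uvw: "(u, v, w) \<in> cuboct_paths k" "p = path3 u v w" by (rule path_classE)
  note d = pathsD[OF uvw(1) k(1)]
  show "two_path p" using d(5) uvw(2) unfolding two_path_iff by blast
  show "subgraph p (Y_induced cuboct0)"
    using d(1,2) by (simp add: subgraph_def uvw(2) edges_Y_induced)
next
  fix e assume e: "e \<in> edges (Y_induced cuboct0)"
  let ?k = "cuboct_colour e"
  have "e \<in> (\<Union>p\<in>path_class ?k. edges p)"
    using e path_class_edges[OF colour_less_3] by blast
  then obtain p where p: "p \<in> path_class ?k" "e \<in> edges p" by blast
  show "\<exists>!p. p \<in> (\<Union>k<3. path_class k) \<and> e \<in> edges p"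
  proof (rule ex1I[of _ p])
    show "p \<in> (\<Union>k<3. path_class k) \<and> e \<in> edges p" using p colour_less_3 by blast
    fix q assume "q \<in> (\<Union>k<3. path_class k) \<and> e \<in> edges q"
    then obtain k where q: "k < 3" "q \<in> path_class k" "e \<in> edges q" by blast
    then have "e \<in> {e \<in> edges (Y_induced cuboct0). cuboct_colour e = k}"
      unfolding path_class_edges[OF q(1), symmetric] by blast
    then have "k = ?k" by simp
    moreover have sub: "e \<subseteq> verts r" if "r \<in> path_class j" "e \<in> edges r" for r j
      using that by (auto elim!: path_classE)
    obtain x where "x \<in> e" using e by (metis insertI1 simple_graphE simple_Y_induced)
    ultimately show "q = p"
      using path_class_disjoint[OF q(1,2)] p q sub by blast
  qed
qed

lemma admissible_cuboct0: "admissible (Y_induced cuboct0) (Omega (Y_induced cuboct0))"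
  unfolding admissible_def
proof (intro conjI exI[of _ cuboct_colour] exI[of _ path_class] ballI allI impI two_path_partition_cuboct0 Omega_cuboct0)
  show "cuboct_colour ` edges (Y_induced cuboct0) \<subseteq> {..<3}"
    using colour_less_3 by auto
  fix T assume "T \<in> triangles (Y_induced cuboct0)"
  then obtain X where X: "clique (Y_induced cuboct0) X" "card X = 3" "T = clique_graph X"
    using copies_complete_graph[OF simple_Y_induced] by blast
  then obtain a b c where abc: "X = {a, b, c}" "a \<noteq> b" "b \<noteq> c" "a \<noteq> c"
    by (auto simp: card_3_iff)
  have adj: "u \<in> cuboct0 \<and> v \<in> cuboct_nbrs u" if "u \<in> X" "v \<in> X" "u \<noteq> v" for u v
    using X(1) that unfolding clique_def cuboct0_adj by blast
  have ne: "cuboct_colour {u, v} \<noteq> cuboct_colour {u, w}"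
    if "u \<in> X" "v \<in> X" "w \<in> X" "distinct [u, v, w]" for u v w
    using colour_triangle[rule_format, of u v w] adj that by simp
  have "edges T = {{a, b}, {a, c}, {b, c}}"
    using abc by (auto simp: X(3) clique_graph_def)
  moreover have "cuboct_colour {a, b} \<noteq> cuboct_colour {a, c}" "cuboct_colour {a, b} \<noteq> cuboct_colour {b, c}"
    "cuboct_colour {a, c} \<noteq> cuboct_colour {b, c}"
    using ne[of a b c] ne[of b a c] ne[of c a b] abc by (simp_all add: insert_commute)
  ultimately show "inj_on cuboct_colour (edges T)" by auto
next
  have *: "cuboct_colour {s, t} = cuboct_colour {u, v}" if "chordless_cycle (Y_induced cuboct0) [s, t, u, v]" for s t u v
  proof -
    have "{s, t} \<in> edges (Y_induced cuboct0)" "{t, u} \<in> edges (Y_induced cuboct0)"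
      "{u, v} \<in> edges (Y_induced cuboct0)" "{s, v} \<in> edges (Y_induced cuboct0)"
      "{s, u} \<notin> edges (Y_induced cuboct0)" "{t, v} \<notin> edges (Y_induced cuboct0)" "s \<noteq> u" "t \<noteq> v"
      using that unfolding chordless_4_cycle_iff[OF simple_Y_induced] by (simp_all add: insert_commute)
    then show ?thesis
      using colour_hole[rule_format, of s t u v] unfolding cuboct0_adj by blast
  qed
  fix s t u v assume c: "chordless_cycle (Y_induced cuboct0) [s, t, u, v]"
  then show "cuboct_colour {s, t} = cuboct_colour {u, v}" by (rule *)
  have "chordless_cycle (Y_induced cuboct0) [t, u, v, s]"
    using c unfolding chordless_4_cycle_iff[OF simple_Y_induced] by (auto simp: insert_commute)
  then show "cuboct_colour {t, u} = cuboct_colour {v, s}" by (rule *)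
next
  fix k :: nat assume k: "k < 3"
  show "card (path_class k) = 4" by (rule card_path_class[OF k])
  show "two_path p" if "p \<in> path_class k" for p
    using two_path_partition_cuboct0 that k unfolding two_path_partition_def Omega_cuboct0 by blast
  show "disjoint_family_on verts (path_class k)"
    using path_class_disjoint[OF k] unfolding disjoint_family_on_def by blast
  show "(\<Union>p\<in>path_class k. edges p) = {e \<in> edges (Y_induced cuboct0). cuboct_colour e = k}"
    by (rule path_class_edges[OF k])
qed

lemma Omega_base_mem: "path3 (VA 16) (VA 2) (VB 0) \<in> Omega (Y_induced cuboct0)"
proof -
  have "(VA 16, VA 2, VB 0) \<in> cuboct_paths 0" by (simp add: cuboct_paths_def)
  then show ?thesis
    unfolding Omega_cuboct0 path_class_def by force
qed

lemma Omega_base: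
  assumes "p \<in> Omega (Y_induced cuboct0)" "{VB 0, VA 2} \<in> edges p"
  shows "p = path3 (VA 16) (VA 2) (VB 0)"
proof -
  have 1: "{VB 0, VA 2} \<in> edges (Y_induced cuboct0)"
    by (simp add: Y_induced_adj cuboct0_def)
  have 2: "{VB 0, VA 2} \<in> edges (path3 (VA 16) (VA 2) (VB 0))"
    by (simp add: insert_commute)
  from two_path_partition_cuboct0 1
  have "\<exists>!p. p \<in> Omega (Y_induced cuboct0) \<and> {VB 0, VA 2} \<in> edges p"
    unfolding two_path_partition_def by blast
  with Omega_base_mem 2 assms show ?thesis by blast
qed

subsection \<open>Intersections\<close>

lemma graph_inter_Y_induced: "graph_inter (Y_induced X) (Y_induced X') = Y_induced (X \<inter> X')"
  by (auto simp: graph_inter_def Y_induced_def)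

lemma Y_induced_clique: "clique Y_graph X \<Longrightarrow> Y_induced X = clique_graph X"
proof -
  assume X: "clique Y_graph X"
  have "{e \<in> edges Y_graph. e \<subseteq> X} \<subseteq> {{u, v} | u v. u \<in> X \<and> v \<in> X \<and> u \<noteq> v}"
  proof
    fix e assume e: "e \<in> {e \<in> edges Y_graph. e \<subseteq> X}"
    then have "e \<in> edges Y_graph" by simp
    then obtain u v where "u \<noteq> v" "e = {u, v}" by (rule simple_graphE[OF simple_Y])
    with e show "e \<in> {{u, v} | u v. u \<in> X \<and> v \<in> X \<and> u \<noteq> v}" by auto
  qed
  then have "{e \<in> edges Y_graph. e \<subseteq> X} = {{u, v} | u v. u \<in> X \<and> v \<in> X \<and> u \<noteq> v}"
    using X by (auto simp: clique_def)
  then show ?thesis by (simp add: Y_induced_def clique_graph_def)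
qed

lemma cuboct_inter:
  "cuboct1 \<inter> cuboct0 = {VA 1, VA 16, VB 0, VA 2}"
  "cuboct2 \<inter> cuboct0 = {VA 2, VB 0}"
  "cuboct3 \<inter> cuboct0 = {VA 2, VB 0, VD 2}"
  by (simp_all only: cuboct_defs eval_17 set_eval)

lemma edge_graph_clique: "u \<noteq> v \<Longrightarrow> clique_graph {u, v} = edge_graph {u, v}"
  by (auto simp: clique_graph_def edge_graph_def)

lemma inter_2: "graph_inter (Y_induced cuboct2) (Y_induced cuboct0) = edge_graph {VB 0, VA 2}"
proof -
  have "clique Y_graph {VB 0, VA 2}" by (simp add: clique_Y_iff)
  then show ?thesis
    using edge_graph_clique[of "VB 0" "VA 2"]
    by (simp add: graph_inter_Y_induced cuboct_inter Y_induced_clique insert_commute)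
qed

lemma clique_base: "clique Y_graph {VB 0, VA 2, VD 2}"
  by (simp add: clique_Y_iff)

lemma inter_3: "graph_inter (Y_induced cuboct3) (Y_induced cuboct0) = clique_graph {VB 0, VA 2, VD 2}"
proof -
  have "{VA 2, VB 0, VD 2} = {VB 0, VA 2, VD 2}" by blast
  then show ?thesis
    using clique_base by (simp add: graph_inter_Y_induced cuboct_inter Y_induced_clique)
qed

text \<open>Only edges are bounded: the intersection is more than a 2-path, as it also contains
  \<open>VA 1\<close> as an isolated vertex.\<close>

lemma inter_1: "edges (graph_inter (Y_induced cuboct1) (Y_induced cuboct0)) \<subseteq> {{VA 2, VA 16}, {VA 2, VB 0}}"
proof
  fix e assume e: "e \<in> edges (graph_inter (Y_induced cuboct1) (Y_induced cuboct0))"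
  then have "e \<in> edges Y_graph" "e \<subseteq> {VA 1, VA 16, VB 0, VA 2}"
    unfolding graph_inter_Y_induced cuboct_inter edges_Y_induced by simp_all
  moreover from this(1) obtain u v where "e = {u, v}" "v \<in> bs_sphere3 u" by (rule Y_edgeE)
  ultimately have uv: "e = {u, v}" "v \<in> bs_sphere3 u" "u \<in> {VA 1, VA 16, VB 0, VA 2}" "v \<in> {VA 1, VA 16, VB 0, VA 2}"
    by simp_all
  have "\<forall>u\<in>{VA 1, VA 16, VB 0, VA 2}. \<forall>v\<in>{VA 1, VA 16, VB 0, VA 2}. v \<in> bs_sphere3 u \<longrightarrow>
    {u, v} = {VA 2, VA 16} \<or> {u, v} = {VA 2, VB 0}"
    by (simp only: bs_sphere3.simps eval_17 set_eval doubleton_eq_iff)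
  with uv show "e \<in> {{VA 2, VA 16}, {VA 2, VB 0}}" by blast
qed

subsection \<open>Rigidity of a member with its 2-paths\<close>

text \<open>Besides the identity, a cuboctahedron has just one symmetry preserving a given edge as a
  set, and it exchanges the ends. Here it is excluded because the 2-path through the base edge must
  be preserved and its third vertex \<open>VA 16\<close> is adjacent to \<open>VA 2\<close> but not
  to \<open>VB 0\<close>. The other vertices are then fixed one after another.\<close>

lemma cuboct_rigid:
  assumes iso: "graph_iso h (Y_induced cuboct0) (Y_induced cuboct0)"
    and pres: "path_preserving Omega h (Y_induced cuboct0) (Y_induced cuboct0)"
    and e: "h ` {VB 0, VA 2} = {VB 0, VA 2}" and v: "v \<in> cuboct0"
  shows "h v = v"
proof -
  have inj: "inj_on h cuboct0" and into: "\<And>u. u \<in> cuboct0 \<Longrightarrow> h u \<in> cuboct0"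
    using iso by (auto simp: graph_iso_def bij_betw_def)
  have adj: "h v \<in> cuboct_nbrs (h u) \<longleftrightarrow> v \<in> cuboct_nbrs u" if "u \<in> cuboct0" "v \<in> cuboct0" for u v
    using iso that into unfolding graph_iso_def by (simp add: cuboct0_adj)
  have mem: "VA 1 \<in> cuboct0" "VA 16 \<in> cuboct0" "VB 0 \<in> cuboct0" "VA 2 \<in> cuboct0" "VC 2 \<in> cuboct0" "VE 2 \<in> cuboct0"
    "VA 15 \<in> cuboct0" "VC 15 \<in> cuboct0" "VE 15 \<in> cuboct0" "VD 2 \<in> cuboct0" "VD 15 \<in> cuboct0" "VE 0 \<in> cuboct0"
    by (simp_all only: cuboct_eval)
  have "path3 (h (VA 16)) (h (VA 2)) (h (VB 0)) \<in> Omega (Y_induced cuboct0)"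
    using pres Omega_base_mem unfolding path_preserving_def map_graph_path3[symmetric] by blast
  moreover have "{VB 0, VA 2} \<in> edges (path3 (h (VA 16)) (h (VA 2)) (h (VB 0)))"
    using e by (auto simp: insert_commute)
  ultimately have "path3 (h (VA 16)) (h (VA 2)) (h (VB 0)) = path3 (VA 16) (VA 2) (VB 0)"
    by (rule Omega_base)
  from arg_cong[OF this, of verts] have "{h (VA 16), h (VA 2), h (VB 0)} = {VA 16, VA 2, VB 0}"
    by (simp only: path3_sel)
  moreover have "h (VA 16) \<noteq> h (VA 2)" "h (VA 16) \<noteq> h (VB 0)"
    using inj_on_eq_iff[OF inj] mem by simp_all
  moreover have e': "{h (VB 0), h (VA 2)} = {VB 0, VA 2}" using e by simp
  ultimately have A16: "h (VA 16) = VA 16" by blast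
  have "h (VA 2) \<in> cuboct_nbrs (VA 16)"
    using adj[of "VA 16" "VA 2"] mem A16 by (simp add: cuboct_nbrs_eval)
  then have "h (VA 2) \<noteq> VB 0" by (auto simp: cuboct_nbrs_eval)
  then have A2: "h (VA 2) = VA 2" and B0: "h (VB 0) = VB 0"
    using e' unfolding doubleton_eq_iff by blast+
  \<comment> \<open>The set \<open>F\<close> collects vertices already known to be fixed, and
    \<open>v\<close> is the only common neighbour of \<open>u\<close> and \<open>w\<close> outside
    \<open>F\<close>. With \<open>u = w\<close> it is the last of the four neighbours of
    \<open>u\<close>.\<close>
  have step: "h v = v"
    if "h u = u" "h w = w" "\<forall>x\<in>F. h x = x" "u \<in> cuboct0" "w \<in> cuboct0" "v \<in> cuboct0"
      "v \<in> cuboct_nbrs u \<and> v \<in> cuboct_nbrs w \<and> v \<notin> F \<and> (\<forall>x\<in>F. x \<in> cuboct0) \<and>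
       (\<forall>x\<in>cuboct_nbrs u. x \<in> cuboct_nbrs w \<longrightarrow> x = v \<or> x \<in> F)" for u w v F
  proof -
    have "h v \<in> cuboct_nbrs u" "h v \<in> cuboct_nbrs w" using adj that by metis+
    then have "h v = v \<or> h v \<in> F" using that by blast
    moreover have "h v \<notin> F"
      using that inj_on_eq_iff[OF inj] by metis
    ultimately show ?thesis by blast
  qed
  have D2: "h (VD 2) = VD 2"
    by (rule step[of "VA 2" "VB 0" "{}", OF A2 B0]) (simp_all only: cuboct_eval)
  have C15: "h (VC 15) = VC 15"
    by (rule step[of "VA 16" "VA 2" "{}", OF A16 A2]) (simp_all only: cuboct_eval)
  have D15: "h (VD 15) = VD 15"
    by (rule step[of "VB 0" "VC 15" "{VA 2}", OF B0 C15]) (simp_all only: cuboct_eval A2)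
  have A15: "h (VA 15) = VA 15"
    by (rule step[of "VB 0" "VB 0" "{VA 2, VD 2, VD 15}", OF B0 B0]) (simp_all only: cuboct_eval A2 D2 D15)
  have E15: "h (VE 15) = VE 15"
    by (rule step[of "VD 2" "VA 16" "{VA 2}", OF D2 A16]) (simp_all only: cuboct_eval A2)
  have C2: "h (VC 2) = VC 2"
    by (rule step[of "VD 2" "VD 2" "{VB 0, VA 2, VE 15}", OF D2 D2]) (simp_all only: cuboct_eval B0 A2 E15)
  have E0: "h (VE 0) = VE 0"
    by (rule step[of "VA 16" "VA 16" "{VA 2, VC 15, VE 15}", OF A16 A16]) (simp_all only: cuboct_eval A2 C15 E15)
  have E2: "h (VE 2) = VE 2"
    by (rule step[of "VC 15" "VC 15" "{VA 16, VA 2, VD 15}", OF C15 C15]) (simp_all only: cuboct_eval A16 A2 D15)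
  have A1: "h (VA 1) = VA 1"
    by (rule step[of "VE 0" "VE 0" "{VA 16, VE 2, VE 15}", OF E0 E0]) (simp_all only: cuboct_eval A16 E2 E15)
  from v show ?thesis
    unfolding cuboct0_def using A1 A16 B0 A2 C2 E2 A15 C15 E15 D2 D15 E0 by (elim insertE emptyE) simp_all
qed

section \<open>Copies of \<open>K\<^sub>4\<close> and transitivity on the members\<close>

abbreviation K4_base :: "bs_vertex set" where
  "K4_base \<equiv> {VB 0, VA 2, VB 4, VD 2}"

abbreviation edge_base :: "bs_vertex set" where
  "edge_base \<equiv> {VB 0, VA 2}"

abbreviation triangle_base :: "bs_vertex set" where
  "triangle_base \<equiv> {VB 0, VA 2, VD 2}"

lemma K4_set_K4_base: "K4_set K4_base"
  by (simp add: K4_set_def clique_Y_iff)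

lemma K4_set_eqI:
  assumes K: "K4_set K" and ab: "a \<in> K" "b \<in> K" and g: "g \<in> bs_group" "g (VB 0) = a" "g (VA 2) = b"
  shows "K = g ` K4_base"
proof -
  note ga = bs_group_aut[OF g(1)]
  have "surj g" using ga by (simp add: bs_aut_def bij_is_surj)
  then obtain K' where K': "K = g ` K'" by (metis subset_UNIV subset_imageE)
  then have "K4_set K'" using K K4_set_image[OF ga] by simp
  moreover have "VB 0 \<in> K'" "VA 2 \<in> K'"
    using ab K' g inj_image_mem_iff[OF bs_aut_inj[OF ga]] by metis+
  ultimately have "K' = {VB 0, VA 2, VB 4, VD 2}"
    by (intro K4_set_through bs_sphere3_base_common) simp_all
  then show ?thesis using K' by simp
qed

lemma K4_set_arc:
  assumes "K4_set K" "a \<in> K" "b \<in> K" "a \<noteq> b"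
  obtains g where "g \<in> bs_group" "g (VB 0) = a" "g (VA 2) = b" "K = g ` K4_base"
proof -
  have "b \<in> bs_sphere3 a" using assms by (simp add: K4_set_def clique_Y_iff)
  then obtain g where g: "g \<in> bs_group" "g (VB 0) = a" "g (VA 2) = b"
    using bs_group_arc_transitive by blast
  with K4_set_eqI[OF assms(1-3) g] show thesis using that by blast
qed

text \<open>Both sets are the image of \<open>K4_base\<close> under the same group element, one that
  moves the base arc to \<open>a\<close> and \<open>b\<close>.\<close>

lemma K4_set_unique:
  assumes "K4_set K" "K4_set K'" "a \<in> K" "b \<in> K" "a \<in> K'" "b \<in> K'" "a \<noteq> b"
  shows "K = K'"
proof -
  obtain g where g: "g \<in> bs_group" "g (VB 0) = a" "g (VA 2) = b" "K = g ` K4_base"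
    by (rule K4_set_arc[OF assms(1,3,4,7)])
  from K4_set_eqI[OF assms(2,5,6) g(1-3)] g(4) show ?thesis by simp
qed

lemma K4_set_ex:
  assumes "b \<in> bs_sphere3 a"
  shows "\<exists>K. K4_set K \<and> a \<in> K \<and> b \<in> K"
proof -
  obtain g where g: "g \<in> bs_group" "g (VB 0) = a" "g (VA 2) = b"
    using bs_group_arc_transitive[OF assms] by blast
  have "K4_set (g ` K4_base)"
    using K4_set_image[OF bs_group_aut[OF g(1)]] K4_set_K4_base by blast
  moreover have "a \<in> g ` K4_base" "b \<in> g ` K4_base" using g by auto
  ultimately show ?thesis by blast
qed

lemma K4_set_obtain2:
  assumes "K4_set K"
  obtains a b where "a \<in> K" "b \<in> K" "a \<noteq> b"
proof -
  have "\<not> card K \<le> Suc 0" using assms by (simp add: K4_set_def)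
  then show thesis using that card_le_Suc0_iff_eq[of K] assms by (metis card.infinite le0)
qed

lemma cubocts_transitive:
  assumes "y \<in> cubocts"
  obtains g where "g \<in> bs_group" "y = map_graph g (Y_induced cuboct0)"
proof -
  have *: "\<exists>g\<in>bs_group. K = g ` K4_base" if K: "K4_set K" for K
  proof -
    obtain a b where "a \<in> K" "b \<in> K" "a \<noteq> b" by (rule K4_set_obtain2[OF K])
    then show ?thesis using K4_set_arc[OF K] by metis
  qed
  obtain K where K: "K4_set K" "y = Y_induced (bs_nbhd K)" using assms by (auto simp: cubocts_def)
  obtain g where g: "g \<in> bs_group" "K = g ` K4_base" using *[OF K(1)] by blast
  \<comment> \<open>The member on \<open>cuboct0\<close> belongs to this copy and not to
    \<open>K4_base\<close>, so the wanted element is composed from two moves through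
    \<open>K4_base\<close>.\<close>
  obtain k where k: "k \<in> bs_group" "{VA 0, VB 2, VB 15, VD 0} = k ` K4_base"
    using *[OF K4_set_eval(1)] by blast
  define h where "h = inv_into UNIV k"
  have h: "h \<in> bs_group" using k(1) by (simp add: h_def bs_group_inv)
  have "h ` {VA 0, VB 2, VB 15, VD 0} = K4_base"
    unfolding k(2) image_image h_def using bs_group_inv_apply(1)[OF k(1)] by simp
  then have "K = (g \<circ> h) ` {VA 0, VB 2, VB 15, VD 0}" by (simp only: image_comp[symmetric] g(2))
  moreover have gh: "g \<circ> h \<in> bs_group" using g h by (intro bs_group_comp)
  ultimately have "y = map_graph (g \<circ> h) (Y_induced cuboct0)"
    by (simp only: K(2) bs_nbhd_image[OF bs_group_aut[OF gh]] map_graph_Y_induced[OF bs_group_aut[OF gh]] bs_nbhd_eval)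
  with gh that show thesis by blast
qed

lemma cubocts_simple: "y \<in> cubocts \<Longrightarrow> simple_graph y"
  using simple_Y_induced by (auto simp: cubocts_def)

lemma cubocts_subgraph: "y \<in> cubocts \<Longrightarrow> subgraph y Y_graph"
  by (auto simp: cubocts_def subgraph_def edges_Y_induced)

lemma cubocts_induced: "cubocts \<subseteq> induced_copies Y_graph (line_graph (hypercube 3))"
proof
  fix y assume y: "y \<in> cubocts"
  then have ind: "induced_subgraph y Y_graph"
    by (auto simp: cubocts_def induced_subgraph_def edges_Y_induced)
  from y obtain g where g: "g \<in> bs_group" and yg: "y = map_graph g (Y_induced cuboct0)" by (rule cubocts_transitive)
  note inj = bs_aut_inj[OF bs_group_aut[OF g]]
  let ?h = "inv_into UNIV g"
  obtain f where f: "graph_iso f (Y_induced cuboct0) (line_graph (hypercube 3))"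
    using cuboct0_isomorphic by (auto simp: graph_isomorphic_def)
  have "graph_iso (f \<circ> ?h) y (line_graph (hypercube 3))"
    unfolding graph_iso_def
  proof (intro conjI ballI)
    have "bij_betw ?h (verts y) cuboct0"
      using inj by (intro bij_betw_byWitness[of _ g]) (auto simp: yg)
    moreover have "bij_betw f cuboct0 (verts (line_graph (hypercube 3)))"
      using f by (simp add: graph_iso_def)
    ultimately show "bij_betw (f \<circ> ?h) (verts y) (verts (line_graph (hypercube 3)))"
      by (rule bij_betw_trans)
    fix u v assume "u \<in> verts y" "v \<in> verts y"
    then obtain u' v' where uv: "u = g u'" "v = g v'" "u' \<in> cuboct0" "v' \<in> cuboct0" by (auto simp: yg)
    then have "{f u', f v'} \<in> edges (line_graph (hypercube 3)) \<longleftrightarrow> {u', v'} \<in> edges (Y_induced cuboct0)"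
      using f by (simp add: graph_iso_def)
    also have "\<dots> \<longleftrightarrow> {u, v} \<in> edges y"
      unfolding yg uv using doubleton_mem_map_graph[OF inj] by blast
    finally show "{u, v} \<in> edges y \<longleftrightarrow> {(f \<circ> ?h) u, (f \<circ> ?h) v} \<in> edges (line_graph (hypercube 3))"
      using inj by (simp add: uv)
  qed
  with ind show "y \<in> induced_copies Y_graph (line_graph (hypercube 3))"
    by (auto simp: induced_copies_def graph_isomorphic_def)
qed

lemma cubocts_admissible:
  assumes "y \<in> cubocts"
  shows "admissible y (Omega y)"
proof -
  from assms obtain g where g: "g \<in> bs_group" and y: "y = map_graph g (Y_induced cuboct0)" by (rule cubocts_transitive)
  note ga = bs_group_aut[OF g]
  show ?thesis
    unfolding y Omega_map_graph[OF ga]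
    by (rule admissible_map_graph[OF bs_aut_inj[OF ga] simple_Y_induced admissible_cuboct0])
qed

lemma Y_connected: "graph_connected Y_graph"
proof -
  define R where "R = {(x, y). {x, y} \<in> edges Y_graph}"
  have R: "(u, v) \<in> R" if "v \<in> bs_sphere3 u" for u v
    using that by (simp add: R_def Y_adj_iff)
  have "sym R" by (auto simp: R_def sym_def insert_commute)
  then have sym: "sym (R\<^sup>*)" by (rule sym_rtrancl)
  have step: "(VA 0, v) \<in> R\<^sup>*" if "(VA 0, u) \<in> R\<^sup>*" "v \<in> bs_sphere3 u" for u v
    using that R by (meson rtrancl.rtrancl_into_rtrancl)
  \<comment> \<open>As 3 generates the integers modulo 17, repeating this step from
    \<open>VA 0\<close> reaches every \<open>VA i\<close>; each other vertex has a neighbour among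
    these.\<close>
  have s3: "(VA 0, VA (i + 3)) \<in> R\<^sup>*" if "(VA 0, VA i) \<in> R\<^sup>*" for i
    by (rule step[OF that]) simp
  have "(VA 0, VA 0) \<in> R\<^sup>*" by simp
  note a0 = this
  note a3 = s3[OF a0, unfolded eval_17] note a6 = s3[OF a3, unfolded eval_17]
  note a9 = s3[OF a6, unfolded eval_17] note a12 = s3[OF a9, unfolded eval_17]
  note a15 = s3[OF a12, unfolded eval_17] note a1 = s3[OF a15, unfolded eval_17]
  note a4 = s3[OF a1, unfolded eval_17] note a7 = s3[OF a4, unfolded eval_17]
  note a10 = s3[OF a7, unfolded eval_17] note a13 = s3[OF a10, unfolded eval_17]
  note a16 = s3[OF a13, unfolded eval_17] note a2 = s3[OF a16, unfolded eval_17]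
  note a5 = s3[OF a2, unfolded eval_17] note a8 = s3[OF a5, unfolded eval_17]
  note a11 = s3[OF a8, unfolded eval_17] note a14 = s3[OF a11, unfolded eval_17]
  have "\<forall>i. (VA 0, VA i) \<in> R\<^sup>*"
    unfolding all_17 by (intro conjI a0 a1 a2 a3 a4 a5 a6 a7 a8 a9 a10 a11 a12 a13 a14 a15 a16)
  then have A: "(VA 0, VA i) \<in> R\<^sup>*" for i by blast
  have "(VA 0, v) \<in> R\<^sup>*" for v
  proof (cases v)
    case (VB i)
    show ?thesis by (rule step[OF A[of "i + 2"]]) (simp add: VB add.assoc numeral_17)
  next
    case (VC i)
    show ?thesis by (rule step[OF A[of "i + 1"]]) (simp add: VC add.assoc numeral_17)
  next
    case (VD i)
    show ?thesis by (rule step[OF A[of i]]) (simp add: VD)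
  next
    case (VE i)
    show ?thesis by (rule step[OF A[of "i + 1"]]) (simp add: VE add.assoc numeral_17)
  next
    case (VF i)
    show ?thesis by (rule step[OF A[of i]]) (simp add: VF)
  qed (simp add: A)
  then have "(u, v) \<in> R\<^sup>*" for u v
    by (meson sym symD rtrancl_trans)
  then show ?thesis unfolding graph_connected_def R_def[symmetric] by simp
qed

subsection \<open>Members containing an edge, a triangle or a 2-path\<close>

lemma members_flag:
  assumes g: "bs_aut g"
  shows "{y \<in> cubocts. g ` edge_base \<in> edges y} =
    map_graph g ` {Y_induced cuboct0, Y_induced cuboct1, Y_induced cuboct2, Y_induced cuboct3}"
proof -
  have "{y \<in> cubocts. g ` edge_base \<in> edges y} = map_graph g ` {y \<in> cubocts. g ` edge_base \<in> edges (map_graph g y)}"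
    by (rule cubocts_Collect_image[OF g])
  then show ?thesis
    unfolding map_graph_sel inj_image_mem[OF bs_aut_inj[OF g]] cubocts_base .
qed

lemma members_distinct:
  "distinct [Y_induced cuboct0, Y_induced cuboct1, Y_induced cuboct2, Y_induced cuboct3]"
  using cubocts_distinct by (simp add: Y_induced_eq_iff)

lemma card_members_edge:
  assumes "e \<in> edges Y_graph"
  shows "card {y \<in> cubocts. e \<in> edges y} = 4"
proof -
  obtain u v where uv: "e = {u, v}" "v \<in> bs_sphere3 u" by (rule Y_edgeE[OF assms])
  then obtain g where g: "g \<in> bs_group" "g (VB 0) = u" "g (VA 2) = v"
    using bs_group_arc_transitive by blast
  note ga = bs_group_aut[OF g(1)]
  have "e = g ` edge_base" using uv g by simp
  then have "card {y \<in> cubocts. e \<in> edges y} =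
      card {Y_induced cuboct0, Y_induced cuboct1, Y_induced cuboct2, Y_induced cuboct3}"
    using members_flag[OF ga] inj_map_graph[OF bs_aut_inj[OF ga]]
    by (simp only: card_image inj_on_subset subset_UNIV)
  then show ?thesis using members_distinct by simp
qed

lemma subgraph_clique_graph:
  assumes "clique Y_graph X"
  shows "subgraph (clique_graph X) (Y_induced Z) \<longleftrightarrow> X \<subseteq> Z"
  using assms by (auto simp: subgraph_def clique_graph_def edges_Y_induced clique_def)

text \<open>Of the four members through the base edge, \<open>cuboct1\<close> and
  \<open>cuboct2\<close> miss the third vertex \<open>VD 2\<close>.\<close>

lemma members_triangle_base:
  "{y \<in> cubocts. subgraph (clique_graph triangle_base) y} = {Y_induced cuboct0, Y_induced cuboct3}"
proof
  show "{y \<in> cubocts. subgraph (clique_graph triangle_base) y} \<subseteq> {Y_induced cuboct0, Y_induced cuboct3}"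
  proof
    fix y assume "y \<in> {y \<in> cubocts. subgraph (clique_graph triangle_base) y}"
    then have y: "y \<in> cubocts" "subgraph (clique_graph triangle_base) y" by simp_all
    have "edge_base \<in> edges (clique_graph triangle_base)" by (auto simp: clique_graph_def)
    then have "edge_base \<in> edges y" using y by (auto simp: subgraph_def)
    then have mem: "y \<in> {Y_induced cuboct0, Y_induced cuboct1, Y_induced cuboct2, Y_induced cuboct3}"
      using y cubocts_base by blast
    have "VD 2 \<in> verts y" using y by (auto simp: subgraph_def)
    moreover have "VD 2 \<notin> cuboct1" "VD 2 \<notin> cuboct2" by (simp_all add: cuboct_defs)
    ultimately show "y \<in> {Y_induced cuboct0, Y_induced cuboct3}" using mem by auto
  qed
  have "triangle_base \<subseteq> cuboct0" "triangle_base \<subseteq> cuboct3" by (simp_all add: cuboct_defs)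
  moreover have "Y_induced cuboct0 \<in> cubocts" "Y_induced cuboct3 \<in> cubocts" using cubocts_base by blast+
  ultimately show "{Y_induced cuboct0, Y_induced cuboct3} \<subseteq> {y \<in> cubocts. subgraph (clique_graph triangle_base) y}"
    using clique_base by (simp add: subgraph_clique_graph)
qed

lemma members_path_base:
  "{y \<in> cubocts. subgraph (path3 (VA 16) (VA 2) (VB 0)) y} = {Y_induced cuboct0, Y_induced cuboct1}"
proof
  let ?p = "path3 (VA 16) (VA 2) (VB 0)"
  show "{y \<in> cubocts. subgraph ?p y} \<subseteq> {Y_induced cuboct0, Y_induced cuboct1}"
  proof
    fix y assume "y \<in> {y \<in> cubocts. subgraph ?p y}"
    then have y: "y \<in> cubocts" "subgraph ?p y" by simp_all
    then have "edge_base \<in> edges y" by (simp add: subgraph_def insert_commute)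
    then have mem: "y \<in> {Y_induced cuboct0, Y_induced cuboct1, Y_induced cuboct2, Y_induced cuboct3}"
      using y cubocts_base by blast
    have "VA 16 \<in> verts y" using y by (simp add: subgraph_def)
    moreover have "VA 16 \<notin> cuboct2" "VA 16 \<notin> cuboct3" by (simp_all add: cuboct_defs)
    ultimately show "y \<in> {Y_induced cuboct0, Y_induced cuboct1}" using mem by auto
  qed
  have "Y_induced cuboct0 \<in> cubocts" "Y_induced cuboct1 \<in> cubocts" using cubocts_base by blast+
  moreover have "subgraph ?p (Y_induced cuboct0)" "subgraph ?p (Y_induced cuboct1)"
    by (simp_all add: subgraph_def Y_induced_adj cuboct_defs)
  ultimately show "{Y_induced cuboct0, Y_induced cuboct1} \<subseteq> {y \<in> cubocts. subgraph ?p y}" by simp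
qed

lemma members_map_graph:
  assumes g: "bs_aut g"
  shows "{y \<in> cubocts. subgraph (map_graph g X) y} = map_graph g ` {y \<in> cubocts. subgraph X y}"
  using cubocts_Collect_image[OF g, of "subgraph (map_graph g X)"]
  by (simp only: subgraph_map_graph[OF bs_aut_inj[OF g]])

lemma card_members_map_graph:
  assumes g: "bs_aut g"
  shows "card {y \<in> cubocts. subgraph (map_graph g X) y} = card {y \<in> cubocts. subgraph X y}"
  unfolding members_map_graph[OF g]
  by (rule card_image[OF inj_on_subset[OF inj_map_graph[OF bs_aut_inj[OF g]] subset_UNIV]])

lemma trianglesE:
  assumes "simple_graph G" "T \<in> triangles G"
  obtains a b c where "T = clique_graph {a, b, c}" "distinct [a, b, c]"
    "{a, b} \<in> edges G" "{a, c} \<in> edges G" "{b, c} \<in> edges G"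
proof -
  obtain X where X: "clique G X" "card X = 3" "T = clique_graph X"
    using copies_complete_graph[OF assms(1)] assms(2) by blast
  then obtain a b c where abc: "X = {a, b, c}" "a \<noteq> b" "b \<noteq> c" "a \<noteq> c"
    by (auto simp: card_3_iff)
  with X have "{a, b} \<in> edges G" "{a, c} \<in> edges G" "{b, c} \<in> edges G"
    by (simp_all add: clique_def)
  with that X abc show thesis by simp
qed

lemma triangles_YE:
  assumes "T \<in> triangles Y_graph"
  obtains g where "g \<in> bs_group" "T = map_graph g (clique_graph triangle_base)"
proof -
  obtain a b c where abc: "T = clique_graph {a, b, c}"
    "{a, b} \<in> edges Y_graph" "{a, c} \<in> edges Y_graph" "{b, c} \<in> edges Y_graph"
    using trianglesE[OF simple_Y assms] by metis
  then obtain g where g: "g \<in> bs_group" "g (VB 0) = a" "g (VA 2) = b" "g (VD 2) = c"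
    using bs_group_triangle_transitive[of b a c] by (auto simp: Y_adj_iff)
  then have "T = map_graph g (clique_graph triangle_base)"
    using abc by (simp add: map_graph_clique_graph[OF bs_aut_inj[OF bs_group_aut[OF g(1)]]])
  with g that show thesis by blast
qed

lemma triangles_subgraph:
  assumes "T \<in> triangles y" "subgraph y G"
  shows "T \<in> triangles G"
  using assms unfolding copies_def subgraph_def by blast

lemma card_members_triangle:
  assumes "T \<in> triangles Y_graph"
  shows "card {y \<in> cubocts. subgraph T y} = 2"
proof -
  obtain g where g: "g \<in> bs_group" and T: "T = map_graph g (clique_graph triangle_base)"
    by (rule triangles_YE[OF assms])
  show ?thesis
    unfolding T card_members_map_graph[OF bs_group_aut[OF g]] members_triangle_base
    using members_distinct by simp
qed

text \<open>An edge of the path together with \<open>y\<close> is moved to the base flag, where only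
  one path of \<open>Omega\<close> contains the edge.\<close>

lemma Omega_flag:
  assumes y: "y \<in> cubocts" and p: "p \<in> Omega y"
  obtains g where "g \<in> bs_group" "y = map_graph g (Y_induced cuboct0)"
    "p = map_graph g (path3 (VA 16) (VA 2) (VB 0))"
proof -
  obtain u v w where uvw: "p = path3 u v w" "{u, v} \<in> edges y"
    using p unfolding Omega_def by blast
  obtain g where g: "g \<in> bs_group" "y = map_graph g (Y_induced cuboct0)" "{u, v} = g ` edge_base"
    by (rule flag_transitive[OF y uvw(2)])
  note ga = bs_group_aut[OF g(1)]
  obtain q where q: "q \<in> Omega (Y_induced cuboct0)" "p = map_graph g q"
    using p unfolding g(2) Omega_map_graph[OF ga] by blast
  have "g ` edge_base \<in> edges (map_graph g q)"
    unfolding q(2)[symmetric] uvw(1) g(3)[symmetric] by simp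
  then have "edge_base \<in> edges q"
    unfolding map_graph_sel inj_image_mem[OF bs_aut_inj[OF ga]] .
  from Omega_base[OF q(1) this] q(2) g(1,2) that show thesis by blast
qed

lemma card_members_path:
  assumes "y \<in> cubocts" "p \<in> Omega y"
  shows "card {y' \<in> cubocts. subgraph p y'} = 2"
proof -
  obtain g where g: "g \<in> bs_group" and p: "p = map_graph g (path3 (VA 16) (VA 2) (VB 0))"
    by (rule Omega_flag[OF assms])
  show ?thesis
    unfolding p card_members_map_graph[OF bs_group_aut[OF g]] members_path_base
    using members_distinct by simp
qed

lemma union_cubocts: "graph_Union cubocts = Y_graph"
proof -
  have "\<exists>y\<in>cubocts. e \<in> edges y" if "e \<in> edges Y_graph" for e
  proof -
    have "{y \<in> cubocts. e \<in> edges y} \<noteq> {}" using card_members_edge[OF that] by force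
    then show ?thesis by blast
  qed
  moreover have "e \<in> edges Y_graph" if "y \<in> cubocts" "e \<in> edges y" for y e
    using that cubocts_subgraph unfolding subgraph_def by blast
  ultimately have E: "(\<Union>y\<in>cubocts. edges y) = edges Y_graph" by blast
  have "\<exists>y\<in>cubocts. v \<in> verts y" for v
  proof -
    obtain g where g: "g \<in> bs_group" "g (VB 0) = v" using bs_group_vertex_transitive by blast
    have "Y_induced cuboct0 \<in> cubocts" using cubocts_base by blast
    then have "map_graph g (Y_induced cuboct0) \<in> cubocts"
      using cubocts_map_graph[OF bs_group_aut[OF g(1)]] by simp
    moreover have "v \<in> verts (map_graph g (Y_induced cuboct0))"
      using g(2) by (auto simp: cuboct0_def)
    ultimately show ?thesis by blast
  qed
  then have V: "(\<Union>y\<in>cubocts. verts y) = UNIV" by blast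
  have "Y_graph = \<lparr>verts = UNIV, edges = edges Y_graph\<rparr>" using verts_Y by (metis graph.surjective old.unit.exhaust)
  then show ?thesis unfolding graph_Union_def E V by simp
qed

subsection \<open>Counting the members\<close>

lemma UNIV_bs_vertex: "(UNIV :: bs_vertex set) = VA ` UNIV \<union> VB ` UNIV \<union> VC ` UNIV \<union> VD ` UNIV \<union> VE ` UNIV \<union> VF ` UNIV"
proof -
  have "v \<in> VA ` UNIV \<union> VB ` UNIV \<union> VC ` UNIV \<union> VD ` UNIV \<union> VE ` UNIV \<union> VF ` UNIV" for v
    by (cases v) simp_all
  then show ?thesis by blast
qed

lemma finite_bs_vertex: "finite (UNIV :: bs_vertex set)"
  unfolding UNIV_bs_vertex by simp

lemma finite_bs_vertex_set: "finite (X :: bs_vertex set)"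
  by (rule finite_subset[OF subset_UNIV finite_bs_vertex])

lemma card_bs_vertex: "card (UNIV :: bs_vertex set) = 102"
proof -
  have c: "card (f ` UNIV) = 17" if "inj f" for f :: "17 \<Rightarrow> bs_vertex"
    using card_image[OF that] by simp
  have "inj VA" "inj VB" "inj VC" "inj VD" "inj VE" "inj VF" by (simp_all add: inj_def)
  note c = this[THEN c]
  show ?thesis
    unfolding UNIV_bs_vertex
    by (subst card_Un_disjoint, simp, simp, force)+ (simp add: c)
qed

text \<open>Serves twice: for Y, of valency 12, and for the base member, of valency 4.\<close>

lemma handshake:
  assumes G: "simple_graph G" and fin: "finite (verts G)"
    and deg: "\<And>v. v \<in> verts G \<Longrightarrow> card {w \<in> verts G. {v, w} \<in> edges G} = d"
  shows "card (verts G) * d = 2 * card (edges G)"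
proof -
  have "edges G \<subseteq> Pow (verts G)" using G by (auto simp: simple_graph_def)
  then have finE: "finite (edges G)" using fin by (meson finite_Pow_iff finite_subset)
  have "\<forall>e\<in>edges G. card {v \<in> verts G. v \<in> e} = 2"
  proof
    fix e assume e: "e \<in> edges G"
    then obtain u v where uv: "u \<noteq> v" "e = {u, v}" "u \<in> verts G" "v \<in> verts G" by (rule simple_graphE[OF G])
    then have "{v \<in> verts G. v \<in> e} = {u, v}" by auto
    with uv show "card {v \<in> verts G. v \<in> e} = 2" by simp
  qed
  then have "(\<Sum>v\<in>verts G. card {e \<in> edges G. v \<in> e}) = 2 * card (edges G)"
    by (rule sum_multicount[OF fin finE])
  moreover have "card {e \<in> edges G. v \<in> e} = d" if v: "v \<in> verts G" for v
  proof -
    have "{e \<in> edges G. v \<in> e} = (\<lambda>w. {v, w}) ` {w \<in> verts G. {v, w} \<in> edges G}"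
    proof
      show "{e \<in> edges G. v \<in> e} \<subseteq> (\<lambda>w. {v, w}) ` {w \<in> verts G. {v, w} \<in> edges G}"
      proof
        fix e assume "e \<in> {e \<in> edges G. v \<in> e}"
        then have e: "e \<in> edges G" "v \<in> e" by simp_all
        obtain a b where ab: "e = {a, b}" "a \<in> verts G" "b \<in> verts G" by (rule simple_graphE[OF G e(1)])
        with e(2) consider "v = a" | "v = b" by blast
        then show "e \<in> (\<lambda>w. {v, w}) ` {w \<in> verts G. {v, w} \<in> edges G}"
          using ab e(1) by cases (auto simp: insert_commute)
      qed
    qed auto
    moreover have "inj_on (\<lambda>w. {v, w}) {w \<in> verts G. {v, w} \<in> edges G}"
      by (rule inj_onI) (auto simp: doubleton_eq_iff)
    ultimately show ?thesis using deg[OF v] by (simp add: card_image)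
  qed
  ultimately show ?thesis by simp
qed

lemma card_Y_edges: "card (edges Y_graph) = 612"
proof -
  have "card {w \<in> verts Y_graph. {v, w} \<in> edges Y_graph} = 12" for v
  proof -
    obtain g where g: "g \<in> bs_group" "g (VB 0) = v" using bs_group_vertex_transitive by blast
    note ga = bs_group_aut[OF g(1)]
    have "surj g" using ga by (simp add: bs_aut_def bij_is_surj)
    then have "bs_sphere3 v = g ` bs_sphere3 (VB 0)"
      using bs_aut_sphere3[OF ga, of _ "VB 0"] g(2) by (auto simp: image_iff simp del: bs_sphere3.simps) (metis surjD)
    moreover have "inj_on g (bs_sphere3 (VB 0))" using bs_aut_inj[OF ga] by (rule inj_on_subset) simp
    ultimately have "card (bs_sphere3 v) = card (bs_sphere3 (VB 0))"
      by (simp only: card_image)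
    then show ?thesis by (simp add: Y_adj_iff)
  qed
  from handshake[OF simple_Y _ this] show ?thesis by (simp add: finite_bs_vertex card_bs_vertex)
qed

lemma card_cuboct0_edges: "card (edges (Y_induced cuboct0)) = 24"
proof -
  have c: "\<forall>v\<in>cuboct0. card (cuboct_nbrs v) = 4"
    unfolding cuboct0_def by (simp add: cuboct_nbrs_eval)
  have "card {w \<in> verts (Y_induced cuboct0). {v, w} \<in> edges (Y_induced cuboct0)} = 4"
    if "v \<in> verts (Y_induced cuboct0)" for v
  proof -
    have "{w \<in> verts (Y_induced cuboct0). {v, w} \<in> edges (Y_induced cuboct0)} = cuboct_nbrs v"
      using that by (auto simp: cuboct0_adj cuboct_nbrs_def simp del: bs_sphere3.simps)
    then show ?thesis using c that by simp
  qed
  from handshake[OF simple_Y_induced _ this]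
  have "card cuboct0 * 4 = 2 * card (edges (Y_induced cuboct0))" by (simp add: finite_bs_vertex_set)
  moreover have "card cuboct0 = 12" by (simp add: cuboct0_def)
  ultimately show ?thesis by simp
qed

text \<open>Double counting of the pairs of a member and one of its edges: 24 times the number of
  members is 4 * 612. This avoids comparing the neighbourhoods of different copies of
  \<open>K\<^sub>4\<close>.\<close>

lemma card_cubocts: "card cubocts = 102"
proof -
  have fin: "finite cubocts" "finite (edges Y_graph)"
    unfolding cubocts_def
    by (meson finite_imageI finite_subset subset_UNIV Finite_Set.finite_set finite_bs_vertex)
      (metis card_Y_edges card.infinite zero_neq_numeral)
  have "card {e \<in> edges Y_graph. e \<in> edges y} = 24" if y: "y \<in> cubocts" for y
  proof -
    obtain g where g: "g \<in> bs_group" "y = map_graph g (Y_induced cuboct0)" by (rule cubocts_transitive[OF y])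
    note inj = bs_aut_inj[OF bs_group_aut[OF g(1)]]
    have "{e \<in> edges Y_graph. e \<in> edges y} = edges y"
      using cubocts_subgraph[OF y] by (auto simp: subgraph_def)
    also have "\<dots> = (`) g ` edges (Y_induced cuboct0)" by (simp add: g(2))
    also have "card \<dots> = card (edges (Y_induced cuboct0))"
      by (rule card_image) (simp add: inj_on_def inj_image_eq_iff[OF inj])
    finally show ?thesis by (simp add: card_cuboct0_edges)
  qed
  moreover have "(\<Sum>y\<in>cubocts. card {e \<in> edges Y_graph. e \<in> edges y}) = 4 * card (edges Y_graph)"
    by (rule sum_multicount[OF fin]) (simp add: card_members_edge)
  ultimately show ?thesis by (simp add: card_Y_edges)
qed

subsection \<open>Complete subgraphs\<close>

text \<open>Existence is transported from the base triangle; for uniqueness, two common vertices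
  already suffice.\<close>

lemma clique_card_3_K4:
  assumes X: "clique Y_graph X" "card X = 3"
  shows "\<exists>!Z. K4_set Z \<and> X \<subseteq> Z"
proof -
  obtain a b c where abc: "X = {a, b, c}" "a \<noteq> b" "b \<noteq> c" "a \<noteq> c"
    using X(2) by (auto simp: card_3_iff)
  then obtain g where g: "g \<in> bs_group" "g (VB 0) = a" "g (VA 2) = b" "g (VD 2) = c"
    using bs_group_triangle_transitive[of b a c] X(1) by (auto simp: clique_Y_iff)
  have "K4_set (g ` K4_base)"
    using K4_set_image[OF bs_group_aut[OF g(1)]] K4_set_K4_base by blast
  moreover have "X \<subseteq> g ` K4_base" using abc(1) g by simp
  moreover have "Z = Z'" if "K4_set Z" "X \<subseteq> Z" "K4_set Z'" "X \<subseteq> Z'" for Z Z'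
    using that abc by (intro K4_set_unique[of Z Z' a b]) auto
  ultimately show ?thesis by (intro ex1I[of _ "g ` K4_base"]) blast+
qed

lemma copies_K4: "H \<in> copies Y_graph (complete_graph 4) \<longleftrightarrow> (\<exists>Z. K4_set Z \<and> H = clique_graph Z)"
  unfolding copies_complete_graph[OF simple_Y] K4_set_def using finite_bs_vertex_set by blast

lemma subgraph_clique_graph_clique_graph: "subgraph (clique_graph X) (clique_graph Z) \<longleftrightarrow> X \<subseteq> Z"
  by (auto simp: subgraph_def clique_graph_def)

lemma triangle_unique_K4:
  assumes "T \<in> triangles Y_graph"
  shows "\<exists>!K. K \<in> copies Y_graph (complete_graph 4) \<and> subgraph T K"
proof -
  obtain X where X: "clique Y_graph X" "card X = 3" "T = clique_graph X"
    using copies_complete_graph[OF simple_Y] assms by blast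
  from clique_card_3_K4[OF X(1,2)] obtain Z where Z: "K4_set Z" "X \<subseteq> Z"
    and u: "\<And>Z'. K4_set Z' \<Longrightarrow> X \<subseteq> Z' \<Longrightarrow> Z' = Z" by blast
  show ?thesis
    unfolding copies_K4 X(3)
  proof (rule ex1I[of _ "clique_graph Z"])
    show "(\<exists>Za. K4_set Za \<and> clique_graph Z = clique_graph Za) \<and> subgraph (clique_graph X) (clique_graph Z)"
      using Z by (auto simp: subgraph_clique_graph_clique_graph)
    show "K = clique_graph Z"
      if "(\<exists>Z. K4_set Z \<and> K = clique_graph Z) \<and> subgraph (clique_graph X) K" for K
      using that u by (auto simp: subgraph_clique_graph_clique_graph)
  qed
qed

text \<open>All copies of \<open>K\<^sub>4\<close> together form the decomposition, since every edge
  lies in exactly one of them.\<close>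

lemma K4_decomposition:
  "\<exists>\<K>\<subseteq>induced_copies Y_graph (complete_graph 4). disjoint_family_on edges \<K> \<and> graph_Union \<K> = Y_graph"
proof (intro exI[of _ "clique_graph ` {Z. K4_set Z}"] conjI)
  let ?K = "clique_graph ` {Z. K4_set Z}"
  show "?K \<subseteq> induced_copies Y_graph (complete_graph 4)"
    unfolding induced_copies_complete_graph[OF simple_Y] using copies_K4 by blast
  show "disjoint_family_on edges ?K"
    unfolding disjoint_family_on_def
  proof (intro ballI impI)
    fix K K' assume "K \<in> ?K" "K' \<in> ?K" and ne: "K \<noteq> K'"
    then obtain Z Z' where Z: "K4_set Z" "K = clique_graph Z" "K4_set Z'" "K' = clique_graph Z'" by blast
    have "False" if e: "e \<in> edges K" "e \<in> edges K'" for e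
    proof -
      obtain u v where uv: "u \<in> Z" "v \<in> Z" "u \<noteq> v" "e = {u, v}"
        using e(1) by (auto simp: Z clique_graph_def)
      then have "u \<in> Z'" "v \<in> Z'"
        using e(2) by (auto simp: Z clique_graph_def doubleton_eq_iff)
      with uv have "Z = Z'" by (intro K4_set_unique[OF Z(1,3)])
      with ne Z show False by simp
    qed
    then show "edges K \<inter> edges K' = {}" by blast
  qed
  have K: "edges K \<subseteq> edges Y_graph" if "K \<in> ?K" for K
    using that by (auto simp: K4_set_def clique_def clique_graph_def)
  then have "(\<Union>K\<in>?K. edges K) \<subseteq> edges Y_graph" by (rule UN_least)
  moreover have "\<exists>K\<in>?K. e \<in> edges K" if "e \<in> edges Y_graph" for e
  proof -
    obtain u v where uv: "e = {u, v}" "v \<in> bs_sphere3 u" by (rule Y_edgeE[OF \<open>e \<in> edges Y_graph\<close>])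
    then obtain Z where Z: "K4_set Z" "u \<in> Z" "v \<in> Z" using K4_set_ex by blast
    moreover have "u \<noteq> v" using uv bs_sphere3_irrefl by blast
    ultimately have "e \<in> edges (clique_graph Z)" by (auto simp: uv clique_graph_def)
    with Z show ?thesis by blast
  qed
  then have "edges Y_graph \<subseteq> (\<Union>K\<in>?K. edges K)" by (intro subsetI) simp
  ultimately have E: "(\<Union>K\<in>?K. edges K) = edges Y_graph" by (rule subset_antisym)
  have "\<exists>K\<in>?K. v \<in> verts K" for v
  proof -
    obtain g where g: "g \<in> bs_group" "g (VB 0) = v" using bs_group_vertex_transitive by blast
    have "K4_set (g ` K4_base)"
      using K4_set_image[OF bs_group_aut[OF g(1)]] K4_set_K4_base by blast
    moreover have "v \<in> g ` K4_base" using g(2) by blast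
    ultimately show ?thesis by force
  qed
  then have V: "(\<Union>K\<in>?K. verts K) = UNIV" by blast
  have "Y_graph = \<lparr>verts = UNIV, edges = edges Y_graph\<rparr>" using verts_Y by (metis graph.surjective old.unit.exhaust)
  then show "graph_Union ?K = Y_graph" unfolding graph_Union_def E V by simp
qed

subsection \<open>Extension of isomorphisms\<close>

lemma extends_bs_group:
  assumes "g \<in> bs_group" "\<And>v. v \<in> verts H \<Longrightarrow> g v = f v"
  shows "extends_to_automorphism Y_graph H f"
  using assms bs_aut_automorphism[OF bs_group_aut] unfolding extends_to_automorphism_def by blast

lemma bs_group_move_arc:
  assumes "b \<in> bs_sphere3 a" "b' \<in> bs_sphere3 a'"
  obtains g where "g \<in> bs_group" "g a = a'" "g b = b'"
proof -
  obtain h where h: "h \<in> bs_group" "h (VB 0) = a" "h (VA 2) = b"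
    using bs_group_arc_transitive[OF assms(1)] by blast
  obtain k where k: "k \<in> bs_group" "k (VB 0) = a'" "k (VA 2) = b'"
    using bs_group_arc_transitive[OF assms(2)] by blast
  show thesis
    by (rule that[of "k \<circ> inv_into UNIV h"])
      (use h k bs_group_inv_apply(1)[OF h(1)] bs_group_comp bs_group_inv in auto)
qed

lemma bs_group_move_triangle:
  assumes "b \<in> bs_sphere3 a" "c \<in> bs_sphere3 a" "c \<in> bs_sphere3 b"
    and "b' \<in> bs_sphere3 a'" "c' \<in> bs_sphere3 a'" "c' \<in> bs_sphere3 b'"
  obtains g where "g \<in> bs_group" "g a = a'" "g b = b'" "g c = c'"
proof -
  obtain h where h: "h \<in> bs_group" "h (VB 0) = a" "h (VA 2) = b" "h (VD 2) = c"
    using bs_group_triangle_transitive[OF assms(1-3)] by blast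
  obtain k where k: "k \<in> bs_group" "k (VB 0) = a'" "k (VA 2) = b'" "k (VD 2) = c'"
    using bs_group_triangle_transitive[OF assms(4-6)] by blast
  show thesis
    by (rule that[of "k \<circ> inv_into UNIV h"])
      (use h k bs_group_inv_apply(1)[OF h(1)] bs_group_comp bs_group_inv in auto)
qed

lemma clique_graph_iso_adj:
  assumes "graph_iso f (clique_graph X) (clique_graph X')" "clique Y_graph X'"
    and "u \<in> X" "v \<in> X" "u \<noteq> v"
  shows "f v \<in> bs_sphere3 (f u)"
proof -
  have bij: "bij_betw f X X'" using assms(1) by (simp add: graph_iso_def)
  then have "f u \<in> X'" "f v \<in> X'" "f u \<noteq> f v"
    using assms(3-5) by (auto simp: bij_betw_def inj_on_eq_iff)
  then show ?thesis using assms(2) by (simp add: clique_Y_iff)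
qed

lemma isos_extend_edges: "isos_extend Y_graph (copies Y_graph (complete_graph 2))"
  unfolding isos_extend_def
proof (intro ballI allI impI)
  fix H H' f assume H: "H \<in> copies Y_graph (complete_graph 2)" "H' \<in> copies Y_graph (complete_graph 2)"
    and f: "graph_iso f H H'"
  obtain X where X: "clique Y_graph X" "card X = 2" "H = clique_graph X"
    using H(1) copies_complete_graph[OF simple_Y] by blast
  obtain X' where X': "clique Y_graph X'" "H' = clique_graph X'"
    using H(2) copies_complete_graph[OF simple_Y] by blast
  obtain a b where ab: "X = {a, b}" "a \<noteq> b" using X(2) by (auto simp: card_2_iff)
  have "f b \<in> bs_sphere3 (f a)"
    using clique_graph_iso_adj[of f X X' a b] f X X' ab by simp
  moreover have "b \<in> bs_sphere3 a" using X(1) ab by (simp add: clique_Y_iff)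
  ultimately obtain g where "g \<in> bs_group" "g a = f a" "g b = f b" using bs_group_move_arc by metis
  then show "extends_to_automorphism Y_graph H f"
    by (intro extends_bs_group[of g]) (auto simp: X(3) ab(1))
qed

lemma isos_extend_triangles: "isos_extend Y_graph (triangles Y_graph)"
  unfolding isos_extend_def
proof (intro ballI allI impI)
  fix H H' f assume H: "H \<in> triangles Y_graph" "H' \<in> triangles Y_graph" and f: "graph_iso f H H'"
  obtain X where X: "clique Y_graph X" "card X = 3" "H = clique_graph X"
    using H(1) copies_complete_graph[OF simple_Y] by blast
  obtain X' where X': "clique Y_graph X'" "H' = clique_graph X'"
    using H(2) copies_complete_graph[OF simple_Y] by blast
  obtain a b c where abc: "X = {a, b, c}" "a \<noteq> b" "b \<noteq> c" "a \<noteq> c" using X(2) by (auto simp: card_3_iff)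
  have adj: "v \<in> bs_sphere3 u \<and> f v \<in> bs_sphere3 (f u)" if "u \<in> X" "v \<in> X" "u \<noteq> v" for u v
    using clique_graph_iso_adj[of f X X' u v] f X X' that by (simp add: clique_Y_iff)
  obtain g where "g \<in> bs_group" "g a = f a" "g b = f b" "g c = f c"
    using bs_group_move_triangle[of b a c "f b" "f a" "f c"] adj abc by auto
  then show "extends_to_automorphism Y_graph H f"
    by (intro extends_bs_group[of g]) (auto simp: X(3) abc(1))
qed

lemma isos_extend_K4: "isos_extend Y_graph (induced_copies Y_graph (complete_graph 4))"
  unfolding isos_extend_def induced_copies_complete_graph[OF simple_Y]
proof (intro ballI allI impI)
  fix H H' f assume H: "H \<in> copies Y_graph (complete_graph 4)" "H' \<in> copies Y_graph (complete_graph 4)"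
    and f: "graph_iso f H H'"
  obtain Z Z' where Z: "K4_set Z" "H = clique_graph Z" "K4_set Z'" "H' = clique_graph Z'"
    using H copies_K4 by blast
  have bij: "bij_betw f Z Z'" using f Z by (simp add: graph_iso_def)
  have adj: "v \<in> bs_sphere3 u \<and> f v \<in> bs_sphere3 (f u)" if "u \<in> Z" "v \<in> Z" "u \<noteq> v" for u v
    using clique_graph_iso_adj[of f Z Z' u v] f Z that by (simp add: clique_Y_iff K4_set_def)
  obtain d where d: "d \<in> Z" using Z(1) by (metis K4_set_obtain2)
  have "card (Z - {d}) = 3" using Z(1) d by (simp add: K4_set_def finite_bs_vertex_set)
  then obtain a b c where abc: "Z - {d} = {a, b, c}" "a \<noteq> b" "b \<noteq> c" "a \<noteq> c" by (auto simp: card_3_iff)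
  then have Zd: "Z = {a, b, c, d}" "d \<noteq> a" "d \<noteq> b" "d \<noteq> c" using d by auto
  obtain g where g: "g \<in> bs_group" "g a = f a" "g b = f b" "g c = f c"
    using bs_group_move_triangle[of b a c "f b" "f a" "f c"] adj abc Zd by auto
  have fZ: "{f a, f b, f c, f d} = Z'" using bij Zd by (auto simp: bij_betw_def)
  have "g ` Z = Z'"
  proof (rule K4_set_unique[of _ _ "f a" "f b"])
    show "K4_set (g ` Z)" using K4_set_image[OF bs_group_aut[OF g(1)]] Z(1) by simp
    show "K4_set Z'" by (rule Z(3))
    show "f a \<in> g ` Z" "f b \<in> g ` Z" using g Zd by auto
    show "f a \<in> Z'" "f b \<in> Z'" using fZ by auto
    show "f a \<noteq> f b" using bij Zd abc by (auto simp: bij_betw_def inj_on_eq_iff)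
  qed
  then have "g d \<in> {f a, f b, f c, f d}" using fZ Zd(1) by blast
  moreover have "g d \<noteq> f a" "g d \<noteq> f b" "g d \<noteq> f c"
    using g Zd bs_aut_eq_iff[OF bs_group_aut[OF g(1)]] by metis+
  ultimately have "g d = f d" by blast
  then show "extends_to_automorphism Y_graph H f"
    using g by (intro extends_bs_group[of g]) (auto simp: Z Zd(1))
qed

text \<open>Let \<open>g\<close> carry the base member to \<open>y\<close>, and choose
  \<open>g'\<close> carrying the base flag to \<open>y'\<close> with the image under
  \<open>f\<close> of the edge of \<open>y\<close> that \<open>g\<close> gives. Then
  \<open>f\<close> pulls back to a symmetry \<open>h\<close> of the base member that preserves
  \<open>Omega\<close> and the base edge, so \<open>h\<close> is the identity there and
  \<open>f\<close> agrees with \<open>g'\<close> after the inverse of \<open>g\<close>.\<close>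

lemma path_preserving_extends:
  assumes y: "y \<in> cubocts" "y' \<in> cubocts" and f: "graph_iso f y y'" and pres: "path_preserving Omega f y y'"
  shows "extends_to_automorphism Y_graph y f"
proof -
  let ?m = "Y_induced cuboct0"
  obtain g where g: "g \<in> bs_group" "y = map_graph g ?m" by (rule cubocts_transitive[OF y(1)])
  note ga = bs_group_aut[OF g(1)] and ginj = bs_aut_inj[OF bs_group_aut[OF g(1)]]
  have "edge_base \<in> edges ?m" by (simp add: Y_induced_adj cuboct0_def)
  then have "{g (VB 0), g (VA 2)} \<in> edges y"
    unfolding g(2) by (simp only: doubleton_mem_map_graph[OF ginj])
  moreover have gm: "g v \<in> verts y" if "v \<in> cuboct0" for v using that by (simp add: g(2))
  ultimately have "{f (g (VB 0)), f (g (VA 2))} \<in> edges y'"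
    using f unfolding graph_iso_def by (simp add: cuboct0_def)
  then obtain g' where g': "g' \<in> bs_group" "y' = map_graph g' ?m"
    "{f (g (VB 0)), f (g (VA 2))} = g' ` edge_base"
    by (rule flag_transitive[OF y(2)])
  note g'a = bs_group_aut[OF g'(1)] and g'inj = bs_aut_inj[OF bs_group_aut[OF g'(1)]]
  define k where "k = inv_into UNIV g'"
  have kg: "k (g' v) = v" "g' (k v) = v" for v
    using bs_group_inv_apply[OF g'(1)] by (simp_all add: k_def)
  define h where "h = k \<circ> f \<circ> g"
  have g'h: "g' (h v) = f (g v)" for v by (simp add: h_def kg)
  have iso: "graph_iso h ?m ?m"
    unfolding graph_iso_def
  proof (intro conjI ballI)
    have "bij_betw g cuboct0 (verts y)" using inj_on_subset[OF ginj subset_UNIV] by (simp add: g(2) bij_betw_def)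
    moreover have "bij_betw f (verts y) (verts y')" using f by (simp add: graph_iso_def)
    moreover have "bij_betw k (verts y') cuboct0"
      by (rule bij_betw_byWitness[of _ g']) (auto simp: g'(2) kg)
    ultimately show "bij_betw h (verts ?m) (verts ?m)"
      unfolding h_def verts_Y_induced by (metis bij_betw_trans)
    fix u v assume uv: "u \<in> verts ?m" "v \<in> verts ?m"
    have "{u, v} \<in> edges ?m \<longleftrightarrow> {g u, g v} \<in> edges y"
      unfolding g(2) by (simp only: doubleton_mem_map_graph[OF ginj])
    also have "\<dots> \<longleftrightarrow> {f (g u), f (g v)} \<in> edges y'"
      using f gm uv unfolding graph_iso_def by simp
    also have "\<dots> \<longleftrightarrow> {h u, h v} \<in> edges ?m"
      unfolding g'(2) g'h[symmetric] by (simp only: doubleton_mem_map_graph[OF g'inj])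
    finally show "{u, v} \<in> edges ?m \<longleftrightarrow> {h u, h v} \<in> edges ?m" .
  qed
  have hp: "path_preserving Omega h ?m ?m"
    unfolding path_preserving_def
  proof
    fix p assume "p \<in> Omega ?m"
    then have "map_graph g p \<in> Omega y" by (simp add: g(2) Omega_map_graph[OF ga])
    then have "map_graph f (map_graph g p) \<in> Omega y'" using pres by (simp add: path_preserving_def)
    then obtain q where q: "q \<in> Omega ?m" "map_graph f (map_graph g p) = map_graph g' q"
      by (auto simp: g'(2) Omega_map_graph[OF g'a])
    have "map_graph h p = map_graph k (map_graph f (map_graph g p))"
      by (simp add: h_def map_graph_comp comp_assoc)
    also have "\<dots> = map_graph k (map_graph g' q)" by (simp only: q(2))
    also have "\<dots> = map_graph (k \<circ> g') q" by (rule map_graph_comp)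
    finally have "map_graph h p = map_graph (k \<circ> g') q" .
    moreover have "k \<circ> g' = id" by (simp add: fun_eq_iff kg)
    ultimately show "map_graph h p \<in> Omega ?m" using q(1) by (simp only: map_graph_id)
  qed
  have "h ` edge_base = k ` {f (g (VB 0)), f (g (VA 2))}" by (simp add: h_def)
  also have "\<dots> = edge_base" unfolding g'(3) by (simp add: kg)
  finally have hv: "h v = v" if "v \<in> cuboct0" for v
    using cuboct_rigid[OF iso hp _ that] by blast
  show ?thesis
  proof (rule extends_bs_group)
    show "g' \<circ> inv_into UNIV g \<in> bs_group" using g g' bs_group_comp bs_group_inv by blast
    fix x assume "x \<in> verts y"
    then obtain v where v: "x = g v" "v \<in> cuboct0" by (auto simp: g(2))
    then show "(g' \<circ> inv_into UNIV g) x = f x"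
      using g'h[of v] hv bs_group_inv_apply(1)[OF g(1)] by simp
  qed
qed

subsection \<open>Intersections of members\<close>

lemma subgraph_graph_inter: "subgraph X (graph_inter G H) \<longleftrightarrow> subgraph X G \<and> subgraph X H"
  by (auto simp: subgraph_def graph_inter_def)

text \<open>The member on \<open>cuboct2\<close> comes first because it is the one that meets the
  given member in the edge alone.\<close>

lemma members_flag_other:
  assumes g: "bs_aut g"
  shows "{y \<in> cubocts - {map_graph g (Y_induced cuboct0)}. g ` edge_base \<in> edges y} =
    {map_graph g (Y_induced cuboct2), map_graph g (Y_induced cuboct1), map_graph g (Y_induced cuboct3)}"
    and "distinct [map_graph g (Y_induced cuboct2), map_graph g (Y_induced cuboct1), map_graph g (Y_induced cuboct3)]"
proof -
  let ?y = "\<lambda>X. map_graph g (Y_induced X)"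
  have eq: "?y X = ?y X' \<longleftrightarrow> X = X'" for X X'
    using inj_map_graph[OF bs_aut_inj[OF g]] by (simp add: inj_eq Y_induced_eq_iff)
  have "{y \<in> cubocts - {?y cuboct0}. g ` edge_base \<in> edges y} = {y \<in> cubocts. g ` edge_base \<in> edges y} - {?y cuboct0}"
    by blast
  also have "\<dots> = {?y cuboct2, ?y cuboct1, ?y cuboct3}"
    unfolding members_flag[OF g] using cubocts_distinct by (auto simp: eq)
  finally show "{y \<in> cubocts - {?y cuboct0}. g ` edge_base \<in> edges y} = {?y cuboct2, ?y cuboct1, ?y cuboct3}" .
  show "distinct [?y cuboct2, ?y cuboct1, ?y cuboct3]"
    using cubocts_distinct by (auto simp: eq)
qed

lemma subgraph_edge_graph:
  assumes "simple_graph G"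
  shows "subgraph (edge_graph e) G \<longleftrightarrow> e \<in> edges G"
  using assms by (auto simp: subgraph_def edge_graph_def simple_graph_def)

lemma edge_zipped:
  assumes y0: "y0 \<in> cubocts" and e: "e \<in> edges y0"
  shows "\<exists>y1 y2 y3. distinct [y1, y2, y3] \<and>
        {y \<in> cubocts - {y0}. subgraph (edge_graph e) (graph_inter y y0)} = {y1, y2, y3} \<and>
        graph_inter y1 y0 = edge_graph e"
proof -
  obtain g where g: "g \<in> bs_group" "y0 = map_graph g (Y_induced cuboct0)" "e = g ` edge_base"
    by (rule flag_transitive[OF y0 e])
  note ga = bs_group_aut[OF g(1)]
  have "{y \<in> cubocts - {y0}. subgraph (edge_graph e) (graph_inter y y0)} = {y \<in> cubocts - {y0}. e \<in> edges y}"
    using e subgraph_edge_graph cubocts_simple y0 unfolding subgraph_graph_inter by blast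
  moreover have "graph_inter (map_graph g (Y_induced cuboct2)) y0 = edge_graph e"
    unfolding g(2,3) graph_inter_map_graph[OF bs_aut_inj[OF ga]] inter_2
    by (simp add: map_graph_def edge_graph_def)
  ultimately show ?thesis
    using members_flag_other[OF ga] unfolding g(2)[symmetric] g(3)[symmetric] by metis
qed

lemma triangle_zipped:
  assumes y0: "y0 \<in> cubocts" and T: "T \<in> triangles y0"
  shows "\<exists>y1. {y \<in> cubocts - {y0}. subgraph T (graph_inter y y0)} = {y1} \<and> graph_inter y1 y0 = T"
proof -
  obtain a b c where abc: "T = clique_graph {a, b, c}" "distinct [a, b, c]"
    "{a, b} \<in> edges y0" "{a, c} \<in> edges y0" "{b, c} \<in> edges y0"
    by (rule trianglesE[OF cubocts_simple[OF y0] T])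
  obtain g where g: "g \<in> bs_group" "y0 = map_graph g (Y_induced cuboct0)" "{a, b} = g ` edge_base"
    by (rule flag_transitive[OF y0 abc(3)])
  note ga = bs_group_aut[OF g(1)] and inj = bs_aut_inj[OF bs_group_aut[OF g(1)]]
  have "c \<in> verts y0" using abc(4) cubocts_simple[OF y0] by (auto simp: simple_graph_def)
  then obtain c' where c': "c = g c'" "c' \<in> cuboct0" by (auto simp: g(2))
  have "{g u, g c'} \<in> edges y0" if "u \<in> edge_base" for u
  proof -
    have "g u \<in> {a, b}" using that unfolding g(3) by (rule imageI)
    then show ?thesis using abc(4,5) unfolding c'(1) by (elim insertE emptyE) simp_all
  qed
  then have "c' \<in> cuboct_nbrs (VB 0)" "c' \<in> cuboct_nbrs (VA 2)"
    unfolding g(2) doubleton_mem_map_graph[OF inj] cuboct0_adj by blast+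
  \<comment> \<open>Of the two common neighbours of \<open>VB 0\<close> and \<open>VA 2\<close> in
    Y, only \<open>VD 2\<close> lies in \<open>cuboct0\<close>.\<close>
  then have "c' = VD 2" by (auto simp: cuboct_nbrs_eval)
  then have "{a, b, c} = g ` triangle_base" using g(3) c'(1) by auto
  then have Tg: "T = map_graph g (clique_graph triangle_base)"
    by (simp add: abc(1) map_graph_clique_graph[OF inj])
  have ne: "map_graph g (Y_induced cuboct3) \<noteq> y0"
    using cubocts_distinct inj_map_graph[OF inj] by (auto simp: g(2) inj_eq Y_induced_eq_iff)
  have "{y \<in> cubocts - {y0}. subgraph T (graph_inter y y0)} = {y \<in> cubocts. subgraph T y} - {y0}"
    using T by (auto simp: subgraph_graph_inter copies_def)
  also have "\<dots> = {map_graph g (Y_induced cuboct3)}"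
    unfolding Tg members_map_graph[OF ga] members_triangle_base using ne by (auto simp: g(2))
  finally have "{y \<in> cubocts - {y0}. subgraph T (graph_inter y y0)} = {map_graph g (Y_induced cuboct3)}" .
  moreover have "graph_inter (map_graph g (Y_induced cuboct3)) y0 = T"
    unfolding g(2) Tg graph_inter_map_graph[OF inj] inter_3 ..
  ultimately show ?thesis by blast
qed

lemma card_edges_inter:
  assumes "X \<in> {cuboct1, cuboct2, cuboct3}"
  shows "finite (edges (graph_inter (Y_induced X) (Y_induced cuboct0))) \<and>
    card (edges (graph_inter (Y_induced X) (Y_induced cuboct0))) \<le> 3"
proof -
  have *: "finite E \<and> card E \<le> 3" if "E \<subseteq> {e1, e2, e3}" for E :: "bs_vertex set set" and e1 e2 e3
  proof -
    have "card {e1, e2, e3} \<le> 3" by (simp add: card_insert_if)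
    then show ?thesis using that by (meson card_mono finite.emptyI finite.insertI finite_subset le_trans)
  qed
  have "edges (graph_inter (Y_induced cuboct3) (Y_induced cuboct0)) \<subseteq> {{VB 0, VA 2}, {VB 0, VD 2}, {VA 2, VD 2}}"
    unfolding inter_3 by (auto simp: clique_graph_def)
  moreover have "edges (graph_inter (Y_induced cuboct2) (Y_induced cuboct0)) \<subseteq> {{VB 0, VA 2}, {VB 0, VA 2}, {VB 0, VA 2}}"
    unfolding inter_2 by (simp add: edge_graph_def)
  moreover have "edges (graph_inter (Y_induced cuboct1) (Y_induced cuboct0)) \<subseteq> {{VA 2, VA 16}, {VA 2, VB 0}, {VA 2, VB 0}}"
    using inter_1 by simp
  ultimately show ?thesis using assms * by (elim insertE emptyE) blast+
qed

text \<open>A 4-hole has four edges, while two different members with a common edge share at most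
  three.\<close>

lemma hole_unique_member:
  assumes vs: "chordless_cycle Y_graph vs" "length vs = 4" and y: "y \<in> cubocts" "y' \<in> cubocts"
    and sub: "subgraph (cycle_graph vs) y" "subgraph (cycle_graph vs) y'"
  shows "y = y'"
proof (rule ccontr)
  assume ne: "y \<noteq> y'"
  have "\<exists>s t u v. vs = [s, t, u, v]" using vs(2) by (auto simp: eval_nat_numeral length_Suc_conv)
  then obtain s t u v where stuv: "vs = [s, t, u, v]" by blast
  have d: "distinct [s, t, u, v]" using vs(1) unfolding stuv chordless_4_cycle_iff[OF simple_Y] by blast
  have E: "edges (cycle_graph vs) = {{s, t}, {t, u}, {u, v}, {v, s}}" by (simp add: stuv cycle_graph_4)
  then have card: "card (edges (cycle_graph vs)) = 4"
    using d by (auto simp: doubleton_eq_iff card_insert_if)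
  have st: "{s, t} \<in> edges y" "{s, t} \<in> edges y'" using sub E by (auto simp: subgraph_def)
  obtain g where g: "g \<in> bs_group" "y = map_graph g (Y_induced cuboct0)" "{s, t} = g ` edge_base"
    by (rule flag_transitive[OF y(1) st(1)])
  note ga = bs_group_aut[OF g(1)] and inj = bs_aut_inj[OF bs_group_aut[OF g(1)]]
  have "y' \<in> {y' \<in> cubocts - {map_graph g (Y_induced cuboct0)}. g ` edge_base \<in> edges y'}"
    using y(2) st(2) g(2,3) ne by simp
  then obtain X where X: "X \<in> {cuboct1, cuboct2, cuboct3}" "y' = map_graph g (Y_induced X)"
    unfolding members_flag_other[OF ga] by blast
  have "edges (cycle_graph vs) \<subseteq> edges (graph_inter y' y)"
    using sub by (auto simp: subgraph_def graph_inter_def)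
  also have "\<dots> = (`) g ` edges (graph_inter (Y_induced X) (Y_induced cuboct0))"
    unfolding g(2) X(2) graph_inter_map_graph[OF inj] by simp
  finally have "card (edges (cycle_graph vs)) \<le> card ((`) g ` edges (graph_inter (Y_induced X) (Y_induced cuboct0)))"
    using card_edges_inter[OF X(1)] by (intro card_mono) simp_all
  also have "\<dots> \<le> 3"
    using card_edges_inter[OF X(1)] card_image_le le_trans by metis
  finally show False using card by simp
qed

lemma strongly_zipped: "strongly_zipped_LQ3_UH Y_graph cubocts Omega"
  unfolding strongly_zipped_LQ3_UH_def
proof (intro conjI ballI allI impI isos_extend_triangles isos_extend_edges)
  show "extends_to_automorphism Y_graph y f"
    if "y \<in> cubocts" "y' \<in> cubocts" "graph_iso f y y' \<and> path_preserving Omega f y y'" for y y' f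
    using path_preserving_extends that by blast
qed (rule triangle_zipped edge_zipped; assumption)+

lemma K4_zipped: "K4_LQ3_UH Y_graph cubocts Omega"
  unfolding K4_LQ3_UH_def
proof (intro conjI isos_extend_K4 K4_decomposition strongly_zipped ballI)
  fix K T assume K: "K \<in> induced_copies Y_graph (complete_graph 4)" and T: "T \<in> triangles K"
  have "subgraph K Y_graph" using K unfolding induced_copies_complete_graph[OF simple_Y] by (simp add: copies_def)
  then have "T \<in> triangles Y_graph" by (rule triangles_subgraph[OF T])
  moreover have "{y \<in> cubocts. subgraph T (graph_inter K y)} = {y \<in> cubocts. subgraph T y}"
    using T by (auto simp: subgraph_graph_inter copies_def)
  ultimately show "card {y \<in> cubocts. subgraph T (graph_inter K y)} = 2"
    using card_members_triangle by simp
qed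

subsection \<open>Rigidity of the automorphisms\<close>

lemma automorphism_Y_iff:
  "f \<in> automorphisms Y_graph \<longleftrightarrow> bij f \<and> (\<forall>u v. f v \<in> bs_sphere3 (f u) \<longleftrightarrow> v \<in> bs_sphere3 u)"
  by (auto simp: automorphisms_def Bij_def graph_iso_def Y_adj_iff)

text \<open>A second common neighbour, besides \<open>VB 0\<close>: once the triangle on \<open>VB 0, VA 2, VD 2\<close> is fixed, this relation
  tells all neighbours of \<open>VB 0\<close> apart.\<close>

definition linked :: "bs_vertex \<Rightarrow> bs_vertex \<Rightarrow> bool" where
  "linked x b \<longleftrightarrow> (\<exists>z\<in>bs_sphere3 b. z \<noteq> VB 0 \<and> z \<in> bs_sphere3 x)"

lemma linked_eval:
  "\<forall>x\<in>{VA 15, VB 1, VB 13, VB 16, VC 8, VC 9, VD 15, VF 8, VF 9}. linked x (VA 2) \<longleftrightarrow> x \<in> {VD 15, VC 8, VB 1, VC 9, VF 9}"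
  "\<forall>x\<in>{VA 15, VB 1, VB 13, VB 16, VC 8, VC 9, VD 15, VF 8, VF 9}. linked x (VB 4) \<longleftrightarrow> x \<in> {VD 15, VC 8, VB 1, VB 16, VF 8}"
  "\<forall>x\<in>{VA 15, VB 1, VB 13, VB 16, VC 8, VC 9, VD 15, VF 8, VF 9}. linked x (VD 2) \<longleftrightarrow> x \<in> {VD 15, VC 8, VB 1, VA 15, VB 13}"
  "\<forall>x\<in>{VA 15, VB 13, VC 9, VF 9}. linked x (VC 8) \<longleftrightarrow> x \<in> {VA 15, VF 9}"
  "\<forall>x\<in>{VB 16, VF 8}. linked x (VD 15) \<longleftrightarrow> x = VB 16"
  by (simp_all only: linked_def bs_sphere3.simps eval_17 set_eval)

lemma base_nbrs_adj:
  "\<forall>x\<in>{VB 16, VF 8}. \<forall>y\<in>{VD 15, VC 8, VB 1}. y \<in> bs_sphere3 x \<longleftrightarrow> y = VC 8"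
  "\<forall>x\<in>{VC 9, VF 9}. \<forall>y\<in>{VD 15, VC 8, VB 1}. y \<in> bs_sphere3 x \<longleftrightarrow> y = VB 1"
  by (simp_all only: bs_sphere3.simps eval_17 set_eval)

text \<open>The nine neighbours other than \<open>VA 2\<close>, \<open>VB 4\<close>,
  \<open>VD 2\<close> fall into blocks: the triple \<open>VD 15\<close>, \<open>VC 8\<close>,
  \<open>VB 1\<close> is linked to all three of these, and three pairs are linked to one each. The
  vertices of the pair \<open>VB 16\<close>, \<open>VF 8\<close> are adjacent to \<open>VC 8\<close>
  alone in the triple, those of \<open>VC 9\<close>, \<open>VF 9\<close> to \<open>VB 1\<close>
  alone, so the triple is fixed pointwise. Being linked to \<open>VC 8\<close> or to
  \<open>VD 15\<close> then separates the two vertices of each pair.\<close>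

lemma automorphism_fixes_base_nbrs:
  assumes f: "f \<in> automorphisms Y_graph" and fixed: "f (VB 0) = VB 0" "f (VA 2) = VA 2" "f (VD 2) = VD 2"
    and v: "v \<in> bs_sphere3 (VB 0)"
  shows "f v = v"
proof -
  define N where "N = {VA 15, VB 1, VB 13, VB 16, VC 8, VC 9, VD 15, VF 8, VF 9}"
  have inj: "f u = f v \<longleftrightarrow> u = v" and adj: "f v \<in> bs_sphere3 (f u) \<longleftrightarrow> v \<in> bs_sphere3 u" for u v
    using f by (auto simp: automorphism_Y_iff bij_is_inj inj_eq)
  have surj: "surj f" using f by (simp add: automorphism_Y_iff bij_is_surj)
  \<comment> \<open>The base arc has only two common neighbours, and \<open>VD 2\<close> is its own
    image.\<close>
  have "f (VB 4) \<in> bs_sphere3 (VB 0) \<inter> bs_sphere3 (VA 2)"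
    using adj[of "VB 4" "VB 0"] adj[of "VB 4" "VA 2"] bs_sphere3_base_common unfolding fixed by blast
  then have B4: "f (VB 4) = VB 4"
    using inj[of "VB 4" "VD 2"] unfolding bs_sphere3_base_common fixed by auto
  have sphere: "bs_sphere3 (VB 0) = insert (VA 2) (insert (VB 4) (insert (VD 2) N))"
    unfolding N_def by (simp add: insert_commute)
  have N: "VA 2 \<notin> N" "VB 4 \<notin> N" "VD 2 \<notin> N" by (simp_all add: N_def)
  have fN: "f x \<in> N" if "x \<in> N" for x
  proof -
    have "f x \<in> bs_sphere3 (VB 0)" using adj[of x "VB 0"] that unfolding fixed sphere by blast
    moreover have "f x \<noteq> VA 2" "f x \<noteq> VB 4" "f x \<noteq> VD 2"
      using inj[of x "VA 2"] inj[of x "VB 4"] inj[of x "VD 2"] that N fixed B4 by auto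
    ultimately show ?thesis using sphere by blast
  qed
  have linked: "linked (f x) b \<longleftrightarrow> linked x b" if "f b = b" for x b
  proof
    assume "linked x b"
    then obtain z where "z \<in> bs_sphere3 b" "z \<noteq> VB 0" "z \<in> bs_sphere3 x" by (auto simp: linked_def)
    then have "f z \<in> bs_sphere3 b" "f z \<noteq> VB 0" "f z \<in> bs_sphere3 (f x)"
      using adj[of z b] adj[of z x] inj[of z "VB 0"] that fixed by simp_all
    then show "linked (f x) b" by (auto simp: linked_def)
  next
    assume "linked (f x) b"
    then obtain z where z: "z \<in> bs_sphere3 b" "z \<noteq> VB 0" "z \<in> bs_sphere3 (f x)" by (auto simp: linked_def)
    obtain z' where "z = f z'" using surj by (metis surjD)
    then have "z' \<in> bs_sphere3 b" "z' \<noteq> VB 0" "z' \<in> bs_sphere3 x"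
      using adj[of z' b] adj[of z' x] inj[of z' "VB 0"] that fixed z by simp_all
    then show "linked x b" by (auto simp: linked_def)
  qed
  note ev = linked_eval[folded N_def]
  have pat: "(f x \<in> {VD 15, VC 8, VB 1, VC 9, VF 9} \<longleftrightarrow> x \<in> {VD 15, VC 8, VB 1, VC 9, VF 9}) \<and>
     (f x \<in> {VD 15, VC 8, VB 1, VB 16, VF 8} \<longleftrightarrow> x \<in> {VD 15, VC 8, VB 1, VB 16, VF 8}) \<and>
     (f x \<in> {VD 15, VC 8, VB 1, VA 15, VB 13} \<longleftrightarrow> x \<in> {VD 15, VC 8, VB 1, VA 15, VB 13})" if "x \<in> N" for x
    using ev(1-3) fN[OF that] that linked[OF fixed(2), of x] linked[OF B4, of x] linked[OF fixed(3), of x] by metis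
  have three: "f x \<in> {VD 15, VC 8, VB 1}" if "x \<in> {VD 15, VC 8, VB 1}" for x
  proof -
    have "x \<in> N" using that by (auto simp: N_def)
    then show ?thesis using pat[of x] that by auto
  qed
  have "f (VB 16) \<in> {VB 16, VF 8}" using pat[of "VB 16"] fN[of "VB 16"] unfolding N_def by auto
  moreover have "f (VC 8) \<in> bs_sphere3 (f (VB 16))" using adj[of "VC 8" "VB 16"] by simp
  ultimately have C8: "f (VC 8) = VC 8"
    using base_nbrs_adj(1) three[of "VC 8"] by blast
  have "f (VC 9) \<in> {VC 9, VF 9}" using pat[of "VC 9"] fN[of "VC 9"] unfolding N_def by auto
  moreover have "f (VB 1) \<in> bs_sphere3 (f (VC 9))" using adj[of "VB 1" "VC 9"] by simp
  ultimately have B1: "f (VB 1) = VB 1"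
    using base_nbrs_adj(2) three[of "VB 1"] by blast
  have D15: "f (VD 15) = VD 15"
    using three[of "VD 15"] C8 B1 inj[of "VD 15" "VC 8"] inj[of "VD 15" "VB 1"] by auto
  have C9: "f (VC 9) = VC 9"
    using \<open>f (VC 9) \<in> {VC 9, VF 9}\<close> ev(4) linked[OF C8, of "VC 9"] by auto
  have F9: "f (VF 9) = VF 9"
  proof -
    have "f (VF 9) \<in> {VC 9, VF 9}" using pat[of "VF 9"] fN[of "VF 9"] B1 C8 D15 inj[of "VF 9"] unfolding N_def by auto
    then show ?thesis using C9 inj[of "VF 9" "VC 9"] by auto
  qed
  have A15: "f (VA 15) = VA 15"
  proof -
    have "f (VA 15) \<in> {VA 15, VB 13}" using pat[of "VA 15"] fN[of "VA 15"] unfolding N_def by auto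
    then show ?thesis using ev(4) linked[OF C8, of "VA 15"] by auto
  qed
  have B13: "f (VB 13) = VB 13"
  proof -
    have "f (VB 13) \<in> {VA 15, VB 13}" using pat[of "VB 13"] fN[of "VB 13"] unfolding N_def by auto
    then show ?thesis using A15 inj[of "VB 13" "VA 15"] by auto
  qed
  have B16: "f (VB 16) = VB 16"
    using \<open>f (VB 16) \<in> {VB 16, VF 8}\<close> ev(5) linked[OF D15, of "VB 16"] by auto
  have F8: "f (VF 8) = VF 8"
  proof -
    have "f (VF 8) \<in> {VB 16, VF 8}" using pat[of "VF 8"] fN[of "VF 8"] unfolding N_def by auto
    then show ?thesis using B16 inj[of "VF 8" "VB 16"] by auto
  qed
  from v show ?thesis
    unfolding sphere N_def using fixed B4 A15 B1 B13 B16 C8 C9 D15 F8 F9 by auto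
qed

lemma automorphism_fixes_nbrs:
  assumes f: "f \<in> automorphisms Y_graph" and fixed: "f a = a" "f b = b" "f c = c"
    and abc: "b \<in> bs_sphere3 a" "c \<in> bs_sphere3 a" "c \<in> bs_sphere3 b" and v: "v \<in> bs_sphere3 a"
  shows "f v = v"
proof -
  obtain g where g: "g \<in> bs_group" "g (VB 0) = a" "g (VA 2) = b" "g (VD 2) = c"
    using bs_group_triangle_transitive[OF abc] by blast
  define k where "k = inv_into UNIV g"
  have kg: "k (g v) = v" "g (k v) = v" for v
    using bs_group_inv_apply[OF g(1)] by (simp_all add: k_def)
  have k: "bs_aut k" using g(1) by (simp add: k_def bs_group_inv bs_group_aut)
  note ga = bs_group_aut[OF g(1)]
  have "k \<circ> f \<circ> g \<in> automorphisms Y_graph"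
    using f k ga by (simp add: automorphism_Y_iff bs_aut_sphere3 bij_comp) (simp add: bs_aut_def bij_comp)
  then have "(k \<circ> f \<circ> g) (k v) = k v"
  proof (rule automorphism_fixes_base_nbrs)
    show "(k \<circ> f \<circ> g) (VB 0) = VB 0" "(k \<circ> f \<circ> g) (VA 2) = VA 2" "(k \<circ> f \<circ> g) (VD 2) = VD 2"
      using kg(1)[of "VB 0"] kg(1)[of "VA 2"] kg(1)[of "VD 2"] by (simp_all add: g(2-4) fixed)
    show "k v \<in> bs_sphere3 (VB 0)"
      using v bs_aut_sphere3[OF ga, of "k v" "VB 0"] by (simp only: kg g(2))
  qed
  then show ?thesis by (metis comp_apply kg(2))
qed

text \<open>The property \<open>F\<close> spreads along edges: if it holds at \<open>a\<close>, then
  a neighbour \<open>b\<close> and a common neighbour \<open>c\<close> of both are fixed, and the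
  fixed triangle on \<open>b\<close>, \<open>a\<close>, \<open>c\<close> yields it at
  \<open>b\<close>. Connectedness does the rest.\<close>

lemma automorphism_rigid:
  assumes f: "f \<in> automorphisms Y_graph" and fixed: "f (VB 0) = VB 0" "f (VA 2) = VA 2" "f (VD 2) = VD 2"
  shows "f v = v"
proof -
  define F where "F a \<longleftrightarrow> f a = a \<and> (\<forall>w\<in>bs_sphere3 a. f w = w)" for a
  have base: "F (VB 0)"
    using fixed automorphism_fixes_base_nbrs[OF f fixed] by (simp add: F_def)
  have step: "F b" if a: "F a" and b: "b \<in> bs_sphere3 a" for a b
  proof -
    obtain g where g: "g \<in> bs_group" "g (VB 0) = a" "g (VA 2) = b"
      using bs_group_arc_transitive[OF b] by blast
    define c where "c = g (VD 2)"
    have "c \<in> bs_sphere3 a" "c \<in> bs_sphere3 b"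
      using bs_aut_sphere3[OF bs_group_aut[OF g(1)], of "VD 2" "VB 0"]
        bs_aut_sphere3[OF bs_group_aut[OF g(1)], of "VD 2" "VA 2"]
      unfolding g(2,3) c_def by simp_all
    moreover have "a \<in> bs_sphere3 b" using b bs_sphere3_sym by blast
    ultimately have "f w = w" if "w \<in> bs_sphere3 b" for w
      using automorphism_fixes_nbrs[OF f, of b a c w] a b that by (simp add: F_def)
    then show ?thesis using a b by (simp add: F_def)
  qed
  have "(VB 0, v) \<in> {(x, y). {x, y} \<in> edges Y_graph}\<^sup>*"
    using Y_connected by (simp add: graph_connected_def)
  then have "F v"
    by (induction rule: rtrancl_induct) (use base step in \<open>auto simp: Y_adj_iff\<close>)
  then show ?thesis by (simp add: F_def)
qed

text \<open>Some group element agrees with the automorphism on the base triangle, and by rigidity it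
  agrees everywhere.\<close>

lemma automorphisms_Y: "automorphisms Y_graph = bs_group"
proof
  show "bs_group \<subseteq> automorphisms Y_graph"
    using bs_aut_automorphism[OF bs_group_aut] by blast
  show "automorphisms Y_graph \<subseteq> bs_group"
  proof
    fix f assume f: "f \<in> automorphisms Y_graph"
    then have "f v \<in> bs_sphere3 (f u) \<longleftrightarrow> v \<in> bs_sphere3 u" for u v by (simp add: automorphism_Y_iff)
    then obtain g where g: "g \<in> bs_group" "g (VB 0) = f (VB 0)" "g (VA 2) = f (VA 2)" "g (VD 2) = f (VD 2)"
      using bs_group_triangle_transitive[of "f (VA 2)" "f (VB 0)" "f (VD 2)"] by auto
    define k where "k = inv_into UNIV g"
    have kg: "k (g v) = v" "g (k v) = v" for v
      using bs_group_inv_apply[OF g(1)] by (simp_all add: k_def)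
    have k: "bs_aut k" using g(1) by (simp add: k_def bs_group_inv bs_group_aut)
    have "k \<circ> f \<in> automorphisms Y_graph"
      using f k by (simp add: automorphism_Y_iff bs_aut_sphere3 bij_comp) (simp add: bs_aut_def bij_comp)
    then have "(k \<circ> f) v = v" for v
      by (rule automorphism_rigid) (simp_all add: kg flip: g(2-4))
    then have "f v = g v" for v by (metis comp_apply kg(2))
    then have "f = g" by blast
    with g(1) show "f \<in> bs_group" by simp
  qed
qed

subsection \<open>The automorphism group\<close>

definition vec2 :: "17 \<Rightarrow> 17 \<Rightarrow> 17^2" where
  "vec2 x y = vector [x, y]"

lemma vec2_nth [simp]: "vec2 x y $ 1 = x" "vec2 x y $ 2 = y"
  by (simp_all add: vec2_def vector_2)

lemma sextet_cone_None: "vec2 1 0 \<in> sextet_cone v \<longleftrightarrow> None \<in> sextet v"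
proof -
  have "on_point p (vec2 1 0) \<longleftrightarrow> p = None" for p by (cases p) simp_all
  then show ?thesis by (simp add: sextet_cone_def)
qed

lemma sextet_cone_Some: "vec2 t 1 \<in> sextet_cone v \<longleftrightarrow> Some t \<in> sextet v"
proof -
  have "on_point p (vec2 t 1) \<longleftrightarrow> p = Some t" for p by (cases p) auto
  then show ?thesis by (simp add: sextet_cone_def)
qed

text \<open>No other sextet contains the five points infinity, 0, 2, 8, 9.\<close>

lemma sextet_cone_base:
  assumes "sextet_cone v = sextet_cone (VB 0)"
  shows "v = VB 0"
proof -
  have "\<forall>v. None \<in> sextet v \<longrightarrow> Some 0 \<in> sextet v \<longrightarrow> Some 2 \<in> sextet v \<longrightarrow> Some 8 \<in> sextet v \<longrightarrow>
      Some 9 \<in> sextet v \<longrightarrow> v = VB 0"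
    by (simp only: all_vertices sextet.simps eval_17 option.inject option.distinct set_eval)
  moreover have "None \<in> sextet v" "Some 0 \<in> sextet v" "Some 2 \<in> sextet v" "Some 8 \<in> sextet v" "Some 9 \<in> sextet v"
    unfolding sextet_cone_None[symmetric] sextet_cone_Some[symmetric] assms
    unfolding sextet_cone_None sextet_cone_Some by simp_all
  ultimately show ?thesis by blast
qed

lemma sextet_cone_inj:
  assumes "sextet_cone u = sextet_cone v"
  shows "u = v"
proof -
  obtain g where g: "g \<in> bs_group" "g (VB 0) = u" using bs_group_vertex_transitive by blast
  obtain M where M: "realizes M g" using g(1) by (auto simp: bs_group_def)
  define k where "k = inv_into UNIV g"
  have kg: "k (g v) = v" "g (k v) = v" for v
    using bs_group_inv_apply[OF g(1)] by (simp_all add: k_def)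
  have "w \<in> sextet_cone (k v) \<longleftrightarrow> w \<in> sextet_cone (VB 0)" for w
  proof -
    have "w \<in> sextet_cone (k v) \<longleftrightarrow> M *v w \<in> sextet_cone (g (k v))"
      using M by (simp add: realizes_def)
    also have "\<dots> \<longleftrightarrow> M *v w \<in> sextet_cone (g (VB 0))" by (simp only: kg g(2) assms)
    also have "\<dots> \<longleftrightarrow> w \<in> sextet_cone (VB 0)" using M by (simp add: realizes_def)
    finally show ?thesis .
  qed
  then have "k v = VB 0" using sextet_cone_base by blast
  then show ?thesis using kg(2) g(2) by metis
qed

text \<open>The matrix carries the cone of \<open>v\<close> to that of \<open>g v\<close>, and
  different vertices have different cones.\<close>

lemma realizes_unique:
  assumes "realizes M g" "realizes M g'"
  shows "g = g'"
proof
  fix v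
  obtain N where N: "M ** N = mat 1" using SL2_inverse assms(1) unfolding realizes_def by blast
  then have MN: "M *v (N *v w) = w" for w by (simp add: matrix_vector_mul_assoc)
  have "w \<in> sextet_cone (g v) \<longleftrightarrow> w \<in> sextet_cone (g' v)" for w
    using assms MN unfolding realizes_def by metis
  then show "g v = g' v" using sextet_cone_inj by blast
qed

section \<open>The kernel of the action\<close>

lemma realizes_id_lower:
  assumes "realizes (mat2 a b c d) id"
  shows "c = 0"
proof (rule ccontr)
  assume c: "c \<noteq> 0"
  \<comment> \<open>The matrix moves infinity to t = a/c. The sextet of \<open>VB (t - 1)\<close>
    contains infinity but not t, because 1 is none of its offsets 0, 2, 8, 9, 15.\<close>
  define t where "t = a * c ^ 15"
  define v where "v = VB (t + 16)"
  have "vec2 1 0 \<in> sextet_cone v" by (simp add: sextet_cone_None v_def)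
  then have "mat2 a b c d *v vec2 1 0 \<in> sextet_cone v" using assms by (simp add: realizes_def)
  then obtain p where p: "p \<in> sextet v" "on_point p (mat2 a b c d *v vec2 1 0)" by (auto simp: sextet_cone_def)
  then obtain s where s: "p = Some s" "a = s * c" using c by (cases p) (simp_all add: mat2_vec)
  then have "t = s" by (simp add: t_def mult.assoc inverse_17[OF c])
  then have "Some t \<in> sextet v" using p(1) s(1) by simp
  then show False by (simp add: v_def add.assoc numeral_17)
qed

lemma realizes_id_conj:
  assumes M: "realizes M id" and N: "realizes N g" "N ** N' = mat 1" "N' ** N = mat 1"
  shows "realizes (N' ** M ** N) id"
proof -
  have "realizes (N' ** M ** N) (inv_into UNIV g \<circ> id \<circ> g)"
    by (intro realizes_comp M N(1) realizes_inv[OF N(1,2)])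
  moreover have "inv_into UNIV g \<circ> id \<circ> g = id"
    using N(1) by (simp add: realizes_def bs_aut_def bij_is_inj fun_eq_iff)
  ultimately show ?thesis by simp
qed

text \<open>A matrix acting trivially on the vertices fixes infinity, and by conjugation also the
  points 0 and 1. Three fixed points make it scalar. Conversely, an invertible scalar preserves
  every line of vectors.\<close>

lemma realizes_id_iff:
  assumes "det M = 1"
  shows "realizes M id \<longleftrightarrow> (\<exists>a. M = mat a)"
proof
  assume M: "realizes M id"
  obtain a b c d where m: "M = mat2 a b c d" by (rule mat2_exhaust)
  have c: "c = 0" using M realizes_id_lower unfolding m by blast
  have "realizes (mat2 0 1 (- 1) 0 ** M ** mat2 0 (- 1) 1 0) id"
    by (rule realizes_id_conj[OF M realizes_tau]) (simp_all add: mat2_mult mat_mat2)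
  then have "realizes (mat2 d (- c) (- b) a) id" by (simp add: m mat2_mult)
  from realizes_id_lower[OF this] have b: "b = 0" by simp
  \<comment> \<open>The conjugating matrix takes infinity to the point 1.\<close>
  have "realizes (mat2 1 0 (- 1) 1 ** M ** mat2 1 0 1 1) id"
    by (rule realizes_id_conj[OF M realizes_lower]) (simp_all add: mat2_mult mat_mat2)
  then have "realizes (mat2 a 0 (d - a) d) id" by (simp add: m mat2_mult b c)
  from realizes_id_lower[OF this] have "a = d" by simp
  with b c m show "\<exists>a. M = mat a" by (auto simp: mat_mat2)
next
  assume "\<exists>a. M = mat a"
  then obtain a where m: "M = mat2 a 0 0 a" by (auto simp: mat_mat2)
  have aa: "a * a = 1" using assms by (simp add: m det_mat2)
  have cancel: "a * x = a * y \<longleftrightarrow> x = y" for x y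
  proof
    assume "a * x = a * y"
    then have "a * (a * x) = a * (a * y)" by (rule arg_cong)
    then show "x = y" by (simp add: mult.assoc[symmetric] aa)
  qed simp
  have "on_point p (M *v w) \<longleftrightarrow> on_point p w" for p w
    using cancel[of "w $ 2" 0] cancel[of "w $ 1"]
    by (cases p) (simp_all add: m mat2_vec mult.left_commute[of _ a])
  then show "realizes M id"
    using assms by (simp add: realizes_def bs_aut_id sextet_cone_def)
qed

definition realization :: "17^2^2 \<Rightarrow> bs_vertex \<Rightarrow> bs_vertex" where
  "realization M = (THE g. realizes M g)"

lemma realization_eqI: "realizes M g \<Longrightarrow> realization M = g"
  unfolding realization_def using realizes_unique by blast

lemma realizes_realization: "det M = 1 \<Longrightarrow> realizes M (realization M)"
  using realizes_ex realization_eqI by blast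

lemma group_SL2: "group (SL :: ('a::comm_ring_1^2^2) monoid)"
proof (rule groupI)
  fix M :: "'a^2^2" assume "M \<in> carrier SL"
  then have M: "det M = 1" by (simp add: SL_def)
  then obtain N where N: "N ** M = mat 1" using SL2_inverse by blast
  then have "det N * det M = 1" by (metis det_I det_mul)
  with M N show "\<exists>N\<in>carrier SL. N \<otimes>\<^bsub>SL\<^esub> M = \<one>\<^bsub>SL\<^esub>" by (auto simp: SL_def)
qed (simp_all add: SL_def det_mul matrix_mul_assoc)

text \<open>The vertex set is the whole type, so the restrictions in \<open>BijGroup\<close>
  disappear and the product is plain composition.\<close>

lemma aut_group_Y_sel:
  "carrier (aut_group Y_graph) = bs_group" "\<one>\<^bsub>aut_group Y_graph\<^esub> = id"
  "g \<in> bs_group \<Longrightarrow> h \<in> bs_group \<Longrightarrow> g \<otimes>\<^bsub>aut_group Y_graph\<^esub> h = g \<circ> h"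
  using bs_group_bij by (auto simp: aut_group_def automorphisms_Y BijGroup_def Bij_def compose_def fun_eq_iff)

lemma group_aut_group_Y: "group (aut_group Y_graph)"
proof (rule groupI)
  fix g assume "g \<in> carrier (aut_group Y_graph)"
  then have g: "g \<in> bs_group" by (simp add: aut_group_Y_sel)
  then have "inv_into UNIV g \<circ> g = id" by (simp add: fun_eq_iff bs_group_inv_apply)
  then show "\<exists>h\<in>carrier (aut_group Y_graph). h \<otimes>\<^bsub>aut_group Y_graph\<^esub> g = \<one>\<^bsub>aut_group Y_graph\<^esub>"
    using g bs_group_inv by (auto simp: aut_group_Y_sel intro!: bexI[of _ "inv_into UNIV g"])
qed (simp_all add: aut_group_Y_sel bs_group_comp bs_group_id comp_assoc)

text \<open>The first isomorphism theorem for \<open>realization\<close>, whose kernel is the set of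
  scalar matrices by \<open>realizes_id_iff\<close>.\<close>

lemma aut_group_Y_iso_PSL: "aut_group Y_graph \<cong> (PSL :: (17^2^2) set monoid)"
proof -
  let ?A = "aut_group Y_graph"
  have mem: "realization M \<in> bs_group" if "M \<in> carrier SL" for M
    using that realizes_realization by (auto simp: SL_def bs_group_def)
  have hom: "group_hom SL ?A realization"
  proof (intro group_hom.intro group_hom_axioms.intro homI group_SL2 group_aut_group_Y)
    show "realization M \<in> carrier ?A" if "M \<in> carrier SL" for M
      using mem[OF that] by (simp add: aut_group_Y_sel)
    fix M N :: "17^2^2" assume MN: "M \<in> carrier SL" "N \<in> carrier SL"
    then have "realizes (M ** N) (realization M \<circ> realization N)"
      by (intro realizes_comp realizes_realization) (simp_all add: SL_def)
    then show "realization (M \<otimes>\<^bsub>SL\<^esub> N) = realization M \<otimes>\<^bsub>?A\<^esub> realization N"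
      using mem MN by (simp add: aut_group_Y_sel realization_eqI SL_def)
  qed
  have "realization M = id \<longleftrightarrow> (\<exists>a. M = mat a)" if "det M = 1" for M
    using realizes_id_iff[OF that] realizes_realization[OF that] realization_eqI[of M id] by metis
  then have ker: "kernel SL ?A realization = {M \<in> carrier SL. \<exists>a. M = mat a}"
    by (auto simp: kernel_def aut_group_Y_sel SL_def)
  have "g \<in> realization ` carrier SL" if "g \<in> bs_group" for g
    using that realization_eqI by (force simp: bs_group_def realizes_def SL_def image_iff)
  then have surj: "realization ` carrier SL = carrier ?A"
    using mem by (auto simp: aut_group_Y_sel)
  have "(\<lambda>X. the_elem (realization ` X)) \<in> iso (SL Mod (kernel SL ?A realization)) ?A"
    by (rule group_hom.FactGroup_iso_set[OF hom surj])
  then have "(PSL :: (17^2^2) set monoid) \<cong> ?A"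
    unfolding PSL_def ker by (auto simp: is_iso_def)
  moreover have "group (PSL :: (17^2^2) set monoid)"
    unfolding PSL_def ker[symmetric]
    by (rule normal.factorgroup_is_group[OF group_hom.normal_kernel[OF hom]])
  ultimately show ?thesis by (metis group.iso_sym)
qed

theorem theorem7:
  shows "\<exists>(\<L> :: bs_vertex graph set) (\<Omega> :: bs_vertex graph \<Rightarrow> bs_vertex graph set).
    card \<L> = 102 \<and>
    \<L> \<subseteq> induced_copies Y_graph (line_graph (hypercube 3)) \<and>
    (\<forall>y\<in>\<L>. admissible y (\<Omega> y)) \<and>
    \<comment> \<open>(1)\<close>
    graph_connected Y_graph \<and> graph_Union \<L> = Y_graph \<and>
    \<comment> \<open>(2)\<close>
    (\<forall>e\<in>edges Y_graph. card {y \<in> \<L>. e \<in> edges y} = 4) \<and>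
    \<comment> \<open>(3)\<close>
    (\<forall>y\<in>\<L>. \<forall>X \<in> triangles y \<union> \<Omega> y. card {y' \<in> \<L>. subgraph X y'} = 2) \<and>
    \<comment> \<open>(4)\<close>
    (\<forall>y\<in>\<L>. \<forall>y'\<in>\<L>. \<forall>T \<in> triangles y \<inter> triangles y'. y \<noteq> y' \<longrightarrow>
       (\<exists>!K. K \<in> copies Y_graph (complete_graph 4) \<and> subgraph T K)) \<and>
    \<comment> \<open>(5)\<close>
    (\<forall>vs. chordless_cycle Y_graph vs \<and> length vs = 4 \<longrightarrow>
       (\<forall>y\<in>\<L>. \<forall>y'\<in>\<L>. subgraph (cycle_graph vs) y \<and> subgraph (cycle_graph vs) y' \<longrightarrow> y = y')) \<and>
    \<comment> \<open>(6)\<close>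
    strongly_zipped_LQ3_UH Y_graph \<L> \<Omega> \<and>
    \<comment> \<open>(7)\<close>
    K4_LQ3_UH Y_graph \<L> \<Omega> \<and>
    \<comment> \<open>(8)\<close>
    aut_group Y_graph \<cong> (PSL :: (17^2^2) set monoid)"
proof (intro exI[of _ cubocts] exI[of _ Omega] conjI ballI allI impI)
  show "card {y' \<in> cubocts. subgraph X y'} = 2" if "y \<in> cubocts" "X \<in> triangles y \<union> Omega y" for y X
    using that card_members_triangle[OF triangles_subgraph[OF _ cubocts_subgraph]] card_members_path by blast
  show "\<exists>!K. K \<in> copies Y_graph (complete_graph 4) \<and> subgraph T K"
    if "y \<in> cubocts" "T \<in> triangles y \<inter> triangles y'" for y y' T
    using that triangle_unique_K4[OF triangles_subgraph[OF _ cubocts_subgraph]] by blast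
  show "y = y'" if "chordless_cycle Y_graph vs \<and> length vs = 4" "y \<in> cubocts" "y' \<in> cubocts"
    "subgraph (cycle_graph vs) y \<and> subgraph (cycle_graph vs) y'" for vs y y'
    using that hole_unique_member by blast
qed (simp_all add: card_cubocts cubocts_induced cubocts_admissible Y_connected
    union_cubocts card_members_edge strongly_zipped K4_zipped aut_group_Y_iso_PSL)

end
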